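(* For every integer $k\ge1$ let $$f_k(\tau)=\frac{\eta(4\tau)^{8k-2}\,\eta(8\tau)^4}{\eta(2\tau)^{4k}},\qquad P_k(t)=(1+t)^{2k+1}A_{2k}(t)-2^{2k}\,t\,A_{2k}(t^2).$$ Then $P_k(t)\in\mathbb{Z}[t]$ has degree $4k$, and there is a cusp form $T_{2k+1}\in S_{2k+1}(8,\chi_{-4})$ such that $$f_k(\tau)=\begin{cases}\dfrac{1}{2^{2k}E_{2k}}\displaystyle\sum_{n\ge1}\chi_{-4}(n)\frac{q^{n}P_k(q^{n})}{(1-q^{2n})^{2k+1}}+T_{2k+1}(\tau), & k\equiv0\pmod2,\\[4mm] -\dfrac{1}{E_{2k}}\displaystyle\sum_{n\ge1}\chi_{-4}(n)\frac{q^{2n}A_{2k}(q^{2n})}{(1-q^{2n})^{2k+1}}+T_{2k+1}(\tau), & k\equiv1\pmod2.\end{cases}$$ Moreover, if both sides of this identity are multiplied by $(1-q)^{2k+1}$ and $q\to1^-$, the identity specializes to the evaluation of the Dirichlet beta function at $2k+1$: both sides have finite limits, and equating these limits gives, after rearrangement, $$\beta(2k+1)=\frac{(-1)^kE_{2k}}{4^{k+1}(2k)!}\,\pi^{2k+1}.$$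
   Context: Here $\tau$ lies in the upper half-plane, $q=e^{2\pi i\tau}$, and $\eta(\tau)=q^{1/24}\prod_{n\ge1}(1-q^n)$; the limit $q\to1^-$ is taken through real $q\in(0,1)$, i.e. along $\tau=iy$, $y\to0^+$. $\chi_{-4}=\left(\frac{-4}{\cdot}\right)$ is the nontrivial Dirichlet character mod $4$. $S_k(N,\chi)$ denotes the complex vector space of cusp forms of weight $k$ on $\Gamma_0(N)$ with Nebentypus $\chi$. The Euler numbers $E_n$ are defined by $\frac{2}{e^{z}+e^{-z}}=\sum_{n\ge0}E_n\frac{z^n}{n!}$. The Eulerian polynomials $A_n(x)$ are defined by $\sum_{n\ge0}A_n(x)\frac{z^n}{n!}=\frac{x-1}{x-e^{(x-1)z}}$. The Dirichlet beta function is $\beta(s)=\sum_{n\ge1}\chi_{-4}(n)n^{-s}=\sum_{n\ge0}\frac{(-1)^n}{(2n+1)^s}$ for $\operatorname{Re}(s)>0$. *)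

theory Defs
  imports "HOL-Complex_Analysis.Complex_Analysis"
begin

definition upper_half_plane :: "complex set" where
  "upper_half_plane = {\<tau>. Im \<tau> > 0}"

definition nome :: "complex \<Rightarrow> complex" where
  "nome \<tau> = exp (2 * of_real pi * \<i> * \<tau>)"

text \<open>The factor \<open>q\<^sup>1\<^sup>/\<^sup>2\<^sup>4\<close> means \<open>exp (2\<pi>\<i>\<tau>/24)\<close>, not a principal power of \<open>q\<close>.\<close>

definition dedekind_eta :: "complex \<Rightarrow> complex" where
  "dedekind_eta \<tau> = exp (2 * of_real pi * \<i> * \<tau> / 24) * (\<Prod>n. 1 - nome \<tau> ^ Suc n)"

text \<open>The Kronecker symbol \<open>(-4/n)\<close>.\<close>

definition chi_m4 :: "int \<Rightarrow> complex" where
  "chi_m4 n = (if n mod 4 = 1 then 1 else if n mod 4 = 3 then -1 else 0)"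


text \<open>
  Modular forms are functions on the upper half-plane; they are represented by total functions
  on \<open>complex\<close> whose values elsewhere are irrelevant. Vanishing at the cusps is required of
  \<open>f|\<^sub>k\<gamma>\<close> for every \<open>\<gamma> \<in> SL\<^sub>2(\<int>)\<close>, which covers all cusps of \<open>\<Gamma>\<^sub>0(N)\<close>; the
  limit is uniform in the real part.
\<close>

definition weight_slash ::
    "nat \<Rightarrow> int \<Rightarrow> int \<Rightarrow> int \<Rightarrow> int \<Rightarrow> (complex \<Rightarrow> complex) \<Rightarrow> complex \<Rightarrow> complex" where
  "weight_slash k a b c d f \<tau> =
     f ((of_int a * \<tau> + of_int b) / (of_int c * \<tau> + of_int d)) / (of_int c * \<tau> + of_int d) ^ k"

definition cusp_forms :: "nat \<Rightarrow> nat \<Rightarrow> (int \<Rightarrow> complex) \<Rightarrow> (complex \<Rightarrow> complex) set" where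
  "cusp_forms k N \<epsilon> = {f.
     f holomorphic_on upper_half_plane \<and>
     (\<forall>a b c d. a * d - b * c = 1 \<and> int N dvd c \<longrightarrow>
        (\<forall>\<tau>\<in>upper_half_plane. weight_slash k a b c d f \<tau> = \<epsilon> d * f \<tau>)) \<and>
     (\<forall>a b c d. a * d - b * c = 1 \<longrightarrow>
        (weight_slash k a b c d f \<longlongrightarrow> 0) (filtercomap Im at_top))}"


definition euler_number :: "nat \<Rightarrow> real" where
  "euler_number n = fact n * fps_nth (2 / (fps_exp 1 + fps_exp (-1))) n"

text \<open>
  The generating function of the Eulerian polynomials is read in the ring \<open>\<complex>[x][[z]]\<close>,
  an integral domain, so that the quotient \<open>(x - 1) / (x - e\<^sup>(\<^sup>x\<^sup>-\<^sup>1\<^sup>)\<^sup>z)\<close> denotes the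
  unique \<open>F\<close> with \<open>F * (x - e\<^sup>(\<^sup>x\<^sup>-\<^sup>1\<^sup>)\<^sup>z) = x - 1\<close>; existence and uniqueness are shown below.
\<close>

definition eulerian_denom :: "complex poly fps" where
  "eulerian_denom = fps_const [:0, 1:] - Abs_fps (\<lambda>n. smult (1 / fact n) ([:-1, 1:] ^ n))"

definition eulerian_gf :: "(nat \<Rightarrow> complex poly) \<Rightarrow> complex poly fps" where
  "eulerian_gf A = Abs_fps (\<lambda>n. smult (1 / fact n) (A n))"

definition eulerian_poly :: "nat \<Rightarrow> complex poly" where
  "eulerian_poly = (THE A. eulerian_gf A * eulerian_denom = fps_const [:-1, 1:])"

lemma eulerian_gf_ex1: "\<exists>!A. eulerian_gf A * eulerian_denom = fps_const [:-1, 1:]"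
proof -
  define C :: "complex poly fps"
    where "C = Abs_fps (\<lambda>n. smult (1 / fact (Suc n)) ([:-1, 1:] ^ n))"
  define D where "D = 1 - fps_X * C"
  have denom: "eulerian_denom = fps_const [:-1, 1:] * D"
  proof (rule fps_ext)
    fix n
    show "fps_nth eulerian_denom n = fps_nth (fps_const [:-1, 1:] * D) n"
      by (cases n) (simp_all add: eulerian_denom_def D_def C_def one_pCons)
  qed
  have D0: "fps_nth D 0 = 1"
    by (simp add: D_def)
  have inv: "D * fps_right_inverse D 1 = 1"
    by (rule fps_right_inverse) (simp add: D0)
  define A where "A = (\<lambda>n. smult (fact n) (fps_nth (fps_right_inverse D 1) n))"
  have "eulerian_gf A = fps_right_inverse D 1"
    by (rule fps_ext) (simp add: eulerian_gf_def A_def)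
  then have ex: "eulerian_gf A * eulerian_denom = fps_const [:-1, 1:]"
    using inv by (simp add: denom mult.commute mult.left_commute)
  have "fps_nth eulerian_denom 0 \<noteq> 0"
    by (simp add: denom D0)
  then have nz: "eulerian_denom \<noteq> 0"
    by auto
  have uniq: "B = A" if "eulerian_gf B * eulerian_denom = fps_const [:-1, 1:]" for B
  proof
    fix n
    have "eulerian_gf B = eulerian_gf A"
      using that ex nz by (metis mult_right_cancel)
    then have "fps_nth (eulerian_gf B) n = fps_nth (eulerian_gf A) n"
      by simp
    then have "smult (fact n) (smult (1 / fact n) (B n)) = smult (fact n) (smult (1 / fact n) (A n))"
      by (simp only: eulerian_gf_def fps_nth_Abs_fps)
    then show "B n = A n"
      by simp
  qed
  show ?thesis
    using ex uniq by blast
qed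

lemma eulerian_poly_gf: "eulerian_gf eulerian_poly * eulerian_denom = fps_const [:-1, 1:]"
  unfolding eulerian_poly_def by (rule theI'[OF eulerian_gf_ex1])

definition dirichlet_beta :: "complex \<Rightarrow> complex" where
  "dirichlet_beta s = (\<Sum>n. chi_m4 (int (Suc n)) * of_nat (Suc n) powr (- s))"


definition f_eta :: "nat \<Rightarrow> complex \<Rightarrow> complex" where
  "f_eta k \<tau> = dedekind_eta (4 * \<tau>) ^ (8 * k - 2) * dedekind_eta (8 * \<tau>) ^ 4
                 / dedekind_eta (2 * \<tau>) ^ (4 * k)"

definition P_poly :: "nat \<Rightarrow> complex poly" where
  "P_poly k = [:1, 1:] ^ (2 * k + 1) * eulerian_poly (2 * k)
                - smult (2 ^ (2 * k)) ([:0, 1:] * pcompose (eulerian_poly (2 * k)) (monom 1 2))"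

definition lambert_term :: "nat \<Rightarrow> complex \<Rightarrow> nat \<Rightarrow> complex" where
  "lambert_term k \<tau> n = (let q = nome \<tau> in
     chi_m4 (int n) *
       (if even k
        then q ^ n * poly (P_poly k) (q ^ n) / (1 - q ^ (2 * n)) ^ (2 * k + 1)
        else q ^ (2 * n) * poly (eulerian_poly (2 * k)) (q ^ (2 * n))
               / (1 - q ^ (2 * n)) ^ (2 * k + 1)))"

definition lambert_coeff :: "nat \<Rightarrow> complex" where
  "lambert_coeff k =
     (if even k then 1 / (2 ^ (2 * k) * of_real (euler_number (2 * k)))
      else - 1 / of_real (euler_number (2 * k)))"

definition rhs_side :: "nat \<Rightarrow> (complex \<Rightarrow> complex) \<Rightarrow> complex \<Rightarrow> complex" where
  "rhs_side k T \<tau> = lambert_coeff k * (\<Sum>n. lambert_term k \<tau> (Suc n)) + T \<tau>"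

end

theory Submission
  imports Defs "HOL-Real_Asymp.Real_Asymp"
begin

text \<open>
  Both \<open>f\<^sub>k\<close> and the Lambert series are modular of weight \<open>2k+1\<close> on \<open>\<Gamma>\<^sub>0(8)\<close> with
  character \<open>\<chi>\<^sub>-\<^sub>4\<close>, so their difference is a cusp form as soon as the constant terms agree at
  the four cusps \<open>\<infinity>, 0, 1/2, 1/4\<close>. One has \<open>f\<^sub>k(\<tau>) = g(\<tau>)\<^sup>2\<^sup>k g(2\<tau>)\<close> with
  \<open>g(\<tau>) = \<eta>(4\<tau>)\<^sup>4/\<eta>(2\<tau>)\<^sup>2\<close> of weight one on \<open>\<Gamma>\<^sub>0(4)\<close>; its behaviour follows from
  \<open>\<eta>(-1/\<tau>)\<^sup>2 = -i\<tau> \<eta>(\<tau>)\<^sup>2\<close>, which is the integrated form of the quasi-modularity of the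
  logarithmic derivative of \<open>\<eta>\<close> (Eisenstein's conditionally convergent double series). By the
  Lipschitz formula the Lambert series is a combination of \<open>G(\<tau>)\<close> and \<open>G(2\<tau>)\<close> for the lattice
  sum \<open>G(\<tau>) = \<Sum> \<chi>\<^sub>-\<^sub>4(m) (m\<tau>+n)\<close> to the power \<open>-(2k+1)\<close>, whose constant terms are multiples
  of \<open>\<beta>(2k+1)\<close>. The latter is the Taylor coefficient of order \<open>2k\<close> of \<open>\<pi> cot \<pi>z\<close> at
  \<open>z = 1/4\<close>, whose even part around that point is a secant.
\<close>

section \<open>Eulerian polynomials\<close>

text \<open>The parity split is forced by the constant terms. At 1/2 only G(2\<tau>) contributes,
  because \<chi>(2) = 0, and this fixes its coefficient uniformly in k. At 0 the constant term of
  f_k carries the sign (-1)^k; G(2\<tau>) alone gives the sign needed for odd k, and for even k a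
  multiple of G(\<tau>), invisible at the other three cusps, reverses it. The comparison requires
  the powers of pi to cancel, so the value of \<beta>(2k+1) is established beforehand, independently
  of the modular identity. The limit q -> 1 of the right side is then inherited from f_k and not
  computed from the series. The analytic obstacle is weight two. Lattice sums of weight 2k+1 \<ge> 3
  converge absolutely, whereas the series behind the logarithmic derivative of \<eta> depends on the
  order of summation, and this dependence produces the factor \<tau> in the inversion formula. Only
  the square of \<eta> is inverted, so no root of -i\<tau> has to be chosen; this suffices because
  all exponents in f_k are even.\<close>

lemma eulerian_poly_0: "eulerian_poly 0 = 1"
proof -
  have "fps_nth (eulerian_gf eulerian_poly * eulerian_denom) 0 = [:-1, 1:]"
    by (simp add: eulerian_poly_gf)
  hence "eulerian_poly 0 * [:-1, 1:] = 1 * [:-1, 1:]"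
    by (simp add: eulerian_gf_def eulerian_denom_def one_pCons)
  moreover have "[:-1, 1:] \<noteq> (0 :: complex poly)" by simp
  ultimately show ?thesis by (metis mult_right_cancel)
qed

text \<open>Coefficient of z^n in the defining identity. The constant coefficient of
  \<open>eulerian_denom\<close> is x - 1, so the last term contributes A_n itself; all terms share
  the factor (x - 1)/n!, and cancelling it leaves the recursion.\<close>

lemma eulerian_poly_rec:
  assumes "n > 0"
  shows "eulerian_poly n =
    (\<Sum>k<n. smult (of_nat (n choose k)) (eulerian_poly k * [:-1, 1:] ^ (n - Suc k)))"
proof -
  define L where "L = ([:-1, 1:] :: complex poly)"
  have nz: "L \<noteq> 0" by (simp add: L_def)
  have denom: "fps_nth eulerian_denom j = (if j = 0 then L else - smult (1 / fact j) (L ^ j))" for j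
    by (simp add: eulerian_denom_def L_def one_pCons)
  have "0 = fps_nth (eulerian_gf eulerian_poly * eulerian_denom) n"
    using assms by (simp add: eulerian_poly_gf)
  also have "\<dots> = (\<Sum>i\<le>n. smult (1 / fact i) (eulerian_poly i) * fps_nth eulerian_denom (n - i))"
    by (simp add: fps_mult_nth eulerian_gf_def atLeast0AtMost)
  also have "\<dots> = smult (1 / fact n) (eulerian_poly n) * L +
      (\<Sum>i<n. smult (1 / fact i) (eulerian_poly i) * fps_nth eulerian_denom (n - i))"
    by (subst lessThan_Suc_atMost [symmetric], subst sum.lessThan_Suc) (simp add: denom)
  also have "(\<Sum>i<n. smult (1 / fact i) (eulerian_poly i) * fps_nth eulerian_denom (n - i))
      = - (\<Sum>i<n. smult (1 / fact n) (smult (of_nat (n choose i)) (eulerian_poly i * L ^ (n - Suc i)))) * L"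
    unfolding sum_negf [symmetric] sum_distrib_right
  proof (rule sum.cong, goal_cases)
    case (2 i)
    hence i: "i < n" by simp
    have "L ^ (n - i) = L ^ (n - Suc i) * L"
      using i by (metis Suc_diff_Suc power_Suc2)
    moreover have "(1 / fact (n - i)) * (1 / fact i) = (1 / fact n) * (of_nat (n choose i) :: complex)"
      using i by (simp add: binomial_fact field_simps)
    ultimately have "smult (1 / fact (n - i)) (smult (1 / fact i) (eulerian_poly i * L ^ (n - i))) =
        smult (1 / fact n) (smult (of_nat (n choose i)) (eulerian_poly i * L ^ (n - Suc i))) * L"
      by (simp only: smult_smult mult_smult_left mult.assoc)
    moreover have "fps_nth eulerian_denom (n - i) = - smult (1 / fact (n - i)) (L ^ (n - i))"
      using i by (simp add: denom)
    ultimately show ?case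
      by (simp only: mult_smult_left mult_smult_right mult_minus_right mult_minus_left)
  qed simp
  finally have eq0: "0 = smult (1 / fact n) (eulerian_poly n) * L +
     - (\<Sum>i<n. smult (1 / fact n) (smult (of_nat (n choose i)) (eulerian_poly i * L ^ (n - Suc i)))) * L" .
  have cancel: "x = y" if "0 = smult c x * z + - (smult c y) * z" "z \<noteq> 0" "c \<noteq> 0"
    for x y z :: "complex poly" and c
  proof -
    have "smult c (x - y) * z = 0"
      using that(1) by (simp add: smult_diff_right left_diff_distrib)
    thus ?thesis using that(2,3) by simp
  qed
  have "smult c (sum f S) = (\<Sum>i\<in>S. smult c (f i))" for c and f :: "nat \<Rightarrow> complex poly" and S
    by (induction S rule: infinite_finite_induct) (simp_all add: smult_add_right)
  from cancel[OF eq0[folded this] nz]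
  have "eulerian_poly n = (\<Sum>i<n. smult (of_nat (n choose i)) (eulerian_poly i * L ^ (n - Suc i)))"
    by simp
  thus ?thesis by (simp only: L_def)
qed

section \<open>Integrality and degree of P_k\<close>

definition int_poly :: "complex poly \<Rightarrow> bool" where
  "int_poly p \<longleftrightarrow> (\<forall>i. coeff p i \<in> \<int>)"

lemma int_poly_add: "int_poly p \<Longrightarrow> int_poly q \<Longrightarrow> int_poly (p + q)"
  and int_poly_diff: "int_poly p \<Longrightarrow> int_poly q \<Longrightarrow> int_poly (p - q)"
  and int_poly_mult: "int_poly p \<Longrightarrow> int_poly q \<Longrightarrow> int_poly (p * q)"
  and int_poly_smult: "c \<in> \<int> \<Longrightarrow> int_poly p \<Longrightarrow> int_poly (smult c p)"
  and int_poly_pCons: "int_poly (pCons c p) \<longleftrightarrow> c \<in> \<int> \<and> int_poly p"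
  and int_poly_0: "int_poly 0"
  and int_poly_1: "int_poly 1"
  by (auto simp: int_poly_def coeff_mult coeff_pCons split: nat.splits intro!: Ints_sum)

lemma int_poly_power: "int_poly p \<Longrightarrow> int_poly (p ^ n)"
  by (induction n) (auto intro: int_poly_1 int_poly_mult)

lemma int_poly_sum: "(\<And>i. i \<in> A \<Longrightarrow> int_poly (f i)) \<Longrightarrow> int_poly (sum f A)"
  by (induction A rule: infinite_finite_induct) (auto intro: int_poly_0 int_poly_add)

lemma int_poly_pcompose: "int_poly p \<Longrightarrow> int_poly q \<Longrightarrow> int_poly (pcompose p q)"
  by (induction p) (auto simp: pcompose_pCons int_poly_pCons int_poly_0 intro!: int_poly_add int_poly_mult)

lemma int_poly_eulerian_poly: "int_poly (eulerian_poly n)"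
proof (induction n rule: less_induct)
  case (less n)
  show ?case
  proof (cases "n = 0")
    case False
    thus ?thesis
      by (subst eulerian_poly_rec)
         (auto intro!: int_poly_sum int_poly_smult int_poly_mult int_poly_power less
               simp: int_poly_pCons int_poly_0)
  qed (simp add: eulerian_poly_0 int_poly_1)
qed

text \<open>In the recursion the summand k = 0 is (x - 1)^(n-1), monic of degree n - 1, while every
  other summand has degree at most n - 2.\<close>

lemma degree_eulerian_poly:
  assumes "n > 0"
  shows "degree (eulerian_poly n) \<le> n - 1 \<and> coeff (eulerian_poly n) (n - 1) = 1"
  using assms
proof (induction n rule: less_induct)
  case (less n)
  let ?L = "[:-1, 1:] :: complex poly"
  obtain m where n: "n = Suc m" using less.prems by (cases n) auto
  have split: "eulerian_poly n = ?L ^ m + (\<Sum>k<m. smult (of_nat (n choose Suc k)) (eulerian_poly (Suc k) * ?L ^ (m - Suc k)))"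
    by (subst eulerian_poly_rec[OF less.prems])
       (simp add: n sum.lessThan_Suc_shift eulerian_poly_0 del: sum.lessThan_Suc binomial_Suc_Suc)
  have deg: "degree (\<Sum>k<m. smult (of_nat (n choose Suc k)) (eulerian_poly (Suc k) * ?L ^ (m - Suc k))) \<le> m - 1"
  proof (rule degree_sum_le)
    fix k assume "k \<in> {..<m}"
    hence k: "k < m" by simp
    have "degree (eulerian_poly (Suc k) * ?L ^ (m - Suc k)) \<le> k + (m - Suc k)"
      using less.IH[of "Suc k"] k n
      by (intro order.trans[OF degree_mult_le] add_mono order.trans[OF degree_power_le]) auto
    also have "\<dots> \<le> m - 1" using k by simp
    finally show "degree (smult (of_nat (n choose Suc k)) (eulerian_poly (Suc k) * ?L ^ (m - Suc k))) \<le> m - 1"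
      using degree_smult_le order.trans by blast
  qed simp
  have degL: "degree (?L ^ m) = m" by (simp add: degree_power_eq)
  have leadL: "coeff (?L ^ m) m = 1"
    using lead_coeff_power[of ?L m] degL by simp
  show ?case
  proof (cases "m = 0")
    case True thus ?thesis using split n by simp
  next
    case False
    have "coeff (\<Sum>k<m. smult (of_nat (n choose Suc k)) (eulerian_poly (Suc k) * ?L ^ (m - Suc k))) m = 0"
      by (rule coeff_eq_0) (use deg False in linarith)
    moreover have "degree (eulerian_poly n) \<le> m"
      unfolding split by (rule degree_add_le) (use degL deg in auto)
    ultimately show ?thesis using leadL n by (subst (2) split) simp
  qed
qed

lemma P_poly_coeff_Ints: "coeff (P_poly k) i \<in> \<int>"
proof -
  have "int_poly (P_poly k)"
    unfolding P_poly_def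
    by (intro int_poly_diff int_poly_mult int_poly_power int_poly_smult int_poly_pcompose int_poly_eulerian_poly)
       (auto simp: int_poly_pCons int_poly_0 coeff_monom int_poly_def [of "monom 1 2"])
  thus ?thesis by (simp add: int_poly_def)
qed

text \<open>The first product has degree (2k+1) + (2k-1) = 4k, the subtracted one at most 1 +
  2(2k-1) = 4k - 1, so the leading term cannot cancel.\<close>

lemma degree_P_poly:
  assumes "k \<ge> 1"
  shows "degree (P_poly k) = 4 * k"
proof -
  let ?A = "eulerian_poly (2 * k)"
  have A: "degree ?A \<le> 2 * k - 1" "coeff ?A (2 * k - 1) = 1"
    using degree_eulerian_poly[of "2 * k"] assms by auto
  hence dA: "degree ?A = 2 * k - 1"
    by (intro antisym A(1) le_degree) auto
  hence "?A \<noteq> 0" using A(2) by auto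
  have d1: "degree ([:1, 1:] ^ (2 * k + 1) * ?A) = 4 * k"
  proof -
    have "degree ([:1, 1:] ^ (2 * k + 1) :: complex poly) = 2 * k + 1"
      by (subst degree_power_eq) auto
    moreover have "[:1, 1:] ^ (2 * k + 1) \<noteq> (0 :: complex poly)"
      by (subst power_eq_0_iff) auto
    ultimately show ?thesis
      using \<open>?A \<noteq> 0\<close> assms dA degree_mult_eq[of "[:1, 1:] ^ (2 * k + 1)" ?A] by linarith
  qed
  have "degree (smult (2 ^ (2 * k)) ([:0, 1:] * pcompose ?A (monom 1 2))) \<le> 1 + (2 * k - 1) * 2"
    by (intro order.trans[OF degree_smult_le] order.trans[OF degree_mult_le] add_mono)
       (auto simp: degree_pcompose dA degree_monom_eq)
  also have "\<dots> < 4 * k" using assms by simp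
  finally have "degree (- smult (2 ^ (2 * k)) ([:0, 1:] * pcompose ?A (monom 1 2))) <
     degree ([:1, 1:] ^ (2 * k + 1) * ?A)" by (simp only: d1 degree_minus)
  from degree_add_eq_left[OF this] show ?thesis
    unfolding P_poly_def by (simp only: d1 diff_conv_add_uminus)
qed

section \<open>Generating functions of powers\<close>

lemma summable_nat_power_mult_geometric:
  fixes t :: complex
  assumes "norm t < 1"
  shows "summable (\<lambda>j. of_nat j ^ n * t ^ j)"
proof -
  define c where "c = (1 + norm t) / 2"
  have "((\<lambda>j. (real (Suc j) / real j) ^ n * norm t) \<longlongrightarrow> 1 ^ n * norm t) sequentially"
    by (intro tendsto_intros LIMSEQ_Suc_n_over_n)
  hence "eventually (\<lambda>j. (real (Suc j) / real j) ^ n * norm t < c) sequentially"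
    by (rule order_tendstoD) (use assms in \<open>simp add: c_def\<close>)
  hence "eventually (\<lambda>j. norm (of_nat (Suc j) ^ n * t ^ Suc j) \<le> c * norm (of_nat j ^ n * t ^ j)) sequentially"
    using eventually_gt_at_top[of 0]
  proof eventually_elim
    case (elim j)
    have "norm (of_nat (Suc j) ^ n * t ^ Suc j) = ((real (Suc j) / real j) ^ n * norm t) * (real j ^ n * norm t ^ j)"
      using elim by (simp add: norm_mult norm_power power_divide del: of_nat_Suc)
    also have "\<dots> \<le> c * (real j ^ n * norm t ^ j)"
      using elim by (intro mult_right_mono) auto
    finally show ?case by (simp add: norm_mult norm_power)
  qed
  then obtain N where "\<And>j. j \<ge> N \<Longrightarrow> norm (of_nat (Suc j) ^ n * t ^ Suc j) \<le> c * norm (of_nat j ^ n * t ^ j)"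
    by (auto simp: eventually_at_top_linorder)
  thus ?thesis
    by (intro summable_ratio_test[of c N]) (use assms in \<open>auto simp: c_def\<close>)
qed

lemma summable_nat_power_geometric:
  fixes t :: complex
  assumes "norm t < 1"
  shows "summable (\<lambda>j. of_nat (Suc j) ^ n * t ^ Suc j)"
  using summable_nat_power_mult_geometric[OF assms] by (subst summable_Suc_iff)

text \<open>With S_m the sum of j^m t^j, subtracting t S_n shifts the index: (1 - t) S_n is the sum
  of (j^n - (j-1)^n) t^j. The binomial expansion expresses this through S_k with k < n, and the
  result is the recursion of the Eulerian polynomials.\<close>

lemma eulerian_poly_sums:
  fixes t :: complex
  assumes t: "norm t < 1"
  shows "(\<lambda>j. of_nat (Suc j) ^ n * t ^ Suc j) sums (t * poly (eulerian_poly n) t / (1 - t) ^ Suc n)"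
proof (induction n rule: less_induct)
  case (less n)
  have t1: "1 - t \<noteq> 0" using t by auto
  show ?case
  proof (cases "n = 0")
    case True
    have "(\<lambda>j. t * t ^ j) sums (t * (1 / (1 - t)))"
      by (intro sums_mult geometric_sums t)
    thus ?thesis by (simp add: True eulerian_poly_0)
  next
    case False
    define S where "S = (\<lambda>m. \<Sum>j. of_nat (Suc j) ^ m * t ^ Suc j)"
    have S: "(\<lambda>j. of_nat (Suc j) ^ m * t ^ Suc j) sums S m" for m
      unfolding S_def by (rule summable_sums, rule summable_nat_power_geometric, rule t)
    have SA: "S k = t * poly (eulerian_poly k) t / (1 - t) ^ Suc k" if "k < n" for k
      using less[OF that] S sums_unique2 by blast
    \<comment> \<open>Adding the index 0 changes nothing, since 0^n = 0 for n > 0.\<close>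
    have "(\<lambda>j. of_nat j ^ n * t ^ j) sums (S n + of_nat 0 ^ n * t ^ 0)"
      using S[of n] sums_Suc_iff[of "\<lambda>j. of_nat j ^ n * t ^ j :: complex"] by blast
    hence "(\<lambda>j. of_nat j ^ n * t ^ j) sums S n"
      using False by (simp add: power_0_left)
    hence "(\<lambda>j. of_nat (Suc j) ^ n * t ^ Suc j - t * (of_nat j ^ n * t ^ j)) sums (S n - t * S n)"
      by (intro sums_diff S sums_mult)
    hence 1: "(\<lambda>j. (of_nat (Suc j) ^ n - of_nat j ^ n) * t ^ Suc j) sums ((1 - t) * S n)"
      by (simp add: algebra_simps)
    have "(\<lambda>j. \<Sum>k<n. (- ((-1) ^ (n - k)) * of_nat (n choose k)) * (of_nat (Suc j) ^ k * t ^ Suc j))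
       sums (\<Sum>k<n. (- ((-1) ^ (n - k)) * of_nat (n choose k)) * S k)"
      by (intro sums_sum sums_mult S)
    also have "(\<lambda>j. \<Sum>k<n. (- ((-1) ^ (n - k)) * of_nat (n choose k)) * (of_nat (Suc j) ^ k * t ^ Suc j))
      = (\<lambda>j. (of_nat (Suc j) ^ n - of_nat j ^ n) * t ^ Suc j)"
    proof
      fix j :: nat
      have "(of_nat j :: complex) ^ n = (of_nat (Suc j) + (-1)) ^ n"
        by simp
      also have "\<dots> = (\<Sum>k\<le>n. of_nat (n choose k) * of_nat (Suc j) ^ k * (-1) ^ (n - k))"
        by (subst binomial_ring) simp
      also have "\<dots> = of_nat (Suc j) ^ n + (\<Sum>k<n. of_nat (n choose k) * of_nat (Suc j) ^ k * (-1) ^ (n - k))"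
        by (subst lessThan_Suc_atMost [symmetric], subst sum.lessThan_Suc) simp
      finally have "of_nat (Suc j) ^ n - of_nat j ^ n =
         (\<Sum>k<n. - (of_nat (n choose k) * of_nat (Suc j) ^ k * (-1 :: complex) ^ (n - k)))"
        by (simp add: sum_negf)
      thus "(\<Sum>k<n. (- ((-1) ^ (n - k)) * of_nat (n choose k)) * (of_nat (Suc j) ^ k * t ^ Suc j))
         = (of_nat (Suc j) ^ n - of_nat j ^ n) * t ^ Suc j"
        by (simp only: sum_distrib_right) (rule sum.cong, simp_all add: mult_ac)
    qed
    finally have "(1 - t) * S n = (\<Sum>k<n. (- ((-1) ^ (n - k)) * of_nat (n choose k)) * S k)"
      using 1 sums_unique2 by blast
    also have "\<dots> = (\<Sum>k<n. of_nat (n choose k) * (poly (eulerian_poly k) t * (t - 1) ^ (n - Suc k)) * (t / (1 - t) ^ n))"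
    proof (rule sum.cong, goal_cases)
      case (2 k)
      then obtain d where n: "n = Suc k + d" by (auto simp: less_iff_Suc_add)
      \<comment> \<open>The binomial sign -(-1)^(n-k) equals (-1)^d and turns (1 - t)^d into (t -
        1)^d, the power occurring in \<open>eulerian_poly_rec\<close>.\<close>
      have "(t - 1) ^ d = (-1) ^ d * (1 - t) ^ d"
        by (simp add: power_mult_distrib [symmetric])
      thus ?case using 2 t1 by (simp add: SA n power_add field_simps)
    qed simp
    also have "\<dots> = (\<Sum>k<n. of_nat (n choose k) * (poly (eulerian_poly k) t * (t - 1) ^ (n - Suc k))) * (t / (1 - t) ^ n)"
      by (simp only: sum_distrib_right)
    also have "(\<Sum>k<n. of_nat (n choose k) * (poly (eulerian_poly k) t * (t - 1) ^ (n - Suc k))) =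
        poly (eulerian_poly n) t"
      using False by (subst eulerian_poly_rec[of n]) (simp_all add: poly_sum)
    finally have "S n = t * poly (eulerian_poly n) t / (1 - t) ^ Suc n"
      using t1 by (simp add: field_simps)
    thus ?thesis using S[of n] by simp
  qed
qed

section \<open>Partial fractions of the cotangent\<close>

lemma has_sum_int_nat:
  fixes f :: "int \<Rightarrow> 'a :: real_normed_vector"
  assumes "((\<lambda>n. f (int n)) has_sum a) UNIV" "((\<lambda>n. f (- int (Suc n))) has_sum b) UNIV"
  shows "(f has_sum (a + b)) UNIV"
proof -
  have "(f has_sum a) (range int)"
    using assms(1) by (subst has_sum_reindex) (auto simp: o_def)
  moreover have "(f has_sum b) (range (\<lambda>n. - int (Suc n)))"
    using assms(2) by (subst has_sum_reindex) (auto simp: o_def inj_on_def)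
  moreover have "(UNIV :: int set) = range int \<union> range (\<lambda>n. - int (Suc n))"
  proof (intro equalityI subsetI)
    fix x :: int
    show "x \<in> range int \<union> range (\<lambda>n. - int (Suc n))"
      by (cases x rule: int_cases) (auto simp del: of_nat_Suc)
  qed auto
  moreover have "range int \<inter> range (\<lambda>n. - int (Suc n)) = {}" by auto
  ultimately show ?thesis by (metis has_sum_Un_disjoint)
qed

lemma has_sum_int_nat0:
  fixes f :: "int \<Rightarrow> 'a :: real_normed_vector"
  assumes "((\<lambda>n. f (int (Suc n))) has_sum a) UNIV" "((\<lambda>n. f (- int (Suc n))) has_sum b) UNIV"
  shows "(f has_sum (f 0 + a + b)) UNIV"
proof (rule has_sum_int_nat[OF _ assms(2)])
  have "((\<lambda>n. f (int n)) has_sum a) (range Suc)"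
    using assms(1) by (subst has_sum_reindex) (auto simp: o_def)
  hence "((\<lambda>n. f (int n)) has_sum (f (int 0) + a)) (insert 0 (range Suc))"
    by (intro has_sum_insert) auto
  also have "insert 0 (range Suc) = UNIV" using not0_implies_Suc by auto
  finally show "((\<lambda>n. f (int n)) has_sum (f 0 + a)) UNIV" by simp
qed

lemma summable_on_int_Suc:
  fixes f :: "int \<Rightarrow> 'a :: banach"
  assumes "f summable_on UNIV"
  shows "(\<lambda>n. f (int (Suc n))) summable_on UNIV"
proof -
  have "f summable_on range (\<lambda>n. int (Suc n))"
    by (rule summable_on_subset_banach[OF assms]) simp
  thus ?thesis
    by (subst (asm) summable_on_reindex) (auto simp: o_def inj_on_def)
qed

text \<open>Eventually both factors have norm at least n/2, so the terms are at most 4/n^2. The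
  finitely many earlier terms, including possible zero denominators, are irrelevant.\<close>

lemma summable_inverse_shift_mult:
  fixes z w :: complex
  shows "summable (\<lambda>n. norm (1 / ((z + of_nat n) * (w + of_nat n))))"
proof (rule summable_comparison_test_ev)
  show "summable (\<lambda>n. 4 * inverse (real n ^ 2))"
    using inverse_power_summable[of 2, where ?'a = real] by (intro summable_mult) simp
  obtain N :: nat where N: "real N > 2 * (norm z + norm w) + 1" using reals_Archimedean2 by blast
  show "eventually (\<lambda>n. norm (norm (1 / ((z + of_nat n) * (w + of_nat n)))) \<le> 4 * inverse (real n ^ 2)) sequentially"
    using eventually_ge_at_top[of N]
  proof eventually_elim
    case (elim n)
    hence n: "real n > 2 * (norm z + norm w) + 1" using N by linarith
    have aux: "norm (u + of_nat n) \<ge> real n / 2" if "norm u \<le> norm z + norm w" for u :: complex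
      using norm_diff_ineq[of "of_nat n" u] that n by (simp add: add.commute)
    have "(real n / 2) * (real n / 2) \<le> norm (z + of_nat n) * norm (w + of_nat n)"
      by (intro mult_mono aux) auto
    moreover have "real n > 0"
      by (rule le_less_trans[OF _ n]) simp
    ultimately have "inverse (norm (z + of_nat n) * norm (w + of_nat n)) \<le> inverse ((real n / 2) * (real n / 2))"
      by (intro le_imp_inverse_le) auto
    also have "inverse ((real n / 2) * (real n / 2)) = 4 * inverse (real n ^ 2)"
      by (simp add: power2_eq_square field_simps)
    finally show ?case by (simp add: norm_mult norm_inverse divide_inverse)
  qed
qed

lemma summable_inverse_shift_power:
  fixes z :: complex
  assumes "m \<ge> 2"
  shows "summable (\<lambda>n. norm (1 / (z + of_nat n) ^ m))"
proof (rule summable_comparison_test_ev)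
  show "summable (\<lambda>n. norm (1 / ((z + of_nat n) * (z + of_nat n))))"
    by (rule summable_inverse_shift_mult)
  obtain N :: nat where N: "real N > norm z + 1" using reals_Archimedean2 by blast
  show "eventually (\<lambda>n. norm (norm (1 / (z + of_nat n) ^ m)) \<le> norm (1 / ((z + of_nat n) * (z + of_nat n)))) sequentially"
    using eventually_ge_at_top[of N]
  proof eventually_elim
    case (elim n)
    hence n: "real n > norm z + 1" using N by linarith
    hence 1: "norm (z + of_nat n) \<ge> 1"
      using norm_diff_ineq[of "of_nat n" z] by (simp add: add.commute)
    hence "norm (z + of_nat n) ^ 2 \<le> norm (z + of_nat n) ^ m"
      by (intro power_increasing assms)
    hence "inverse (norm (z + of_nat n) ^ m) \<le> inverse (norm (z + of_nat n) ^ 2)"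
      using 1 by (intro le_imp_inverse_le zero_less_power) auto
    thus ?case by (simp add: norm_divide norm_power norm_mult power2_eq_square divide_simps)
  qed
qed

lemma not_nonpos_Ints_of_not_Ints:
  fixes z :: complex
  assumes "z \<notin> \<int>"
  shows "z \<notin> \<int>\<^sub>\<le>\<^sub>0" "1 - z \<notin> \<int>\<^sub>\<le>\<^sub>0"
proof -
  show "z \<notin> \<int>\<^sub>\<le>\<^sub>0" using assms nonpos_Ints_Int by blast
  show "1 - z \<notin> \<int>\<^sub>\<le>\<^sub>0"
  proof
    assume "1 - z \<in> \<int>\<^sub>\<le>\<^sub>0"
    hence "1 - z \<in> \<int>" by (rule nonpos_Ints_Int)
    hence "1 - (1 - z) \<in> \<int>" by (rule Ints_diff[OF Ints_1])
    thus False using assms by simp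
  qed
qed

lemma sin_pi_nonzero:
  fixes z :: complex
  assumes "z \<notin> \<int>"
  shows "sin (of_real pi * z) \<noteq> 0"
  using assms by (auto simp: sin_eq_0)

text \<open>Differentiate the reflection formula \<open>rGamma z * rGamma (1 - z)\<close> = sin(pi
  z)/pi and divide by it.\<close>

lemma Digamma_reflection:
  fixes z :: complex
  assumes "z \<notin> \<int>"
  shows "Digamma (1 - z) - Digamma z = of_real pi * cot (of_real pi * z)"
proof -
  note nz = not_nonpos_Ints_of_not_Ints[OF assms]
  have "((\<lambda>z. rGamma z * rGamma (1 - z)) has_field_derivative
      (rGamma z * (rGamma (1 - z) * Digamma (1 - z)) - rGamma z * Digamma z * rGamma (1 - z))) (at z)"
    using nz by (auto intro!: derivative_eq_intros)
  moreover have "((\<lambda>z. sin (of_real pi * z) / of_real pi) has_field_derivative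
      cos (of_real pi * z)) (at z)"
    by (auto intro!: derivative_eq_intros)
  ultimately have "rGamma z * (rGamma (1 - z) * Digamma (1 - z)) - rGamma z * Digamma z * rGamma (1 - z)
      = cos (of_real pi * z)"
    unfolding rGamma_reflection_complex by (rule DERIV_unique)
  hence "(rGamma z * rGamma (1 - z)) * (Digamma (1 - z) - Digamma z) = cos (of_real pi * z)"
    by (simp add: algebra_simps)
  thus ?thesis
    using sin_pi_nonzero[OF assms] by (simp add: rGamma_reflection_complex cot_def field_simps)
qed

text \<open>A difference of two cotangents is used because its partial fraction terms are of order
  1/n^2, so that unordered summation makes sense. The indices n \<ge> 0 give Digamma at z and w, the
  indices n < 0 give it at 1 - z and 1 - w; reflection combines the two halves.\<close>

lemma has_sum_cot_diff:
  fixes z w :: complex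
  assumes z: "z \<notin> \<int>" and w: "w \<notin> \<int>"
  shows "((\<lambda>n. 1 / (z + of_int n) - 1 / (w + of_int n)) has_sum
      (of_real pi * cot (of_real pi * z) - of_real pi * cot (of_real pi * w))) UNIV"
proof -
  have main: "((\<lambda>n. 1 / (u + of_nat n) - 1 / (v + of_nat n)) has_sum (Digamma v - Digamma u)) UNIV"
    if u: "u \<notin> \<int>" and v: "v \<notin> \<int>" for u v :: complex
  proof -
    have nz: "u + of_nat n \<noteq> 0" "v + of_nat n \<noteq> 0" for n
      using u v by (metis Ints_minus Ints_of_nat add_eq_0_iff2)+
    have "u \<noteq> 0" "v \<noteq> 0" using u v by auto
    note this [THEN summable_Digamma, THEN summable_sums]
    from sums_diff[OF this(2) this(1)] have S: "(\<lambda>n. 1 / (u + of_nat n) - 1 / (v + of_nat n)) sums (Digamma v - Digamma u)"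
      by (simp add: Digamma_def divide_inverse)
    have "summable (\<lambda>n. norm (v - u) * norm (1 / ((u + of_nat n) * (v + of_nat n))))"
      by (intro summable_mult summable_inverse_shift_mult)
    also have "(\<lambda>n. norm (v - u) * norm (1 / ((u + of_nat n) * (v + of_nat n)))) = (\<lambda>n. norm (1 / (u + of_nat n) - 1 / (v + of_nat n)))"
    proof
      fix n
      have "1 / (u + of_nat n) - 1 / (v + of_nat n) = (v - u) * (1 / ((u + of_nat n) * (v + of_nat n)))"
        using nz[of n] by (simp add: divide_simps)
      thus "norm (v - u) * norm (1 / ((u + of_nat n) * (v + of_nat n))) = norm (1 / (u + of_nat n) - 1 / (v + of_nat n))"
        by (simp only: norm_mult)
    qed
    finally show ?thesis using S by (intro norm_summable_imp_has_sum)
  qed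
  have 1: "1 - z \<notin> \<int>" "1 - w \<notin> \<int>"
    using z w by (metis Ints_1 Ints_diff diff_diff_eq2 add_diff_cancel_left')+
  have "((\<lambda>n. 1 / (z + of_int n) - 1 / (w + of_int n)) has_sum
     ((Digamma w - Digamma z) + (Digamma (1 - z) - Digamma (1 - w)))) UNIV"
  proof (rule has_sum_int_nat)
    show "((\<lambda>n. 1 / (z + of_int (int n)) - 1 / (w + of_int (int n))) has_sum Digamma w - Digamma z) UNIV"
      using main[OF z w] by simp
    have "(1 / (1 - w + of_nat n) - 1 / (1 - z + of_nat n)) = 1 / (z + of_int (- int (Suc n))) - 1 / (w + of_int (- int (Suc n)))" for n
    proof -
      have "z + of_int (- int (Suc n)) = - (1 - z + of_nat n)" "w + of_int (- int (Suc n)) = - (1 - w + of_nat n)" by auto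
      thus ?thesis by (simp only: divide_minus_right) simp
    qed
    thus "((\<lambda>n. 1 / (z + of_int (- int (Suc n))) - 1 / (w + of_int (- int (Suc n)))) has_sum Digamma (1 - z) - Digamma (1 - w)) UNIV"
      using main[OF 1(2) 1(1)] by simp
  qed
  also have "(Digamma w - Digamma z) + (Digamma (1 - z) - Digamma (1 - w)) =
     of_real pi * cot (of_real pi * z) - of_real pi * cot (of_real pi * w)"
    using Digamma_reflection[OF z] Digamma_reflection[OF w] by (simp add: algebra_simps)
  finally show ?thesis .
qed

text \<open>Off the integers this is the m-th derivative of pi cot(pi z): the reflection formula
  differentiated m times, with a factor -1 from each derivative at 1 - z. In this form its partial
  fractions can be read off from the Polygamma series.\<close>

definition cot_deriv :: "nat \<Rightarrow> complex \<Rightarrow> complex" where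
  "cot_deriv m z = (-1) ^ m * Polygamma m (1 - z) - Polygamma m z"

lemma cot_deriv_0: "z \<notin> \<int> \<Longrightarrow> cot_deriv 0 z = of_real pi * cot (of_real pi * z)"
  using Digamma_reflection by (simp add: cot_deriv_def)

lemma has_field_derivative_cot_deriv:
  assumes "z \<notin> \<int>"
  shows "(cot_deriv m has_field_derivative cot_deriv (Suc m) z) (at z)"
  unfolding cot_deriv_def [abs_def] using not_nonpos_Ints_of_not_Ints[OF assms]
  by (auto intro!: derivative_eq_intros)

text \<open>The indices n \<ge> 0 form the Polygamma series at z. The substitution n -> -1 - n turns
  the others into the series at 1 - z, with sign (-1)^(m+1).\<close>

lemma has_sum_cot_deriv:
  assumes z: "z \<notin> \<int>" and m: "m > 0"
  shows "((\<lambda>n. 1 / (z + of_int n) ^ Suc m) has_sum ((-1) ^ m * cot_deriv m z / fact m)) UNIV"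
proof -
  note nz = not_nonpos_Ints_of_not_Ints[OF z]
  have main: "((\<lambda>n. 1 / (u + of_nat n) ^ Suc m) has_sum ((-1) ^ Suc m * Polygamma m u / fact m)) UNIV"
    if "u \<notin> \<int>\<^sub>\<le>\<^sub>0" for u :: complex
  proof (rule norm_summable_imp_has_sum)
    show "summable (\<lambda>n. norm (1 / (u + of_nat n) ^ Suc m))"
      by (rule summable_inverse_shift_power) (use m in simp)
    have "u \<noteq> 0" using that by auto
    from Polygamma_LIMSEQ[OF this m]
    show "(\<lambda>n. 1 / (u + of_nat n) ^ Suc m) sums ((-1) ^ Suc m * Polygamma m u / fact m)"
      by (simp only: divide_inverse mult_1_left)
  qed
  have "((\<lambda>n. 1 / (z + of_int n) ^ Suc m) has_sum ((-1) ^ Suc m * Polygamma m z / fact m + 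
     (-1) ^ Suc m * ((-1) ^ Suc m * Polygamma m (1 - z) / fact m))) UNIV"
  proof (rule has_sum_int_nat)
    show "((\<lambda>n. 1 / (z + of_int (int n)) ^ Suc m) has_sum ((-1) ^ Suc m * Polygamma m z / fact m)) UNIV"
      using main[OF nz(1)] by simp
    have "1 / (z + of_int (- int (Suc n))) ^ Suc m = (-1) ^ Suc m * (1 / (1 - z + of_nat n) ^ Suc m)" for n
    proof -
      have "z + of_int (- int (Suc n)) = (- 1) * (1 - z + of_nat n)" by simp
      hence "(z + of_int (- int (Suc n))) ^ Suc m = (-1) ^ Suc m * (1 - z + of_nat n) ^ Suc m"
        by (simp only: power_mult_distrib)
      moreover have "1 / ((-1) ^ Suc m * x) = (-1) ^ Suc m * (1 / x)" for x :: complex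
        by (cases "even m") simp_all
      ultimately show ?thesis by simp
    qed
    thus "((\<lambda>n. 1 / (z + of_int (- int (Suc n))) ^ Suc m) has_sum (-1) ^ Suc m * ((-1) ^ Suc m * Polygamma m (1 - z) / fact m)) UNIV"
      using has_sum_cmult_right[OF main[OF nz(2)], of "(-1) ^ Suc m"] by simp
  qed
  also have "(-1) ^ Suc m * Polygamma m z / fact m + 
     (-1) ^ Suc m * ((-1) ^ Suc m * Polygamma m (1 - z) / fact m) = (-1) ^ m * cot_deriv m z / fact m"
    by (simp add: cot_deriv_def field_simps)
  finally show ?thesis .
qed

section \<open>q-expansions and the Lipschitz formula\<close>

lemma has_field_derivative_nome [derivative_intros]:
  "(nome has_field_derivative 2 * of_real pi * \<i> * nome z) (at z within A)"
  unfolding nome_def by (auto intro!: derivative_eq_intros)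

lemma nome_norm: "norm (nome z) = exp (- 2 * pi * Im z)"
  by (simp add: nome_def norm_exp_eq_Re)

lemma nome_norm_less_1: "Im z > 0 \<Longrightarrow> norm (nome z) < 1"
  by (simp add: nome_norm)

lemma not_Ints_upper: "Im z \<noteq> 0 \<Longrightarrow> z \<notin> \<int>"
  by (auto simp: complex_is_Int_iff)

text \<open>For m = 0 the cotangent is a rational function of q = e^2 with e = exp(i pi z), expanded
  geometrically; each differentiation multiplies the n-th coefficient by 2 pi i n. The convention
  0^0 = 1 matters for m = 0, where the index n = 0 must contribute 1.\<close>

lemma cot_deriv_q_expansion:
  assumes "Im z > 0"
  shows "cot_deriv m z = (if m = 0 then of_real pi * \<i> else 0)
           - (2 * of_real pi * \<i>) ^ Suc m * (\<Sum>n. of_nat n ^ m * nome z ^ n)"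
  using assms
proof (induction m arbitrary: z)
  case 0
  let ?q = "nome z"
  have q: "norm ?q < 1" using nome_norm_less_1 0 by simp
  hence q1: "1 - ?q \<noteq> 0" by auto
  have z: "z \<notin> \<int>" using 0 not_Ints_upper by simp
  define e where "e = exp (\<i> * (of_real pi * z))"
  have e0: "e \<noteq> 0" by (simp add: e_def)
  have e2: "?q = e ^ 2" by (simp add: nome_def e_def power2_eq_square exp_add [symmetric] mult_ac)
  have s: "sin (of_real pi * z) = (e - inverse e) / (2 * \<i>)" "cos (of_real pi * z) = (e + inverse e) / 2"
    by (simp_all add: sin_exp_eq' cos_exp_eq e_def exp_minus sin_exp_eq divide_simps algebra_simps)
  have "cot (of_real pi * z) = \<i> * (?q + 1) / (?q - 1)"
    using e0 q1 unfolding cot_def s e2 by (simp add: divide_simps power2_eq_square)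
  hence "cot_deriv 0 z = of_real pi * \<i> - 2 * of_real pi * \<i> * (1 / (1 - ?q))"
  proof -
    have "?q - 1 \<noteq> 0" using q1 by auto
    hence "\<i> * (?q + 1) / (?q - 1) = \<i> - 2 * \<i> * (1 / (1 - ?q))"
      using q1 by (simp add: field_simps)
    thus "cot (of_real pi * z) = \<i> * (?q + 1) / (?q - 1) \<Longrightarrow> ?thesis"
      using cot_deriv_0[OF z] by (simp add: right_diff_distrib)
  qed
  thus ?case using suminf_geometric[OF q] by simp
next
  case (Suc m)
  let ?q = "nome z"
  have q: "norm ?q < 1" using nome_norm_less_1 Suc by simp
  have z: "z \<notin> \<int>" using Suc not_Ints_upper by simp
  define c where "c = (\<lambda>n. of_nat n ^ m :: complex)"
  have sm: "summable (\<lambda>n. c n * x ^ n)" if "norm x < 1" for x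
    unfolding c_def by (rule summable_nat_power_mult_geometric[OF that])
  have "((\<lambda>x. \<Sum>n. c n * x ^ n) has_field_derivative (\<Sum>n. diffs c n * ?q ^ n)) (at ?q)"
  proof (rule termdiffs_strong)
    show "summable (\<lambda>n. c n * of_real ((1 + norm ?q) / 2) ^ n)" by (rule sm) (use q in \<open>simp only: norm_of_real, simp\<close>)
    show "norm ?q < norm (of_real ((1 + norm ?q) / 2) :: complex)" using q by (simp only: norm_of_real) auto
  qed
  from this has_field_derivative_nome have D: "((\<lambda>z. \<Sum>n. c n * nome z ^ n) has_field_derivative (\<Sum>n. diffs c n * ?q ^ n) * (2 * of_real pi * \<i> * ?q)) (at z)"
    by (rule DERIV_chain2)
  have "(\<lambda>n. of_nat n * c n * ?q ^ (n - Suc 0)) sums (\<Sum>n. diffs c n * ?q ^ n)"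
    by (rule diffs_equiv) (rule termdiff_converges[of _ 1], use q sm in auto)
  hence "(\<lambda>n. ?q * (of_nat n * c n * ?q ^ (n - Suc 0))) sums (?q * (\<Sum>n. diffs c n * ?q ^ n))"
    by (rule sums_mult)
  also have "(\<lambda>n. ?q * (of_nat n * c n * ?q ^ (n - Suc 0))) = (\<lambda>n. of_nat n ^ Suc m * ?q ^ n)"
  proof
    fix n show "?q * (of_nat n * c n * ?q ^ (n - Suc 0)) = of_nat n ^ Suc m * ?q ^ n"
      by (cases n) (simp_all add: c_def)
  qed
  finally have S: "?q * (\<Sum>n. diffs c n * ?q ^ n) = (\<Sum>n. of_nat n ^ Suc m * ?q ^ n)"
    by (simp add: sums_iff)
  have "((\<lambda>z. (if m = 0 then of_real pi * \<i> else 0) - (2 * of_real pi * \<i>) ^ Suc m * (\<Sum>n. c n * nome z ^ n))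
     has_field_derivative (- ((2 * of_real pi * \<i>) ^ Suc m * ((\<Sum>n. diffs c n * ?q ^ n) * (2 * of_real pi * \<i> * ?q))))) (at z)"
    using DERIV_diff[OF DERIV_const[of "if m = 0 then of_real pi * \<i> else 0"]
      DERIV_cmult[OF D, of "(2 * of_real pi * \<i>) ^ Suc m"]] by (simp only: diff_0)
  moreover have "((\<lambda>z. (if m = 0 then of_real pi * \<i> else 0) - (2 * of_real pi * \<i>) ^ Suc m * (\<Sum>n. c n * nome z ^ n))
     has_field_derivative cot_deriv (Suc m) z) (at z)"
  proof (rule has_field_derivative_transform_within_open[OF has_field_derivative_cot_deriv[OF z]])
    show "open {z. Im z > 0}" by (rule open_halfspace_Im_gt)
  qed (use Suc in \<open>auto simp: c_def\<close>)
  ultimately have "cot_deriv (Suc m) z = - ((2 * of_real pi * \<i>) ^ Suc m * ((\<Sum>n. diffs c n * ?q ^ n) * (2 * of_real pi * \<i> * ?q)))"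
    using DERIV_unique by blast
  also have "\<dots> = - ((2 * of_real pi * \<i>) ^ Suc (Suc m) * (?q * (\<Sum>n. diffs c n * ?q ^ n)))"
    by (simp add: mult_ac)
  finally show ?case by (simp only: S) simp
qed

lemma lipschitz_formula:
  assumes "Im z > 0" "m > 0"
  shows "((\<lambda>n. 1 / (z + of_int n) ^ Suc m) has_sum
     ((- 2 * of_real pi * \<i>) ^ Suc m / fact m * (\<Sum>n. of_nat n ^ m * nome z ^ n))) UNIV"
proof -
  have "((\<lambda>n. 1 / (z + of_int n) ^ Suc m) has_sum ((-1) ^ m * cot_deriv m z / fact m)) UNIV"
    by (intro has_sum_cot_deriv not_Ints_upper) (use assms in auto)
  also have "(-1) ^ m * cot_deriv m z / fact m = (- 2 * of_real pi * \<i>) ^ Suc m / fact m * (\<Sum>n. of_nat n ^ m * nome z ^ n)"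
  proof -
    have "(- 2 * of_real pi * \<i>) ^ Suc m = (-1) ^ Suc m * (2 * of_real pi * \<i>) ^ Suc m"
      by (subst power_mult_distrib [symmetric]) simp
    thus ?thesis using assms by (simp only: cot_deriv_q_expansion) simp
  qed
  finally show ?thesis .
qed

section \<open>The Dirichlet beta function at odd integers\<close>

text \<open>Replacing z by cz multiplies the n-th coefficient by c^n; this is checked by multiplying
  out. With c = 2 pi i it turns the hyperbolic secant that defines the Euler numbers into an
  ordinary secant.\<close>

lemma fps_sech_scaled:
  fixes c :: complex
  shows "2 / (fps_exp c + fps_exp (-c)) =
     Abs_fps (\<lambda>n. c ^ n * of_real (fps_nth (2 / (fps_exp 1 + fps_exp (-1))) n))"
proof -
  define e where "e = (2 / (fps_exp 1 + fps_exp (-1)) :: real fps)"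
  define E where "E = Abs_fps (\<lambda>n. c ^ n * of_real (fps_nth e n) :: complex)"
  have "e * (fps_exp 1 + fps_exp (-1)) = 2"
  proof -
    have nz: "fps_nth (fps_exp 1 + fps_exp (-1) :: real fps) 0 \<noteq> 0" by simp
    show ?thesis
      unfolding e_def fps_divide_unit[OF nz] mult.assoc inverse_mult_eq_1[OF nz] by simp
  qed
  note eq = this
  have e: "(\<Sum>i=0..n. fps_nth e i * (1 / fact (n - i) + (-1) ^ (n - i) / fact (n - i))) = fps_nth 2 n" for n
  proof -
    have "fps_nth (e * (fps_exp 1 + fps_exp (-1))) n = fps_nth 2 n"
      by (simp only: eq)
    thus ?thesis unfolding fps_mult_nth by simp
  qed
  have "E * (fps_exp c + fps_exp (-c)) = 2"
  proof (rule fps_ext)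
    fix n
    have "fps_nth (E * (fps_exp c + fps_exp (-c))) n =
        (\<Sum>i=0..n. c ^ n * of_real (fps_nth e i * (1 / fact (n - i) + (-1) ^ (n - i) / fact (n - i))))"
      unfolding fps_mult_nth
    proof (rule sum.cong, goal_cases)
      case (2 i)
      hence "c ^ n = c ^ i * c ^ (n - i)" by (simp flip: power_add)
      moreover have "(- c) ^ (n - i) = (-1) ^ (n - i) * c ^ (n - i)" by (rule power_minus)
      ultimately show ?case by (simp add: E_def algebra_simps)
    qed simp
    also have "\<dots> = c ^ n * of_real (fps_nth 2 n)"
      by (simp only: sum_distrib_left [symmetric] of_real_sum [symmetric] e)
    also have "\<dots> = fps_nth 2 n"
      by (cases n) (simp_all add: fps_numeral_nth)
    finally show "fps_nth (E * (fps_exp c + fps_exp (-c))) n = fps_nth 2 n" .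
  qed
  moreover have "fps_nth (fps_exp c + fps_exp (-c)) 0 \<noteq> 0" by simp
  ultimately have "E = 2 / (fps_exp c + fps_exp (-c))"
    by (metis fps_divide_times_eq fps_nonzero_nth nonzero_mult_div_cancel_right)
  thus ?thesis unfolding E_def e_def by simp
qed

text \<open>If a + b = pi/2, then sin(a+b) = 1 and 2 sin a sin b = cos(a-b), hence cot a + cot b =
  2/cos(a-b).\<close>

lemma cot_reflected_sum:
  fixes x :: complex
  assumes "1/4 + x \<notin> \<int>" "1/4 - x \<notin> \<int>"
  shows "of_real pi * cot (of_real pi * (1/4 + x)) + of_real pi * cot (of_real pi * (1/4 - x)) =
     of_real (2 * pi) * (2 / (exp (2 * of_real pi * \<i> * x) + exp (- (2 * of_real pi * \<i>) * x)))"
proof -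
  define a where "a = complex_of_real pi * (1/4 + x)"
  define b where "b = complex_of_real pi * (1/4 - x)"
  have nz: "sin a \<noteq> 0" "sin b \<noteq> 0"
    using sin_pi_nonzero assms by (simp_all add: a_def b_def)
  have ab: "a + b = of_real (pi / 2)" "a - b = 2 * of_real pi * x"
    by (simp_all add: a_def b_def algebra_simps)
  have s1: "sin a * cos b + cos a * sin b = 1"
    unfolding sin_add [symmetric] ab by (simp only: sin_of_real sin_pi_half of_real_1)
  have s2: "cos a * cos b - sin a * sin b = 0"
    unfolding cos_add [symmetric] ab by (simp only: cos_of_real cos_pi_half of_real_0)
  have s3: "cos a * cos b + sin a * sin b = cos (2 * of_real pi * x)"
    using cos_diff[of a b] unfolding ab by simp
  have "2 * (sin a * sin b) = cos (2 * of_real pi * x)" using s2 s3 by (simp add: algebra_simps)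
  hence p: "4 * (sin a * sin b) = exp (2 * of_real pi * \<i> * x) + exp (- (2 * of_real pi * \<i>) * x)"
    by (simp add: cos_exp_eq mult_ac)
  have "cot a + cot b = (sin a * cos b + cos a * sin b) / (sin a * sin b)"
    using nz by (simp add: cot_def field_simps)
  also have "\<dots> = 4 / (4 * (sin a * sin b))" unfolding s1 using nz by simp
  finally have "cot a + cot b = 4 / (exp (2 * of_real pi * \<i> * x) + exp (- (2 * of_real pi * \<i>) * x))"
    unfolding p .
  thus ?thesis by (simp add: a_def [symmetric] b_def [symmetric] distrib_left [symmetric])
qed

lemma quarter_not_Ints:
  assumes "norm x < 1/8"
  shows "1/4 + x \<notin> (\<int> :: complex set)"
proof
  assume "1/4 + x \<in> \<int>"
  then obtain n where "1/4 + x = of_int n" by (auto elim: Ints_cases)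
  hence "Re (1/4 + x) = of_int n" by simp
  moreover have "\<bar>Re x\<bar> < 1/8" using assms abs_Re_le_cmod[of x] by linarith
  ultimately have "of_int n < (1::real)" "of_int n > (0::real)" by auto
  thus False by simp
qed

text \<open>Symmetrising pi cot(pi z) about 1/4 doubles the even Taylor coefficients and kills the
  odd ones. The symmetrised function is 2 pi times the secant of 2 pi x, whose coefficients are
  Euler numbers.\<close>

lemma cot_deriv_quarter:
  "cot_deriv (2 * k) (1/4) = of_real pi * (2 * of_real pi * \<i>) ^ (2 * k) * of_real (euler_number (2 * k))"
proof -
  \<comment> \<open>\<open>F m\<close> is the m-th derivative of the symmetrisation
    \<open>F 0\<close>; the alternating sign comes from the inner function 1/4 - x. On the disc of
    radius 1/8 neither argument meets an integer.\<close>
  define F where "F = (\<lambda>m x. cot_deriv m (1/4 + x) + (-1) ^ m * cot_deriv m (1/4 - x))"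
  have D: "(F m has_field_derivative F (Suc m) x) (at x)" if "x \<in> ball 0 (1/8)" for m x
  proof -
    have 1: "1/4 + x \<notin> \<int>" "1/4 - x \<notin> \<int>"
      using quarter_not_Ints[of x] quarter_not_Ints[of "-x"] that by auto
    have "((\<lambda>x. cot_deriv m (1/4 + x)) has_field_derivative cot_deriv (Suc m) (1/4 + x) * 1) (at x)"
      by (rule DERIV_chain2[of "cot_deriv m" _ "\<lambda>x. 1/4 + x", OF has_field_derivative_cot_deriv[OF 1(1)]]) (auto intro!: derivative_eq_intros)
    moreover have "((\<lambda>x. cot_deriv m (1/4 - x)) has_field_derivative cot_deriv (Suc m) (1/4 - x) * (-1)) (at x)"
      by (rule DERIV_chain2[of "cot_deriv m" _ "\<lambda>x. 1/4 - x", OF has_field_derivative_cot_deriv[OF 1(2)]]) (auto intro!: derivative_eq_intros)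
    ultimately show ?thesis
      unfolding F_def using DERIV_add DERIV_cmult[of _ _ _ _ "(-1) ^ m"] by fastforce
  qed
  have hd: "(deriv ^^ m) (F 0) x = F m x" if "x \<in> ball 0 (1/8)" for m x
    using that
  proof (induction m arbitrary: x)
    case (Suc m)
    have "((deriv ^^ m) (F 0) has_field_derivative F (Suc m) x) (at x)"
      by (rule has_field_derivative_transform_within_open[OF D[OF Suc.prems] open_ball Suc.prems])
         (use Suc.IH in simp)
    thus ?case by (simp add: DERIV_imp_deriv)
  qed simp
  let ?c = "2 * of_real pi * \<i> :: complex"
  define G where "G = (fps_const (of_real (2 * pi)) * (2 / (fps_exp ?c + fps_exp (- ?c))) :: complex fps)"
  have "(\<lambda>x. of_real (2 * pi) * (2 / (exp (?c * x) + exp (- ?c * x)))) has_fps_expansion G"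
    unfolding G_def by (intro fps_expansion_intros) auto
  also have "?this \<longleftrightarrow> F 0 has_fps_expansion G"
  proof (rule has_fps_expansion_cong)
    have "eventually (\<lambda>x. x \<in> ball 0 (1/8 :: real)) (nhds (0 :: complex))"
      by (intro eventually_nhds_in_open) auto
    thus "eventually (\<lambda>x. of_real (2 * pi) * (2 / (exp (?c * x) + exp (- ?c * x))) = F 0 x) (nhds 0)"
    proof eventually_elim
      case (elim x)
      have 1: "1/4 + x \<notin> \<int>" "1/4 - x \<notin> \<int>"
        using quarter_not_Ints[of x] quarter_not_Ints[of "-x"] elim by auto
      show ?case using cot_reflected_sum[OF 1] by (simp add: F_def cot_deriv_0 1)
    qed
  qed simp
  finally have "fps_nth G (2 * k) = (deriv ^^ (2 * k)) (F 0) 0 / fact (2 * k)"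
    by (rule fps_nth_fps_expansion)
  also have "\<dots> = 2 * cot_deriv (2 * k) (1/4) / fact (2 * k)"
    by (subst hd) (simp_all add: F_def)
  finally have "2 * cot_deriv (2 * k) (1/4) = fact (2 * k) * fps_nth G (2 * k)"
    by simp
  also have "\<dots> = 2 * (of_real pi * ?c ^ (2 * k) * of_real (euler_number (2 * k)))"
    unfolding G_def fps_sech_scaled fps_mult_left_const_nth fps_nth_Abs_fps euler_number_def
    by (simp del: power_mult)
  finally show ?thesis by simp
qed

lemma chi_m4_minus: "chi_m4 (- n) = - chi_m4 n"
proof -
  have "(- n) mod 4 = 3 \<longleftrightarrow> n mod 4 = 1" "(- n) mod 4 = 1 \<longleftrightarrow> n mod 4 = 3" by presburger+
  thus ?thesis by (simp add: chi_m4_def)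
qed

lemma norm_chi_m4_le: "norm (chi_m4 n) \<le> 1"
  by (simp add: chi_m4_def)

text \<open>The partial fractions at 1/4, scaled by 4^(2k+1), are the sum over the class 1 mod 4.
  Negation maps this class to 3 mod 4; the character and the odd power both change sign, so the
  second class contributes the same amount.\<close>

lemma has_sum_chi_m4:
  assumes "k > 0"
  shows "((\<lambda>n. chi_m4 n / of_int n ^ (2 * k + 1)) has_sum
     (of_real pi * (2 * of_real pi * \<i>) ^ (2 * k) * of_real (euler_number (2 * k)) / (fact (2 * k) * (2 * 4 ^ (2 * k))))) UNIV"
proof -
  define B where "B = of_real pi * (2 * of_real pi * \<i>) ^ (2 * k) * of_real (euler_number (2 * k)) / fact (2 * k)"
  define f where "f = (\<lambda>n. chi_m4 n / of_int n ^ (2 * k + 1))"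
  have "((\<lambda>n. 1 / (1/4 + of_int n) ^ Suc (2 * k)) has_sum B) UNIV"
    using has_sum_cot_deriv[of "1/4" "2 * k"] quarter_not_Ints[of 0] assms cot_deriv_quarter[of k]
    by (simp add: B_def)
  from has_sum_cmult_right[OF this, of "1 / 4 ^ Suc (2 * k)"]
  have *: "((\<lambda>n. 1 / (4 * of_int n + 1) ^ (2 * k + 1)) has_sum (B / 4 ^ Suc (2 * k))) UNIV"
  proof -
    have "1 / 4 ^ Suc (2 * k) * (1 / (1/4 + of_int n) ^ Suc (2 * k)) = 1 / (4 * of_int n + 1 :: complex) ^ (2 * k + 1)" for n
    proof -
      have "4 ^ Suc (2 * k) * (1/4 + of_int n) ^ Suc (2 * k) = (4 * (1/4 + of_int n) :: complex) ^ Suc (2 * k)"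
        by (simp only: power_mult_distrib)
      also have "4 * (1/4 + of_int n) = (4 * of_int n + 1 :: complex)" by simp
      finally show ?thesis by (simp only: times_divide_times_eq mult_1_left Suc_eq_plus1)
    qed
    thus "((\<lambda>n. 1 / 4 ^ Suc (2 * k) * (1 / (1/4 + of_int n) ^ Suc (2 * k))) has_sum 1 / 4 ^ Suc (2 * k) * B) UNIV \<Longrightarrow> ?thesis"
      by simp
  qed
  have quot: "4 * (a div 4) + 1 = a" "4 * of_int (a div 4) + 1 = (of_int a :: complex)" if "a mod 4 = 1" for a :: int
  proof -
    show "4 * (a div 4) + 1 = a" using that by presburger
    hence "of_int (4 * (a div 4) + 1) = (of_int a :: complex)" by (rule arg_cong)
    thus "4 * of_int (a div 4) + 1 = (of_int a :: complex)" by simp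
  qed
  have 1: "(f has_sum (B / 4 ^ Suc (2 * k))) {n. n mod 4 = 1}"
    by (subst has_sum_reindex_bij_witness[of _ "\<lambda>n. 4 * n + 1" "\<lambda>n. n div 4" UNIV "\<lambda>n. 1 / (4 * of_int n + 1) ^ (2 * k + 1)"])
       (use * quot in \<open>auto simp: f_def chi_m4_def\<close>)
  have 2: "(f has_sum (B / 4 ^ Suc (2 * k))) {n. n mod 4 = 3}"
    using 1
    by (subst has_sum_reindex_bij_witness[of _ uminus uminus "{n. n mod 4 = 1}" f])
       (auto simp: f_def chi_m4_minus, presburger+)
  have "(f has_sum (B / 4 ^ Suc (2 * k) + B / 4 ^ Suc (2 * k))) ({n. n mod 4 = 1} \<union> {n. n mod 4 = 3})"
    by (rule has_sum_Un_disjoint[OF 1 2]) auto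
  hence "(f has_sum (B / 4 ^ Suc (2 * k) + B / 4 ^ Suc (2 * k))) UNIV"
    by (subst (asm) has_sum_cong_neutral[of UNIV _ f f]) (auto simp: f_def chi_m4_def)
  also have "B / 4 ^ Suc (2 * k) + B / 4 ^ Suc (2 * k) = B / (2 * 4 ^ (2 * k))" by (simp add: field_simps)
  finally show ?thesis by (simp add: f_def B_def)
qed

lemma has_sum_chi_m4_beta:
  assumes "k > 0"
  shows "((\<lambda>n. chi_m4 n / of_int n ^ (2 * k + 1)) has_sum (2 * dirichlet_beta (of_nat (2 * k + 1)))) UNIV"
proof -
  define f where "f = (\<lambda>n. chi_m4 n / of_int n ^ (2 * k + 1))"
  obtain S where S: "(f has_sum S) UNIV" using has_sum_chi_m4[OF assms] unfolding f_def by blast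
  hence sum: "f summable_on UNIV" by (auto simp: summable_on_def)
  have f_minus: "f (- n) = f n" for n
    by (simp add: f_def chi_m4_minus power_minus_odd)
  obtain b where b: "((\<lambda>n. f (int (Suc n))) has_sum b) UNIV"
    using summable_on_int_Suc[OF sum] by (auto simp: summable_on_def)
  have "((\<lambda>n. f (- int (Suc n))) has_sum b) UNIV"
    using b unfolding f_minus .
  from has_sum_int_nat0[OF b this] have "(f has_sum (b + b)) UNIV"
    by (simp add: f_def chi_m4_def)
  moreover have "dirichlet_beta (of_nat (2 * k + 1)) = b"
  proof -
    have "of_nat (Suc n) powr (- of_nat (2 * k + 1)) = 1 / (of_nat (Suc n) :: complex) ^ (2 * k + 1)" for n
      by (simp only: powr_minus divide_inverse mult_1_left) (subst powr_nat', auto)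
    hence "dirichlet_beta (of_nat (2 * k + 1)) = (\<Sum>n. f (int (Suc n)))"
      unfolding dirichlet_beta_def f_def by simp
    also have "\<dots> = b" using has_sum_imp_sums[OF b] by (simp add: sums_iff)
    finally show ?thesis .
  qed
  ultimately show ?thesis by (simp add: f_def)
qed

lemma dirichlet_beta_odd:
  assumes "k > 0"
  shows "dirichlet_beta (of_nat (2 * k + 1)) =
      (-1) ^ k * of_real (euler_number (2 * k)) / (4 ^ (k + 1) * fact (2 * k)) * of_real pi ^ (2 * k + 1)"
proof -
  have "2 * dirichlet_beta (of_nat (2 * k + 1)) =
     of_real pi * (2 * of_real pi * \<i>) ^ (2 * k) * of_real (euler_number (2 * k)) / (fact (2 * k) * (2 * 4 ^ (2 * k)))"
    using has_sum_unique[OF has_sum_chi_m4_beta[OF assms] has_sum_chi_m4[OF assms]] .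
  moreover have "(2 * of_real pi * \<i>) ^ (2 * k) = 4 ^ k * of_real pi ^ (2 * k) * (-1) ^ k"
  proof -
    have "(2 * of_real pi * \<i>)\<^sup>2 = (4 * of_real pi ^ 2 * (-1) :: complex)"
      by (simp add: power_mult_distrib)
    thus ?thesis by (simp only: power_mult) (simp only: power_mult_distrib)
  qed
  moreover have "(4 :: complex) ^ (2 * k) = 4 ^ k * 4 ^ k" by (simp add: mult_2 power_add)
  ultimately show ?thesis by (simp add: field_simps)
qed

text \<open>If the number vanished, the Polygamma function of even order 2k would agree at 1/4 and
  3/4, against its strict monotonicity on the positive reals. Euler numbers occur as denominators in
  \<open>lambert_coeff\<close>.\<close>

lemma euler_number_even_nonzero:
  assumes "k > 0"
  shows "euler_number (2 * k) \<noteq> 0"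
proof
  assume "euler_number (2 * k) = 0"
  hence "cot_deriv (2 * k) (1/4) = 0"
    using cot_deriv_quarter[of k] by simp
  hence "Polygamma (2 * k) (of_real (3/4)) = Polygamma (2 * k) (of_real (1/4) :: complex)"
    by (simp add: cot_deriv_def)
  hence "Polygamma (2 * k) (3/4 :: real) = Polygamma (2 * k) (1/4 :: real)"
    using Polygamma_of_real[of "3/4" "2 * k", where ?'a = complex]
      Polygamma_of_real[of "1/4" "2 * k", where ?'a = complex] by (metis of_real_eq_iff zero_neq_numeral zero_neq_one divide_eq_0_iff)
  moreover have "Polygamma (2 * k) (1/4 :: real) < Polygamma (2 * k) (3/4 :: real)"
    by (rule Polygamma_real_strict_mono) (use assms in auto)
  ultimately show False by simp
qed

section \<open>Lattice sums\<close>

text \<open>The exponent is half of 3, the smallest weight treated: |m\<tau> + n|^2 dominates (1 +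
  |m|)(1 + |n|), so |m\<tau> + n|^(-3) is bounded by a product of two such weights, each summable
  over the integers.\<close>

definition lattice_weight :: "int \<Rightarrow> real" where
  "lattice_weight n = (1 + \<bar>of_int n\<bar>) powr (-3/2)"

lemma lattice_weight_nonneg: "lattice_weight n \<ge> 0"
  by (simp add: lattice_weight_def)

lemma summable_lattice_weight: "lattice_weight summable_on UNIV"
proof -
  have "summable (\<lambda>n. real n powr (-3/2))"
    by (subst summable_real_powr_iff) simp
  hence s: "summable (\<lambda>n. real (Suc n) powr (-3/2))"
    by (subst summable_Suc_iff)
  have 1: "(\<lambda>n. lattice_weight (int n)) summable_on UNIV"
    using s by (subst summable_on_UNIV_nonneg_real_iff) (simp_all add: lattice_weight_def add.commute)
  have 2: "(\<lambda>n. lattice_weight (- int (Suc n))) summable_on UNIV"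
    using s by (subst summable_on_UNIV_nonneg_real_iff, simp add: lattice_weight_def, subst (asm) summable_Suc_iff [symmetric])
       (simp add: lattice_weight_def add.commute)
  show ?thesis
    using has_sum_int_nat[OF has_sum_infsum[OF 1] has_sum_infsum[OF 2]] by (auto simp: summable_on_def)
qed

lemma summable_lattice_weight_prod:
  "(\<lambda>(m, n). lattice_weight m * lattice_weight n) summable_on UNIV"
proof -
  have "(\<lambda>(m, n). lattice_weight m * lattice_weight n) summable_on (UNIV \<times> UNIV)"
  proof (rule summable_on_SigmaI)
    fix m :: int
    show "((\<lambda>n. case (m, n) of (m, n) \<Rightarrow> lattice_weight m * lattice_weight n) has_sum
       (lattice_weight m * infsum lattice_weight UNIV)) UNIV"
      using has_sum_cmult_right[OF has_sum_infsum[OF summable_lattice_weight], of "lattice_weight m"] by simp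
  next
    show "(\<lambda>m. lattice_weight m * infsum lattice_weight UNIV) summable_on UNIV"
      by (intro summable_on_cmult_left summable_lattice_weight)
  qed (auto simp: lattice_weight_nonneg)
  thus ?thesis by simp
qed

text \<open>Raise the hypothesis to the power s/2. Since the left-hand product is at least 1, its
  exponent may be lowered from s/2 to 3/2.\<close>

lemma inverse_power_le_lattice_weight:
  fixes z :: complex
  assumes "(1 + \<bar>of_int m\<bar>) * (1 + \<bar>of_int n\<bar>) \<le> K * norm z ^ 2" "K > 0" "s \<ge> 3"
  shows "norm (1 / z ^ s) \<le> K powr (real s / 2) * (lattice_weight m * lattice_weight n)"
proof -
  define P :: real where "P = (1 + \<bar>of_int m\<bar>) * (1 + \<bar>of_int n\<bar>)"
  have "1 * 1 \<le> P" unfolding P_def by (intro mult_mono) auto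
  hence P: "P \<ge> 1" by simp
  have z: "norm z > 0"
  proof (rule ccontr)
    assume "\<not> norm z > 0"
    hence "z = 0" by simp
    thus False using assms(1) P by (simp add: P_def)
  qed
  have "P powr (3/2) \<le> P powr (real s / 2)"
    using assms P by (intro powr_mono) auto
  also have "\<dots> \<le> (K * norm z ^ 2) powr (real s / 2)"
    using assms(1) P by (intro powr_mono2) (auto simp: P_def)
  also have "\<dots> = K powr (real s / 2) * (norm z ^ 2) powr (real s / 2)"
    using assms by (subst powr_mult) auto
  also have "(norm z ^ 2) powr (real s / 2) = norm z ^ s"
    using z by (simp add: powr_powr powr_realpow flip: powr_numeral)
  finally have "P powr (3/2) \<le> K powr (real s / 2) * norm z ^ s" .
  hence "1 / norm z ^ s \<le> K powr (real s / 2) * P powr (-3/2)"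
    using z P by (simp add: field_simps powr_minus_divide)
  also have "P powr (-3/2) = lattice_weight m * lattice_weight n"
    unfolding P_def lattice_weight_def by (subst powr_mult) auto
  finally show ?thesis by (simp add: norm_divide norm_power)
qed

text \<open>The imaginary part of m\<tau> + n controls m, and then the real part controls n. The
  constant depends only on the bounds A and B, which makes the resulting convergence locally uniform
  in \<tau>.\<close>

lemma lattice_prod_le_norm:
  fixes \<tau> :: complex
  assumes "\<bar>Re \<tau>\<bar> \<le> A" "Im \<tau> \<ge> B" "B > 0" "(m, n) \<noteq> (0, 0)"
  shows "(1 + \<bar>of_int m\<bar>) * (1 + \<bar>of_int n\<bar>) \<le> (3 * (2 + (2 * A\<^sup>2 + 1) / B\<^sup>2)) * norm (of_int m * \<tau> + of_int n) ^ 2"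
proof -
  define x y where "x = Re \<tau>" and "y = Im \<tau>"
  define a b where "a = real_of_int m" and "b = real_of_int n"
  define Q where "Q = (a * x + b)\<^sup>2 + (a * y)\<^sup>2"
  have Q: "norm (of_int m * \<tau> + of_int n) ^ 2 = Q"
    by (simp add: cmod_power2 Q_def x_def y_def a_def b_def)
  have "B\<^sup>2 \<le> y\<^sup>2" using assms by (intro power_mono) (auto simp: y_def)
  hence "a\<^sup>2 * B\<^sup>2 \<le> a\<^sup>2 * y\<^sup>2" by (intro mult_left_mono) auto
  also have "\<dots> \<le> Q" by (simp add: Q_def power_mult_distrib)
  finally have a2: "a\<^sup>2 \<le> Q / B\<^sup>2" using assms by (simp add: field_simps)
  have "x\<^sup>2 \<le> A\<^sup>2" using assms by (intro power2_le_iff_abs_le[THEN iffD2]) (auto simp: x_def)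
  hence "a\<^sup>2 * x\<^sup>2 \<le> Q / B\<^sup>2 * A\<^sup>2" using a2 by (intro mult_mono) (auto simp: Q_def)
  moreover have "b\<^sup>2 \<le> 2 * (a * x + b)\<^sup>2 + 2 * (a\<^sup>2 * x\<^sup>2)"
    using zero_le_power2[of "2 * (a * x) + b"] by (simp add: power2_eq_square algebra_simps)
  moreover have "(a * x + b)\<^sup>2 \<le> Q" by (simp add: Q_def)
  ultimately have "b\<^sup>2 \<le> 2 * Q + 2 * (Q / B\<^sup>2 * A\<^sup>2)" by linarith
  hence ab: "a\<^sup>2 + b\<^sup>2 \<le> (2 + (2 * A\<^sup>2 + 1) / B\<^sup>2) * Q"
    using a2 assms by (simp add: field_simps)
  have "m\<^sup>2 + n\<^sup>2 \<ge> 1"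
    using assms(4) by (metis sum_power2_gt_zero_iff int_one_le_iff_zero_less prod.inject)
  hence "real_of_int (m\<^sup>2 + n\<^sup>2) \<ge> 1" by linarith
  hence ab1: "a\<^sup>2 + b\<^sup>2 \<ge> 1" by (simp add: a_def b_def)
  \<comment> \<open>Expand and use 2|a| \<le> a^2 + 1, 2|b| \<le> b^2 + 1 and 2|ab| \<le> a^2 + b^2.
    The constant 2 is then absorbed because a^2 + b^2 \<ge> 1 away from the origin.\<close>
  have "(1 + \<bar>a\<bar>) * (1 + \<bar>b\<bar>) \<le> 2 + \<bar>a\<bar>\<^sup>2 + \<bar>b\<bar>\<^sup>2"
    using zero_le_power2[of "\<bar>a\<bar> - \<bar>b\<bar>"] zero_le_power2[of "\<bar>a\<bar> - 1"] zero_le_power2[of "\<bar>b\<bar> - 1"]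
    unfolding power2_diff by (simp add: distrib_left distrib_right)
  also have "\<dots> \<le> 3 * (a\<^sup>2 + b\<^sup>2)" using ab1 by simp
  also have "\<dots> \<le> 3 * ((2 + (2 * A\<^sup>2 + 1) / B\<^sup>2) * Q)" using ab by simp
  finally show ?thesis unfolding Q by (simp only: mult.assoc a_def b_def)
qed

text \<open>The weight is kept general because the slash action only permutes lattice points and so
  changes nothing but \<open>w\<close>. For s > 0 the origin contributes 0, as division by zero
  yields 0.\<close>

definition lattice_sum :: "(int \<times> int \<Rightarrow> complex) \<Rightarrow> nat \<Rightarrow> complex \<Rightarrow> complex" where
  "lattice_sum w s \<tau> = (\<Sum>\<^sub>\<infinity>(m, n)\<in>UNIV. w (m, n) / (of_int m * \<tau> + of_int n) ^ s)"

lemma lattice_sum_term_bound: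
  assumes "\<bar>Re \<tau>\<bar> \<le> A" "Im \<tau> \<ge> B" "B > 0" "s \<ge> 3" "\<And>p. norm (w p) \<le> M"
  shows "norm (case p of (m, n) \<Rightarrow> w (m, n) / (of_int m * \<tau> + of_int n) ^ s) \<le>
     (M * (3 * (2 + (2 * A\<^sup>2 + 1) / B\<^sup>2)) powr (real s / 2)) * (case p of (m, n) \<Rightarrow> lattice_weight m * lattice_weight n)"
proof -
  obtain m n where p: "p = (m, n)" by (cases p)
  have M: "M \<ge> 0" using assms(5)[of p] norm_ge_zero order_trans by blast
  show ?thesis
  proof (cases "p = (0, 0)")
    case True
    thus ?thesis using M assms(4) by (simp add: lattice_weight_nonneg power_0_left)
  next
    case False
    have "2 + (2 * A\<^sup>2 + 1) / B\<^sup>2 > 0" using assms by (intro add_pos_nonneg) auto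
    hence "norm (1 / (of_int m * \<tau> + of_int n) ^ s) \<le> (3 * (2 + (2 * A\<^sup>2 + 1) / B\<^sup>2)) powr (real s / 2) * (lattice_weight m * lattice_weight n)"
      using lattice_prod_le_norm[OF assms(1-3), of m n] False p assms(4)
      by (intro inverse_power_le_lattice_weight mult_pos_pos) simp_all
    hence "norm (w (m, n)) * norm (1 / (of_int m * \<tau> + of_int n) ^ s) \<le> M * ((3 * (2 + (2 * A\<^sup>2 + 1) / B\<^sup>2)) powr (real s / 2) * (lattice_weight m * lattice_weight n))"
      using M assms(5) by (intro mult_mono) auto
    thus ?thesis unfolding p norm_mult [symmetric] by (simp add: mult_ac)
  qed
qed

lemma lattice_sum_summable:
  assumes "Im \<tau> > 0" "s \<ge> 3" "\<And>p. norm (w p) \<le> M"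
  shows "(\<lambda>(m, n). w (m, n) / (of_int m * \<tau> + of_int n) ^ s) summable_on UNIV"
proof (rule abs_summable_summable)
  have *: "(\<lambda>p. (M * (3 * (2 + (2 * \<bar>Re \<tau>\<bar>\<^sup>2 + 1) / (Im \<tau>)\<^sup>2)) powr (real s / 2)) * (case p of (m, n) \<Rightarrow> lattice_weight m * lattice_weight n)) summable_on UNIV"
    by (intro summable_on_cmult_right summable_lattice_weight_prod)
  show "(\<lambda>p. norm (case p of (m, n) \<Rightarrow> w (m, n) / (of_int m * \<tau> + of_int n) ^ s)) summable_on UNIV"
    by (rule summable_on_comparison_test[OF *], rule lattice_sum_term_bound) (use assms in auto)
qed

lemma holomorphic_uniform_limit_open:
  assumes "uniform_limit A f g F" "F \<noteq> bot" "open A" "\<And>n. f n holomorphic_on A"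
  shows "g holomorphic_on A"
  unfolding holomorphic_on_open[OF assms(3)]
proof
  fix z assume "z \<in> A"
  then obtain r where r: "r > 0" "cball z r \<subseteq> A"
    using assms(3) by (meson open_contains_cball)
  hence r': "ball z r \<subseteq> A" using ball_subset_cball by blast
  have "g holomorphic_on ball z r"
  proof (rule holomorphic_uniform_limit[where f = f and F = F and z = z and r = r and g = g])
    show "eventually (\<lambda>n. continuous_on (cball z r) (f n) \<and> f n holomorphic_on ball z r) F"
      using assms(4) r by (intro always_eventually allI conjI holomorphic_on_imp_continuous_on)
        (auto intro: holomorphic_on_subset holomorphic_on_subset[OF assms(4) r'])
    show "uniform_limit (cball z r) f g F"
      by (rule uniform_limit_on_subset[OF assms(1) r(2)])
  qed (use assms in auto)
  thus "\<exists>f'. (g has_field_derivative f') (at z)"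
    using r by (simp add: holomorphic_on_open)
qed

text \<open>Near a given point the summands have a summable bound independent of \<tau>, so the
  finite partial sums converge uniformly there. Summands with m = 0 are constant, whatever their
  denominator.\<close>

lemma lattice_sum_holomorphic:
  assumes "s \<ge> 3" "\<And>p. norm (w p) \<le> M"
  shows "lattice_sum w s holomorphic_on upper_half_plane"
proof -
  have "\<exists>f'. (lattice_sum w s has_field_derivative f') (at z)" if "Im z > 0" for z
  proof -
    define A B where "A = \<bar>Re z\<bar> + 1" and "B = Im z / 2"
    define U where "U = {\<tau>. Re \<tau> < A} \<inter> {\<tau>. Re \<tau> > - A} \<inter> {\<tau>. Im \<tau> > B}"
    have U: "open U" unfolding U_def
      by (intro open_Int open_halfspace_Re_lt open_halfspace_Re_gt open_halfspace_Im_gt)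
    have B: "B > 0" using that by (simp add: B_def)
    let ?f = "\<lambda>p \<tau>. case p of (m, n) \<Rightarrow> w (m, n) / (of_int m * \<tau> + of_int n) ^ s"
    have hol: "?f p holomorphic_on U" for p
    proof -
      obtain m n where p: "p = (m, n)" by (cases p)
      show ?thesis
      proof (cases "m = 0")
        case False
        have "of_int m * \<tau> + of_int n \<noteq> 0" if "\<tau> \<in> U" for \<tau>
        proof
          assume "of_int m * \<tau> + of_int n = 0"
          hence "Im (of_int m * \<tau> + of_int n) = 0" by simp
          thus False using False that B by (auto simp: U_def)
        qed
        thus ?thesis unfolding p by (auto intro!: holomorphic_intros)
      qed (simp add: p)
    qed
    have "uniform_limit U (\<lambda>X \<tau>. \<Sum>p\<in>X. ?f p \<tau>) (\<lambda>\<tau>. \<Sum>\<^sub>\<infinity>p. ?f p \<tau>) (finite_subsets_at_top UNIV)"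
    proof (rule Weierstrass_m_test_general)
      show "norm (?f p \<tau>) \<le> (M * (3 * (2 + (2 * A\<^sup>2 + 1) / B\<^sup>2)) powr (real s / 2)) * (case p of (m, n) \<Rightarrow> lattice_weight m * lattice_weight n)" if "\<tau> \<in> U" for \<tau> p
        using that B assms by (intro lattice_sum_term_bound) (auto simp: U_def)
    qed (intro summable_on_cmult_right summable_lattice_weight_prod)
    hence "lattice_sum w s holomorphic_on U"
      unfolding lattice_sum_def [abs_def]
      by (rule holomorphic_uniform_limit_open) (use U hol in \<open>simp_all add: holomorphic_on_sum del: split_paired_All split_paired_all\<close>)
    moreover have "z \<in> U" using that by (auto simp: U_def A_def B_def)
    ultimately show ?thesis using U by (simp add: holomorphic_on_open)
  qed
  moreover have "open upper_half_plane"
    unfolding upper_half_plane_def by (rule open_halfspace_Im_gt)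
  ultimately show ?thesis by (simp add: holomorphic_on_open upper_half_plane_def)
qed

lemma moebius_denom_nonzero:
  fixes \<tau> :: complex and a b c d :: int
  assumes "Im \<tau> > 0" "a * d - b * c = 1"
  shows "of_int c * \<tau> + of_int d \<noteq> 0"
proof
  assume 0: "of_int c * \<tau> + of_int d = 0"
  hence "Im (of_int c * \<tau> + of_int d) = 0" by simp
  hence c: "c = 0" using assms by simp
  hence "d = 0" using 0 by simp
  thus False using assms c by simp
qed

text \<open>Clearing the denominator c\<tau> + d sends the lattice point (m, n) to (ma + nc, mb +
  nd). Reindexing by the inverse matrix moves the change into the weight.\<close>

lemma lattice_sum_slash:
  assumes "Im \<tau> > 0" "a * d - b * c = 1"
  shows "weight_slash s a b c d (lattice_sum w s) \<tau> =
     lattice_sum (\<lambda>(m, n). w (m * d - n * c, n * a - m * b)) s \<tau>"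
proof -
  define j where "j = of_int c * \<tau> + of_int d"
  have j: "j \<noteq> 0" unfolding j_def by (rule moebius_denom_nonzero[OF assms])
  have ad: "a * d = 1 + b * c" using assms(2) by simp
  have "weight_slash s a b c d (lattice_sum w s) \<tau> =
     (\<Sum>\<^sub>\<infinity>(m, n)\<in>UNIV. w (m, n) / (of_int m * ((of_int a * \<tau> + of_int b) / j) + of_int n) ^ s) / j ^ s"
    by (simp add: weight_slash_def lattice_sum_def j_def)
  also have "\<dots> = (\<Sum>\<^sub>\<infinity>p. (case p of (m, n) \<Rightarrow> w (m, n) / (of_int m * ((of_int a * \<tau> + of_int b) / j) + of_int n) ^ s) * inverse (j ^ s))"
    by (subst infsum_cmult_left') (simp add: divide_inverse)
  also have "\<dots> = (\<Sum>\<^sub>\<infinity>p. (case p of (m, n) \<Rightarrow> w (m * d - n * c, n * a - m * b) / (of_int m * \<tau> + of_int n) ^ s))"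
  proof (rule infsum_reindex_bij_witness[of _ "\<lambda>(m, n). (m * d - n * c, n * a - m * b)" "\<lambda>(m, n). (m * a + n * c, m * b + n * d)"])
    fix p :: "int \<times> int"
    obtain m n where p: "p = (m, n)" by (cases p)
    have inv: "(m * a + n * c) * d - (m * b + n * d) * c = m" "(m * b + n * d) * a - (m * a + n * c) * b = n"
      using ad by (simp_all add: algebra_simps) (metis ad distrib_left mult.commute mult.left_commute mult_1)+
    show "(\<lambda>(m, n). (m * d - n * c, n * a - m * b)) ((\<lambda>(m, n). (m * a + n * c, m * b + n * d)) p) = p"
      using inv by (simp add: p)
    have "(of_int m * ((of_int a * \<tau> + of_int b) / j) + of_int n) * j = of_int (m * a + n * c) * \<tau> + of_int (m * b + n * d)"
      using j by (simp add: distrib_right) (simp add: j_def algebra_simps)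
    hence H: "(of_int m * ((of_int a * \<tau> + of_int b) / j) + of_int n) ^ s * j ^ s = (of_int (m * a + n * c) * \<tau> + of_int (m * b + n * d)) ^ s"
      by (simp only: power_mult_distrib [symmetric])
    show "(case (\<lambda>(m, n). (m * a + n * c, m * b + n * d)) p of (m, n) \<Rightarrow> w (m * d - n * c, n * a - m * b) / (of_int m * \<tau> + of_int n) ^ s)
       = (case p of (m, n) \<Rightarrow> w (m, n) / (of_int m * ((of_int a * \<tau> + of_int b) / j) + of_int n) ^ s) * inverse (j ^ s)"
      unfolding p prod.case inv H [symmetric] by (simp only: divide_inverse inverse_mult_distrib mult.assoc)
  next
    fix p :: "int \<times> int"
    obtain m n where p: "p = (m, n)" by (cases p)
    have "(m * d - n * c) * a + (n * a - m * b) * c = m" "(m * d - n * c) * b + (n * a - m * b) * d = n"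
      using ad by (simp_all add: algebra_simps) (metis ad distrib_left mult.commute mult.left_commute mult_1)+
    thus "(\<lambda>(m, n). (m * a + n * c, m * b + n * d)) ((\<lambda>(m, n). (m * d - n * c, n * a - m * b)) p) = p"
      by (simp add: p)
  qed auto
  finally show ?thesis by (simp add: lattice_sum_def)
qed

text \<open>Rows with m \<noteq> 0 allow a sharper estimate, in which a factor
  \<open>Im \<tau>\<close> is gained: (1 + |m|)(1 + |n|) is at most 7/(Im \<tau>) times |m\<tau> +
  n|^2. Hence only the row m = 0 survives as \<open>Im \<tau>\<close> grows.\<close>

lemma lattice_sum_cusp_bound_aux:
  assumes x: "\<bar>Re \<tau>\<bar> \<le> 1" and y: "Im \<tau> \<ge> 1" and s: "s \<ge> 3" and M: "\<And>p. norm (w p) \<le> M"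
  shows "norm (lattice_sum w s \<tau> - (\<Sum>\<^sub>\<infinity>n. w (0, n) / of_int n ^ s)) \<le>
     M * (7 / Im \<tau>) powr (real s / 2) * (\<Sum>\<^sub>\<infinity>(m, n)\<in>(-{0}) \<times> UNIV. lattice_weight m * lattice_weight n)"
proof -
  define f where "f = (\<lambda>(m, n). w (m, n) / (of_int m * \<tau> + of_int n) ^ s)"
  define g where "g = (\<lambda>(m, n). lattice_weight m * lattice_weight n)"
  have M0: "M \<ge> 0" using M norm_ge_zero order_trans by blast
  have f: "f summable_on UNIV"
    unfolding f_def by (rule lattice_sum_summable) (use assms in auto)
  have g: "g summable_on ((-{0}) \<times> UNIV)"
    unfolding g_def by (rule summable_on_subset_banach[OF summable_lattice_weight_prod]) simp
  have UN: "UNIV = ({0} \<times> UNIV) \<union> ((-{0::int}) \<times> (UNIV :: int set))" by auto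
  have "lattice_sum w s \<tau> = infsum f UNIV" by (simp add: lattice_sum_def f_def)
  also have "\<dots> = infsum f ({0} \<times> UNIV) + infsum f ((-{0}) \<times> UNIV)"
    by (subst UN, rule infsum_Un_disjoint) (auto intro: summable_on_subset_banach[OF f])
  also have "infsum f ({0} \<times> UNIV) = (\<Sum>\<^sub>\<infinity>n. w (0, n) / of_int n ^ s)"
    by (rule infsum_reindex_bij_witness[of _ "Pair 0" snd]) (auto simp: f_def)
  finally have "norm (lattice_sum w s \<tau> - (\<Sum>\<^sub>\<infinity>n. w (0, n) / of_int n ^ s)) = norm (infsum f ((-{0}) \<times> UNIV))"
    by simp
  also have "\<dots> \<le> M * (7 / Im \<tau>) powr (real s / 2) * infsum g ((-{0}) \<times> UNIV)"
  proof (rule norm_infsum_le)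
    show "(f has_sum infsum f ((-{0}) \<times> UNIV)) ((-{0}) \<times> UNIV)"
      by (intro has_sum_infsum summable_on_subset_banach[OF f]) simp
    show "((\<lambda>p. M * (7 / Im \<tau>) powr (real s / 2) * g p) has_sum M * (7 / Im \<tau>) powr (real s / 2) * infsum g ((-{0}) \<times> UNIV)) ((-{0}) \<times> UNIV)"
      by (intro has_sum_cmult_right has_sum_infsum g)
    fix p :: "int \<times> int" assume "p \<in> (-{0}) \<times> UNIV"
    then obtain m n where p: "p = (m, n)" and m: "m \<noteq> 0" by (cases p) auto
    define a b where "a = real_of_int m" and "b = real_of_int n"
    have a1: "\<bar>a\<bar> \<ge> 1" using m unfolding a_def by linarith
    define Q where "Q = (a * Re \<tau> + b)\<^sup>2 + (a * Im \<tau>)\<^sup>2"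
    have Q: "norm (of_int m * \<tau> + of_int n) ^ 2 = Q"
      by (simp add: cmod_power2 Q_def a_def b_def)
    have "1 * 1 \<le> \<bar>a\<bar> * Im \<tau>" using a1 y by (intro mult_mono) auto
    hence "1\<^sup>2 \<le> (\<bar>a\<bar> * Im \<tau>)\<^sup>2" by (intro power_mono) auto
    hence Q1: "1 \<le> Q" "(\<bar>a\<bar> * Im \<tau>)\<^sup>2 \<le> Q" by (auto simp: Q_def power_mult_distrib add_increasing)
    have "a\<^sup>2 * (Re \<tau>)\<^sup>2 \<le> a\<^sup>2 * (Im \<tau>)\<^sup>2"
      using x y by (intro mult_left_mono) (auto simp: abs_le_square_iff [symmetric])
    moreover have "b\<^sup>2 \<le> 2 * (a * Re \<tau> + b)\<^sup>2 + 2 * (a\<^sup>2 * (Re \<tau>)\<^sup>2)"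
      using zero_le_power2[of "2 * (a * Re \<tau>) + b"] by (simp add: power2_eq_square algebra_simps)
    ultimately have b2: "b\<^sup>2 \<le> 2 * Q" by (simp add: Q_def power_mult_distrib)
    \<comment> \<open>The constant 7 is 1 + 2 + 4: the product is at most Q + 2 + 2 b^2, and both 1
      \<le> Q and b^2 \<le> 2Q hold.\<close>
    have "Im \<tau> * ((1 + \<bar>a\<bar>) * (1 + \<bar>b\<bar>)) \<le> Im \<tau> * ((2 * \<bar>a\<bar>) * (1 + \<bar>b\<bar>))"
      using a1 y by (intro mult_left_mono mult_right_mono) auto
    also have "\<dots> \<le> (\<bar>a\<bar> * Im \<tau>)\<^sup>2 + (1 + \<bar>b\<bar>)\<^sup>2"
      using zero_le_power2[of "\<bar>a\<bar> * Im \<tau> - (1 + \<bar>b\<bar>)"] unfolding power2_diff by (simp add: mult_ac)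
    also have "(1 + \<bar>b\<bar>)\<^sup>2 \<le> 2 + 2 * b\<^sup>2"
      using zero_le_power2[of "1 - \<bar>b\<bar>"] unfolding power2_diff power2_sum by simp
    finally have "Im \<tau> * ((1 + \<bar>a\<bar>) * (1 + \<bar>b\<bar>)) \<le> 7 * Q" using Q1 b2 by linarith
    hence "(1 + \<bar>of_int m\<bar>) * (1 + \<bar>of_int n\<bar>) \<le> 7 / Im \<tau> * norm (of_int m * \<tau> + of_int n) ^ 2"
      using y unfolding Q a_def b_def by (simp add: field_simps)
    hence "norm (1 / (of_int m * \<tau> + of_int n) ^ s) \<le> (7 / Im \<tau>) powr (real s / 2) * (lattice_weight m * lattice_weight n)"
      using y s by (intro inverse_power_le_lattice_weight) auto
    hence "norm (w (m, n)) * norm (1 / (of_int m * \<tau> + of_int n) ^ s) \<le> M * ((7 / Im \<tau>) powr (real s / 2) * (lattice_weight m * lattice_weight n))"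
      using M0 M by (intro mult_mono) auto
    thus "norm (f p) \<le> M * (7 / Im \<tau>) powr (real s / 2) * g p"
      unfolding norm_mult [symmetric] by (simp add: f_def g_def p mult_ac)
  qed
  finally show ?thesis unfolding g_def .
qed

text \<open>Translating by the integer part of \<open>Re \<tau>\<close> changes the weight only by a
  shear, which preserves its bound and its row m = 0. This gives the uniformity in the real part
  that the limit along \<open>filtercomap Im at_top\<close> demands.\<close>

lemma lattice_sum_cusp_bound:
  assumes y: "Im \<tau> \<ge> 1" and s: "s \<ge> 3" and M: "\<And>p. norm (w p) \<le> M"
  shows "norm (lattice_sum w s \<tau> - (\<Sum>\<^sub>\<infinity>n. w (0, n) / of_int n ^ s)) \<le>
     M * (7 / Im \<tau>) powr (real s / 2) * (\<Sum>\<^sub>\<infinity>(m, n)\<in>(-{0}) \<times> UNIV. lattice_weight m * lattice_weight n)"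
proof -
  define j where "j = \<lfloor>Re \<tau>\<rfloor>"
  define \<tau>' where "\<tau>' = \<tau> - of_int j"
  define w' where "w' = (\<lambda>(m, n). w (m, n - m * j))"
  have "\<bar>Re \<tau>'\<bar> \<le> 1" unfolding \<tau>'_def j_def by (simp add: abs_le_iff) linarith
  hence "norm (lattice_sum w' s \<tau>' - (\<Sum>\<^sub>\<infinity>n. w' (0, n) / of_int n ^ s)) \<le>
     M * (7 / Im \<tau>') powr (real s / 2) * (\<Sum>\<^sub>\<infinity>(m, n)\<in>(-{0}) \<times> UNIV. lattice_weight m * lattice_weight n)"
    using y s M by (intro lattice_sum_cusp_bound_aux) (auto simp: \<tau>'_def w'_def split: prod.splits)
  moreover have "lattice_sum w' s \<tau>' = lattice_sum w s \<tau>"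
    using lattice_sum_slash[of \<tau>' 1 1 j 0 s w] y by (simp add: weight_slash_def w'_def \<tau>'_def)
  ultimately show ?thesis by (simp add: \<tau>'_def w'_def)
qed

lemma lattice_sum_cusp_limit:
  assumes s: "s \<ge> 3" and M: "\<And>p. norm (w p) \<le> M"
  shows "(lattice_sum w s \<longlongrightarrow> (\<Sum>\<^sub>\<infinity>n. w (0, n) / of_int n ^ s)) (filtercomap Im at_top)"
proof (rule LIM_zero_cancel)
  define W where "W = (\<Sum>\<^sub>\<infinity>(m, n)\<in>(-{0}) \<times> UNIV. lattice_weight m * lattice_weight n)"
  have "((\<lambda>y. M * (7 / y) powr (real s / 2) * W) \<longlongrightarrow> 0) at_top"
  proof -
    have "((\<lambda>y. y powr (- (real s / 2))) \<longlongrightarrow> 0) at_top"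
      by (rule tendsto_neg_powr) (use s in \<open>auto intro: filterlim_ident\<close>)
    hence "((\<lambda>y. M * 7 powr (real s / 2) * W * y powr (- (real s / 2))) \<longlongrightarrow> M * 7 powr (real s / 2) * W * 0) at_top"
      by (intro tendsto_intros)
    moreover have "eventually (\<lambda>y. M * 7 powr (real s / 2) * W * y powr (- (real s / 2)) = M * (7 / y) powr (real s / 2) * W) at_top"
      using eventually_gt_at_top[of 0] by eventually_elim (simp add: powr_divide powr_minus_divide)
    ultimately show ?thesis by (simp add: tendsto_cong)
  qed
  hence lim: "((\<lambda>\<tau>. M * (7 / Im \<tau>) powr (real s / 2) * W) \<longlongrightarrow> 0) (filtercomap Im at_top)"
    by (rule filterlim_compose) (rule filterlim_filtercomap)
  have "eventually (\<lambda>\<tau>. Im \<tau> \<ge> 1) (filtercomap Im at_top)"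
    using eventually_ge_at_top[of 1] by (rule eventually_filtercomapI)
  hence "eventually (\<lambda>\<tau>. norm (lattice_sum w s \<tau> - (\<Sum>\<^sub>\<infinity>n. w (0, n) / of_int n ^ s)) \<le> M * (7 / Im \<tau>) powr (real s / 2) * W) (filtercomap Im at_top)"
  proof eventually_elim
    case (elim \<tau>)
    show ?case using lattice_sum_cusp_bound[OF elim s M] unfolding W_def .
  qed
  from Lim_null_comparison[OF this lim]
  show "((\<lambda>\<tau>. lattice_sum w s \<tau> - (\<Sum>\<^sub>\<infinity>n. w (0, n) / of_int n ^ s)) \<longlongrightarrow> 0) (filtercomap Im at_top)" .
qed

section \<open>The inversion formula of the eta function\<close>

definition euler_prod :: "complex \<Rightarrow> complex" where
  "euler_prod q = (\<Prod>n. 1 - q ^ Suc n)"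

lemma dedekind_eta_euler_prod:
  "dedekind_eta \<tau> = exp (2 * of_real pi * \<i> * \<tau> / 24) * euler_prod (nome \<tau>)"
  by (simp add: dedekind_eta_def euler_prod_def)

lemma convergent_euler_prod:
  assumes "norm q < 1"
  shows "convergent_prod (\<lambda>n. 1 - q ^ Suc n :: complex)"
proof -
  have "summable (\<lambda>n. norm q * norm q ^ n)"
    using assms by (intro summable_mult summable_geometric) simp
  hence "abs_convergent_prod (\<lambda>n. 1 - q ^ Suc n)"
    by (intro summable_imp_abs_convergent_prod) (simp add: norm_mult norm_power)
  thus ?thesis by (rule abs_convergent_prod_imp_convergent_prod)
qed

lemma power_Suc_less_1:
  fixes r :: real
  assumes "0 \<le> r" "r < 1"
  shows "r ^ Suc n < 1"
proof -
  have "r * r ^ n \<le> r * 1" using assms by (intro mult_left_mono power_le_one) auto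
  thus ?thesis using assms by simp
qed

lemma one_minus_power_nonzero:
  fixes q :: complex
  assumes "norm q < 1"
  shows "1 - q ^ Suc n \<noteq> 0"
proof
  assume "1 - q ^ Suc n = 0"
  hence "norm (q ^ Suc n) = 1" by simp
  moreover have "norm q ^ Suc n < 1" using assms by (intro power_Suc_less_1) auto
  ultimately show False by (simp only: norm_power)
qed

lemma euler_prod_nonzero:
  assumes "norm q < 1"
  shows "euler_prod q \<noteq> 0"
  unfolding euler_prod_def
  using prodinf_nonzero[OF convergent_euler_prod[OF assms]] one_minus_power_nonzero[OF assms] by blast

lemma uniform_limit_euler_prod:
  assumes r: "0 \<le> r" "r < 1"
  shows "uniform_limit (cball 0 r) (\<lambda>N q. \<Prod>n<N. 1 - q ^ Suc n) euler_prod sequentially"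
proof -
  have "uniformly_convergent_on (cball 0 r) (\<lambda>N q :: complex. \<Sum>n<N. norm (1 - q ^ Suc n - 1))"
  proof (rule Weierstrass_m_test')
    show "summable (\<lambda>n. r * r ^ n)" using r by (intro summable_mult summable_geometric) simp
    show "norm (norm (1 - q ^ Suc n - 1)) \<le> r * r ^ n" if "q \<in> cball 0 r" for n and q :: complex
      using that power_mono[of "norm q" r "Suc n"] by (simp add: norm_power norm_mult)
  qed
  hence "uniformly_convergent_on (cball 0 r) (\<lambda>N q :: complex. \<Prod>n<N. 1 - q ^ Suc n)"
    by (intro uniformly_convergent_on_prod') (auto intro!: continuous_intros)
  then obtain l where l: "uniform_limit (cball 0 r) (\<lambda>N q :: complex. \<Prod>n<N. 1 - q ^ Suc n) l sequentially"
    by (auto simp: uniformly_convergent_on_def)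
  have "l q = euler_prod q" if "q \<in> cball 0 r" for q
  proof -
    have "norm q < 1" using that r by simp
    from convergent_euler_prod[OF this] have "(\<lambda>n. 1 - q ^ Suc n) has_prod euler_prod q"
      unfolding euler_prod_def by (simp add: convergent_prod_has_prod_iff)
    hence "(\<lambda>N. \<Prod>n<N. 1 - q ^ Suc n) \<longlonglongrightarrow> euler_prod q"
      by (rule has_prod_imp_tendsto')
    moreover have "(\<lambda>N. \<Prod>n<N. 1 - q ^ Suc n) \<longlonglongrightarrow> l q"
      using l that by (rule tendsto_uniform_limitI)
    ultimately show ?thesis using LIMSEQ_unique by blast
  qed
  with l show ?thesis
    by (subst uniform_limit_cong'[where g = "\<lambda>N q. \<Prod>n<N. 1 - q ^ Suc n" and i = l]) auto
qed

lemma euler_prod_log_deriv: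
  assumes "norm q < 1"
  shows "euler_prod field_differentiable at q"
    and "(\<lambda>n. - of_nat (Suc n) * q ^ n / (1 - q ^ Suc n)) sums (deriv euler_prod q / euler_prod q)"
proof -
  define r where "r = (1 + norm q) / 2"
  have r: "0 \<le> r" "r < 1" "norm q < r" using assms by (auto simp: r_def)
  have lim: "uniform_limit (ball 0 r) (\<lambda>N q. \<Prod>n<N. 1 - q ^ Suc n) euler_prod sequentially"
    by (rule uniform_limit_on_subset[OF uniform_limit_euler_prod[OF r(1,2)]]) auto
  have "euler_prod holomorphic_on ball 0 r"
    by (rule holomorphic_uniform_limit_open[OF lim]) (auto intro!: holomorphic_intros)
  thus "euler_prod field_differentiable at q"
    using r by (simp add: holomorphic_on_open field_differentiable_def)
  have "(\<lambda>n. deriv (\<lambda>q. 1 - q ^ Suc n) q / (1 - q ^ Suc n)) sums (deriv euler_prod q / euler_prod q)"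
    by (rule logderiv_prodinf_complex_uniform_limit[OF lim])
       (use r assms euler_prod_nonzero in \<open>auto intro!: holomorphic_intros\<close>)
  moreover have "deriv (\<lambda>q. 1 - q ^ Suc n) q = - of_nat (Suc n) * q ^ n" for n
    using DERIV_imp_deriv[OF DERIV_diff[OF DERIV_const[of 1] DERIV_power_Suc[OF DERIV_ident, of n]], of q]
    by (simp add: algebra_simps)
  ultimately show "(\<lambda>n. - of_nat (Suc n) * q ^ n / (1 - q ^ Suc n)) sums (deriv euler_prod q / euler_prod q)"
    by simp
qed

lemma euler_prod_at_0: "euler_prod 0 = 1"
  by (simp add: euler_prod_def)

lemma nome_of_nat_mult: "nome (of_nat n * z) = nome z ^ n"
  by (simp add: nome_def exp_of_nat_mult [symmetric] mult_ac)

lemma dedekind_eta_nonzero: "Im \<tau> > 0 \<Longrightarrow> dedekind_eta \<tau> \<noteq> 0"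
  by (simp add: dedekind_eta_euler_prod euler_prod_nonzero nome_norm_less_1)

section \<open>The Eisenstein series of weight two\<close>

definition int_square_sum :: "complex \<Rightarrow> complex" where
  "int_square_sum z = (\<Sum>\<^sub>\<infinity>n::int. 1 / (z + of_int n) ^ 2)"

lemma int_square_sum_minus: "int_square_sum (- z) = int_square_sum z"
  unfolding int_square_sum_def
proof (rule infsum_reindex_bij_witness[of _ uminus uminus])
  fix n :: int
  have "z + of_int (- n) = - (- z + of_int n)" by simp
  thus "1 / (z + of_int (- n)) ^ 2 = 1 / (- z + of_int n) ^ 2" by (simp only: power2_minus)
qed auto

text \<open>The index n = 0 contributes 1/0 = 0, so the value is 2 \<zeta>(2). It serves as the
  central row of the Eisenstein series, with the origin automatically omitted.\<close>

lemma int_square_sum_0: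
  "((\<lambda>n::int. 1 / (0 + of_int n) ^ 2) has_sum (of_real (pi\<^sup>2 / 3) :: complex)) UNIV"
proof -
  have "((\<lambda>n. 1 / real (Suc n) ^ 2) has_sum (pi\<^sup>2 / 6)) UNIV"
    using inverse_squares_sums by (intro sums_nonneg_imp_has_sum) (auto simp: add.commute)
  hence "((\<lambda>n. of_real (1 / real (Suc n) ^ 2)) has_sum (of_real (pi\<^sup>2 / 6) :: complex)) UNIV"
    by (rule has_sum_of_real)
  hence s: "((\<lambda>n. 1 / (of_nat (Suc n)) ^ 2) has_sum (of_real (pi\<^sup>2 / 6) :: complex)) UNIV"
    by simp
  have "((\<lambda>n::int. 1 / (0 + of_int n) ^ 2) has_sum (1 / (0 + of_int 0) ^ 2 + of_real (pi\<^sup>2 / 6) + of_real (pi\<^sup>2 / 6) :: complex)) UNIV"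
  proof (rule has_sum_int_nat0)
    show "((\<lambda>n. 1 / (0 + of_int (int (Suc n))) ^ 2) has_sum (of_real (pi\<^sup>2 / 6) :: complex)) UNIV"
      using s by simp
    have "(0 + of_int (- int (Suc n))) ^ 2 = ((of_nat (Suc n)) ^ 2 :: complex)" for n
      by (simp add: power2_eq_square algebra_simps)
    thus "((\<lambda>n. 1 / (0 + of_int (- int (Suc n))) ^ 2) has_sum (of_real (pi\<^sup>2 / 6) :: complex)) UNIV"
      using s by simp
  qed
  also have "(1 / (0 + of_int 0) ^ 2 + of_real (pi\<^sup>2 / 6) + of_real (pi\<^sup>2 / 6) :: complex) = of_real (pi\<^sup>2 / 3)"
    by simp
  finally show ?thesis .
qed

lemma has_sum_int_square_sum:
  assumes "Im z \<noteq> 0 \<or> z = 0"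
  shows "((\<lambda>n. 1 / (z + of_int n) ^ 2) has_sum int_square_sum z) UNIV"
proof -
  have "(\<lambda>n::int. 1 / (z + of_int n) ^ 2) summable_on UNIV"
    using assms
  proof
    assume "Im z \<noteq> 0"
    hence "z \<notin> \<int>" by (rule not_Ints_upper)
    from has_sum_cot_deriv[OF this, of 1] show ?thesis
      by (auto simp: summable_on_def numeral_2_eq_2)
  next
    assume "z = 0"
    thus ?thesis using int_square_sum_0 has_sum_imp_summable by blast
  qed
  thus ?thesis unfolding int_square_sum_def by (rule has_sum_infsum)
qed

lemma int_square_sum_q_expansion:
  assumes "Im z > 0"
  shows "int_square_sum z = - (4 * of_real pi ^ 2) * (\<Sum>n. of_nat n * nome z ^ n)"
proof -
  have "((\<lambda>n. 1 / (z + of_int n) ^ 2) has_sum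
     ((- 2 * of_real pi * \<i>) ^ 2 * (\<Sum>n. of_nat n * nome z ^ n))) UNIV"
    using lipschitz_formula[OF assms, of 1] by (simp add: numeral_2_eq_2)
  thus ?thesis unfolding int_square_sum_def by (simp add: infsumI power_mult_distrib)
qed

text \<open>Absolute convergence allows the double series of n q^(nj) to be summed over j first,
  giving a Lambert series, or over n first, giving q-expansions of
  \<open>int_square_sum\<close>.\<close>

lemma summable_divisor_series:
  fixes q :: complex
  assumes "norm q < 1"
  shows "(\<lambda>(n, j). of_nat (Suc n) * q ^ (Suc n * Suc j)) summable_on UNIV \<times> UNIV"
proof (rule abs_summable_summable)
  define r where "r = norm q"
  have r: "0 \<le> r" "r < 1" using assms by (auto simp: r_def)
  have "(\<lambda>(n, j). real (Suc n) * r ^ (Suc n * Suc j)) summable_on UNIV \<times> UNIV"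
  proof (rule summable_on_SigmaI)
    fix n
    have rn: "0 \<le> r ^ Suc n" "r ^ Suc n < 1" using r by (auto intro!: power_Suc_less_1 simp del: power_Suc)
    have "(\<lambda>j. real (Suc n) * r ^ Suc n * (r ^ Suc n) ^ j) sums (real (Suc n) * r ^ Suc n * (1 / (1 - r ^ Suc n)))"
      using rn by (intro sums_mult geometric_sums) simp
    hence "((\<lambda>j. real (Suc n) * r ^ Suc n * (r ^ Suc n) ^ j) has_sum (real (Suc n) * r ^ Suc n * (1 / (1 - r ^ Suc n)))) UNIV"
      using rn by (intro sums_nonneg_imp_has_sum) auto
    moreover have "real (Suc n) * r ^ Suc n * (r ^ Suc n) ^ j = real (Suc n) * r ^ (Suc n * Suc j)" for j
      by (simp only: power_mult power_Suc mult.assoc)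
    ultimately show "((\<lambda>j. case (n, j) of (n, j) \<Rightarrow> real (Suc n) * r ^ (Suc n * Suc j)) has_sum (real (Suc n) * r ^ Suc n * (1 / (1 - r ^ Suc n)))) UNIV"
      by (simp only: prod.case)
  next
    have "summable (\<lambda>n. of_nat (Suc n) ^ 1 * (of_real r) ^ Suc n :: complex)"
      by (rule summable_nat_power_geometric) (use r in simp)
    also have "(\<lambda>n. of_nat (Suc n) ^ 1 * (of_real r) ^ Suc n :: complex) = (\<lambda>n. of_real (real (Suc n) * r ^ Suc n))"
      by simp
    finally have S: "summable (\<lambda>n. real (Suc n) * r ^ Suc n * (1 / (1 - r)))"
      by (intro summable_mult2) (simp only: summable_complex_of_real)
    have "(\<lambda>n. real (Suc n) * r ^ Suc n * (1 / (1 - r))) summable_on UNIV"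
      using S r by (subst summable_on_UNIV_nonneg_real_iff) auto
    thus "(\<lambda>n. real (Suc n) * r ^ Suc n * (1 / (1 - r ^ Suc n))) summable_on UNIV"
    proof (rule summable_on_comparison_test)
      fix n
      have "r ^ Suc n \<le> r ^ 1" using r by (intro power_decreasing) auto
      hence "1 / (1 - r ^ Suc n) \<le> 1 / (1 - r)" using r by (intro divide_left_mono mult_pos_pos) auto
      thus "real (Suc n) * r ^ Suc n * (1 / (1 - r ^ Suc n)) \<le> real (Suc n) * r ^ Suc n * (1 / (1 - r))"
        using r by (intro mult_left_mono) auto
      have "r ^ Suc n < 1" using r by (intro power_Suc_less_1) auto
      thus "0 \<le> real (Suc n) * r ^ Suc n * (1 / (1 - r ^ Suc n))"
        using r by simp
    qed
  qed (use r in auto)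
  thus "(\<lambda>p. norm (case p of (n, j) \<Rightarrow> of_nat (Suc n) * q ^ (Suc n * Suc j))) summable_on UNIV \<times> UNIV"
    by (rule summable_on_cong[THEN iffD1, rotated]) (auto simp: norm_mult norm_power r_def simp del: of_nat_Suc power_Suc mult_Suc mult_Suc_right)
qed

text \<open>This is pi^2/3 times the quasi-modular E_2. The nesting is essential: the double series
  is not absolutely convergent, and the inner sum runs over the integer translates.\<close>

definition E2_sum :: "complex \<Rightarrow> complex" where
  "E2_sum \<tau> = (\<Sum>\<^sub>\<infinity>n::int. int_square_sum (of_int n * \<tau>))"

text \<open>The rows n and -n agree, so the total is the row 0 plus twice the positive rows.
  Expanding these in q and exchanging the two summations collects them into a Lambert
  series.\<close>

lemma E2_sum_expansion:
  assumes "Im \<tau> > 0"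
  defines "q \<equiv> nome \<tau>"
  shows "((\<lambda>n. int_square_sum (of_int n * \<tau>)) has_sum
     (of_real (pi\<^sup>2 / 3) - 8 * of_real pi ^ 2 * (\<Sum>n. of_nat (Suc n) * q ^ Suc n / (1 - q ^ Suc n)))) UNIV"
proof -
  have q: "norm q < 1" unfolding q_def by (rule nome_norm_less_1) fact
  let ?T = "\<lambda>(n, j). of_nat (Suc n) * q ^ (Suc n * Suc j) :: complex"
  note sum = summable_divisor_series[OF q]
  obtain S where S: "(?T has_sum S) (UNIV \<times> UNIV)" using sum by (auto simp: summable_on_def)
  have row: "((\<lambda>j. ?T (n, j)) has_sum (of_nat (Suc n) * q ^ Suc n / (1 - q ^ Suc n))) UNIV" for n
  proof -
    have "norm (q ^ Suc n) < 1" using power_Suc_less_1[of "norm q" n] q by (simp only: norm_power) simp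
    hence "(\<lambda>j. of_nat (Suc n) * q ^ Suc n * (q ^ Suc n) ^ j) sums (of_nat (Suc n) * q ^ Suc n * (1 / (1 - q ^ Suc n)))"
      by (intro sums_mult geometric_sums)
    moreover have "of_nat (Suc n) * q ^ Suc n * (q ^ Suc n) ^ j = ?T (n, j)" for j
      by (simp only: power_mult power_Suc mult.assoc prod.case)
    ultimately have "(\<lambda>j. ?T (n, j)) sums (of_nat (Suc n) * q ^ Suc n / (1 - q ^ Suc n))"
      by (simp only: prod.case times_divide_eq_right mult_1_right)
    moreover obtain a where "((\<lambda>j. ?T (n, j)) has_sum a) UNIV"
      using summable_on_SigmaD1[of "\<lambda>n j. ?T (n, j)" UNIV "\<lambda>_. UNIV" n] sum by (auto simp: summable_on_def)
    ultimately show ?thesis using has_sum_imp_sums sums_unique2 by blast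
  qed
  have "((\<lambda>n. of_nat (Suc n) * q ^ Suc n / (1 - q ^ Suc n)) has_sum S) UNIV"
    by (rule has_sum_SigmaD[OF S row])
  hence S_eq: "S = (\<Sum>n. of_nat (Suc n) * q ^ Suc n / (1 - q ^ Suc n))"
    using has_sum_imp_sums sums_unique by blast
  have S': "((\<lambda>(j, n). ?T (n, j)) has_sum S) (UNIV \<times> UNIV)"
    using S by (subst has_sum_swap) simp
  have col: "((\<lambda>n. ?T (n, j)) has_sum (- 1 / (4 * of_real pi ^ 2) * int_square_sum (of_nat (Suc j) * \<tau>))) UNIV" for j
  proof -
    have z: "Im (of_nat (Suc j) * \<tau>) > 0" using assms by simp
    have nz: "nome (of_nat (Suc j) * \<tau>) = q ^ Suc j" unfolding q_def by (rule nome_of_nat_mult)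
    have "norm (q ^ Suc j) < 1" using power_Suc_less_1[of "norm q" j] q by (simp only: norm_power) simp
    from summable_nat_power_mult_geometric[OF this, of 1]
    have "(\<lambda>n. of_nat n * (q ^ Suc j) ^ n) sums (\<Sum>n. of_nat n * (q ^ Suc j) ^ n)"
      by (simp add: summable_sums)
    hence "(\<lambda>n. of_nat (Suc n) * (q ^ Suc j) ^ Suc n) sums (\<Sum>n. of_nat n * (q ^ Suc j) ^ n)"
      by (subst sums_Suc_iff) simp
    also have "(\<lambda>n. of_nat (Suc n) * (q ^ Suc j) ^ Suc n) = (\<lambda>n. ?T (n, j))"
      by (simp only: power_mult [symmetric] prod.case mult.commute[of "Suc j"])
    also have "(\<Sum>n. of_nat n * (q ^ Suc j) ^ n) = - 1 / (4 * of_real pi ^ 2) * int_square_sum (of_nat (Suc j) * \<tau>)"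
      unfolding int_square_sum_q_expansion[OF z] nz by simp
    finally have "(\<lambda>n. ?T (n, j)) sums (- 1 / (4 * of_real pi ^ 2) * int_square_sum (of_nat (Suc j) * \<tau>))" .
    moreover obtain a where "((\<lambda>n. ?T (n, j)) has_sum a) UNIV"
      using summable_on_SigmaD1[of "\<lambda>j n. ?T (n, j)" UNIV "\<lambda>_. UNIV" j] S' has_sum_imp_summable by (auto simp: summable_on_def)
    ultimately show ?thesis using has_sum_imp_sums sums_unique2 by blast
  qed
  have "((\<lambda>j. - 1 / (4 * of_real pi ^ 2) * int_square_sum (of_nat (Suc j) * \<tau>)) has_sum S) UNIV"
    by (rule has_sum_SigmaD[OF S']) (use col in simp)
  from has_sum_cmult_right[OF this, of "- (4 * of_real pi ^ 2)"]
  have pos: "((\<lambda>j. int_square_sum (of_nat (Suc j) * \<tau>)) has_sum (- (4 * of_real pi ^ 2) * S)) UNIV"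
    by simp
  have "((\<lambda>n. int_square_sum (of_int n * \<tau>)) has_sum
     (int_square_sum (of_int 0 * \<tau>) + (- (4 * of_real pi ^ 2) * S) + (- (4 * of_real pi ^ 2) * S))) UNIV"
  proof (rule has_sum_int_nat0)
    show "((\<lambda>n. int_square_sum (of_int (int (Suc n)) * \<tau>)) has_sum (- (4 * of_real pi ^ 2) * S)) UNIV"
      using pos by simp
    have "int_square_sum (of_int (- int (Suc n)) * \<tau>) = int_square_sum (of_nat (Suc n) * \<tau>)" for n
      using int_square_sum_minus[of "of_nat (Suc n) * \<tau>"] by (simp add: algebra_simps)
    thus "((\<lambda>n. int_square_sum (of_int (- int (Suc n)) * \<tau>)) has_sum (- (4 * of_real pi ^ 2) * S)) UNIV"
      using pos by simp
  qed
  moreover have "int_square_sum 0 = of_real (pi\<^sup>2 / 3)"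
    unfolding int_square_sum_def using infsumI[OF int_square_sum_0] by simp
  ultimately show ?thesis by (simp add: S_eq mult.assoc)
qed

text \<open>The logarithmic derivative of \<eta> is (2 pi i/24) E_2, and dividing by the factor
  pi^2/3 contained in \<open>E2_sum\<close> gives the constant i/(4 pi).\<close>

lemma has_field_derivative_dedekind_eta:
  assumes "Im \<tau> > 0"
  shows "(dedekind_eta has_field_derivative (\<i> / (4 * of_real pi) * E2_sum \<tau> * dedekind_eta \<tau>)) (at \<tau>)"
proof -
  define q where "q = nome \<tau>"
  have q: "norm q < 1" unfolding q_def by (rule nome_norm_less_1) fact
  define e where "e = exp (2 * of_real pi * \<i> * \<tau> / 24)"
  note nz = euler_prod_nonzero[OF q]
  define L where "L = (\<Sum>n. of_nat (Suc n) * q ^ Suc n / (1 - q ^ Suc n))"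
  have "(\<lambda>n. - q * (- of_nat (Suc n) * q ^ n / (1 - q ^ Suc n))) sums (- q * (deriv euler_prod q / euler_prod q))"
    by (intro sums_mult euler_prod_log_deriv q)
  also have "(\<lambda>n. - q * (- of_nat (Suc n) * q ^ n / (1 - q ^ Suc n))) = (\<lambda>n. of_nat (Suc n) * q ^ Suc n / (1 - q ^ Suc n))"
  proof
    fix n
    have "- q * (- of_nat (Suc n) * q ^ n) = of_nat (Suc n) * q ^ Suc n"
      by (simp add: algebra_simps)
    thus "- q * (- of_nat (Suc n) * q ^ n / (1 - q ^ Suc n)) = of_nat (Suc n) * q ^ Suc n / (1 - q ^ Suc n)"
      by (simp only: times_divide_eq_right)
  qed
  finally have "L = - q * (deriv euler_prod q / euler_prod q)" by (simp add: L_def sums_iff)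
  hence L: "q * deriv euler_prod q = - L * euler_prod q" using nz by simp
  have E2: "E2_sum \<tau> = of_real (pi\<^sup>2 / 3) - 8 * of_real pi ^ 2 * L"
    unfolding E2_sum_def L_def q_def by (rule infsumI[OF E2_sum_expansion[OF assms]])
  have "(euler_prod has_field_derivative deriv euler_prod q) (at (nome \<tau>))"
    using euler_prod_log_deriv(1)[OF q] unfolding q_def by (rule field_differentiable_derivI)
  hence "((\<lambda>\<tau>. exp (2 * of_real pi * \<i> * \<tau> / 24) * euler_prod (nome \<tau>)) has_field_derivative
      (2 * of_real pi * \<i> / 24 * e * euler_prod q + deriv euler_prod q * (2 * of_real pi * \<i> * q) * e)) (at \<tau>)"
    unfolding e_def q_def
    by (auto intro!: derivative_eq_intros DERIV_chain2[where g = nome] simp: mult_ac)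
  also have "(2 * of_real pi * \<i> / 24 * e * euler_prod q + deriv euler_prod q * (2 * of_real pi * \<i> * q) * e)
     = 2 * of_real pi * \<i> * e * (euler_prod q / 24 + q * deriv euler_prod q)"
    by (simp add: algebra_simps)
  also have "\<dots> = \<i> / (4 * of_real pi) * E2_sum \<tau> * (e * euler_prod q)"
    unfolding L E2 by (simp add: field_simps power2_eq_square)
  finally show ?thesis
    unfolding dedekind_eta_euler_prod [abs_def] e_def q_def .
qed

lemma cot_nome:
  assumes "Im z > 0"
  shows "of_real pi * cot (of_real pi * z) = of_real pi * \<i> - 2 * of_real pi * \<i> / (1 - nome z)"
proof -
  have "z \<notin> \<int>" using assms not_Ints_upper by simp
  moreover have "(\<Sum>n. nome z ^ n) = 1 / (1 - nome z)"
    by (rule suminf_geometric) (rule nome_norm_less_1[OF assms])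
  ultimately show ?thesis
    using cot_deriv_q_expansion[OF assms, of 0] by (simp add: cot_deriv_0)
qed

lemma cot_minus: "cot (- z :: complex) = - cot z"
  by (simp add: cot_def)

text \<open>Doubling n\<tau> + j \<plusminus> 1/2 gives the lattice point with coordinates 2n and 2j
  \<plusminus> 1, which is never the origin because the second one is odd. This costs the factor 4
  in the constant.\<close>

lemma lattice_point_shift_bound:
  assumes "Im \<tau> > 0"
  obtains K where "K > 0"
    "\<And>n j. (n, j) \<noteq> (0, 0) \<Longrightarrow>
       (1 + \<bar>of_int n\<bar>) * (1 + \<bar>of_int j\<bar>) \<le> K * norm (of_int n * \<tau> + of_int j) ^ 2"
    "\<And>n j. (1 + \<bar>of_int n\<bar>) * (1 + \<bar>of_int j\<bar>) \<le> K * norm (of_int n * \<tau> + of_int j - 1/2) ^ 2"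
    "\<And>n j. (1 + \<bar>of_int n\<bar>) * (1 + \<bar>of_int j\<bar>) \<le> K * norm (of_int n * \<tau> + of_int j + 1/2) ^ 2"
proof -
  define K0 where "K0 = 3 * (2 + (2 * \<bar>Re \<tau>\<bar>\<^sup>2 + 1) / (Im \<tau>)\<^sup>2)"
  have K0: "K0 > 0" unfolding K0_def by (intro mult_pos_pos add_pos_nonneg) auto
  have bd: "(1 + \<bar>of_int n\<bar>) * (1 + \<bar>of_int j\<bar>) \<le> K0 * norm (of_int n * \<tau> + of_int j) ^ 2"
    if "(n, j) \<noteq> (0, 0)" for n j
    unfolding K0_def using lattice_prod_le_norm[of \<tau> "\<bar>Re \<tau>\<bar>" "Im \<tau>" n j] assms that by simp
  have half: "(1 + \<bar>of_int n\<bar>) * (1 + \<bar>of_int j\<bar>) \<le> 4 * K0 * norm (of_int n * \<tau> + of_int j + of_int e / 2) ^ 2"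
    if e: "e = 1 \<or> e = -1" for n j e :: int
  proof -
    have "\<bar>j\<bar> \<le> \<bar>2 * j + e\<bar>" using e by arith
    have "odd (2 * j + e)" using e by auto
    hence "2 * j + e \<noteq> 0" by (metis even_zero)
    hence "(2 * n, 2 * j + e) \<noteq> (0, 0)" by simp
    have "(1 + \<bar>of_int n\<bar>) * (1 + \<bar>of_int j\<bar>) \<le> (1 + \<bar>real_of_int (2 * n)\<bar>) * (1 + \<bar>real_of_int (2 * j + e)\<bar>)"
    proof (intro mult_mono)
      have "real_of_int \<bar>j\<bar> \<le> real_of_int \<bar>2 * j + e\<bar>" using \<open>\<bar>j\<bar> \<le> \<bar>2 * j + e\<bar>\<close> by linarith
      thus "1 + \<bar>real_of_int j\<bar> \<le> 1 + \<bar>real_of_int (2 * j + e)\<bar>" by simp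
    qed auto
    also have "\<dots> \<le> K0 * norm (of_int (2 * n) * \<tau> + of_int (2 * j + e)) ^ 2"
      by (rule bd) fact
    also have "of_int (2 * n) * \<tau> + of_int (2 * j + e) = 2 * (of_int n * \<tau> + of_int j + of_int e / 2)"
      by (simp add: algebra_simps)
    also have "K0 * norm (2 * (of_int n * \<tau> + of_int j + of_int e / 2)) ^ 2 = 4 * K0 * norm (of_int n * \<tau> + of_int j + of_int e / 2) ^ 2"
      by (simp only: norm_mult power_mult_distrib) simp
    finally show ?thesis .
  qed
  show ?thesis
  proof (rule that[of "4 * K0"])
    show "4 * K0 > 0" using K0 by simp
    show "(1 + \<bar>of_int n\<bar>) * (1 + \<bar>of_int j\<bar>) \<le> 4 * K0 * norm (of_int n * \<tau> + of_int j) ^ 2"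
      if "(n, j) \<noteq> (0, 0)" for n j
      by (rule order_trans[OF bd[OF that]]) (use K0 in \<open>auto intro!: mult_right_mono\<close>)
    show "(1 + \<bar>of_int n\<bar>) * (1 + \<bar>of_int j\<bar>) \<le> 4 * K0 * norm (of_int n * \<tau> + of_int j - 1/2) ^ 2" for n j
      using half[of "-1" n j] by simp
    show "(1 + \<bar>of_int n\<bar>) * (1 + \<bar>of_int j\<bar>) \<le> 4 * K0 * norm (of_int n * \<tau> + of_int j + 1/2) ^ 2" for n j
      using half[of 1 n j] by simp
  qed
qed

text \<open>The telescoping terms \<open>1/(x - 1/2) - 1/(x + 1/2)\<close> regularise \<open>1/x\<^sup>2\<close> at every lattice point,
  including \<open>(0, 0)\<close>, where \<open>1/0 = 0\<close> drops the pole.\<close>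

lemma eisenstein_remainder_summable:
  assumes "Im \<tau> > 0"
  shows "(\<lambda>(n, j). 1 / (of_int n * \<tau> + of_int j) ^ 2 -
     (1 / (of_int n * \<tau> + of_int j - 1/2) - 1 / (of_int n * \<tau> + of_int j + 1/2)))
     summable_on (UNIV :: (int \<times> int) set)"
proof -
  obtain K where K: "K > 0"
    "\<And>n j. (n, j) \<noteq> (0, 0) \<Longrightarrow>
       (1 + \<bar>of_int n\<bar>) * (1 + \<bar>of_int j\<bar>) \<le> K * norm (of_int n * \<tau> + of_int j) ^ 2"
    "\<And>n j. (1 + \<bar>of_int n\<bar>) * (1 + \<bar>of_int j\<bar>) \<le> K * norm (of_int n * \<tau> + of_int j - 1/2) ^ 2"
    "\<And>n j. (1 + \<bar>of_int n\<bar>) * (1 + \<bar>of_int j\<bar>) \<le> K * norm (of_int n * \<tau> + of_int j + 1/2) ^ 2"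
    using lattice_point_shift_bound[OF assms] by metis
  define R where "R = (\<lambda>(n, j). 1 / (of_int n * \<tau> + of_int j) ^ 2 -
     (1 / (of_int n * \<tau> + of_int j - 1/2) - 1 / (of_int n * \<tau> + of_int j + 1/2)))"
  \<comment> \<open>The summand 4 covers the origin, where the remainder is 0 - (-2 - 2) = 4; the
    summand K^2 covers all other points.\<close>
  have "norm (R p) \<le> (4 + K\<^sup>2) * (case p of (n, j) \<Rightarrow> lattice_weight n * lattice_weight j)" for p
  proof -
    obtain n j where p: "p = (n, j)" by (cases p)
    show ?thesis
    proof (cases "p = (0, 0)")
      case True
      have "norm (R p) = 4" by (simp add: True R_def)
      thus ?thesis by (simp add: True lattice_weight_def)
    next
      case False
      define P :: real where "P = (1 + \<bar>of_int n\<bar>) * (1 + \<bar>of_int j\<bar>)"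
      define x where "x = of_int n * \<tau> + of_int j"
      have "1 * 1 \<le> P" unfolding P_def by (intro mult_mono) auto
      hence P: "P \<ge> 1" by simp
      have b1: "P / K \<le> norm x ^ 2" "P / K \<le> norm (x - 1/2) ^ 2" "P / K \<le> norm (x + 1/2) ^ 2"
        using K(2)[of n j] K(3,4)[of n j] K(1) False unfolding P_def x_def p
        by (auto simp: field_simps)
      have PK: "P / K > 0" using P K by simp
      have aux: "v \<noteq> 0" if "P / K \<le> norm v ^ 2" for v :: complex using that PK by auto
      note nz = b1[THEN aux]
      have "(P / K) * (P / K) \<le> norm (x - 1/2) ^ 2 * norm (x + 1/2) ^ 2"
        using PK b1 by (intro mult_mono) auto
      hence "(P / K) ^ 2 \<le> (norm (x - 1/2) * norm (x + 1/2)) ^ 2"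
        by (simp only: power_mult_distrib power2_eq_square mult_ac)
      hence b2: "P / K \<le> norm (x - 1/2) * norm (x + 1/2)"
        by (rule power2_le_imp_le) auto
      have "(x - 1/2) * (x + 1/2) = x\<^sup>2 - 1/4"
        by (simp add: power2_eq_square algebra_simps)
      moreover have "1 / (x - 1/2) - 1 / (x + 1/2) = 1 / ((x - 1/2) * (x + 1/2))"
        by (subst diff_frac_eq[OF nz(2,3)]) simp
      moreover have "1 / x\<^sup>2 - 1 / ((x - 1/2) * (x + 1/2)) = ((x - 1/2) * (x + 1/2) - x\<^sup>2) / (x\<^sup>2 * ((x - 1/2) * (x + 1/2)))"
        using nz by (subst diff_frac_eq) auto
      \<comment> \<open>The leading terms cancel, so the remainder is of order |x|^(-4), well within
        the range of absolute convergence.\<close>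
      ultimately have "R p = (- 1/4) / (x\<^sup>2 * ((x - 1/2) * (x + 1/2)))"
        unfolding R_def p prod.case x_def [symmetric] by simp
      hence "norm (R p) = 1/4 / (norm x ^ 2 * (norm (x - 1/2) * norm (x + 1/2)))"
        by (simp only: norm_divide norm_mult norm_power) simp
      also have "\<dots> \<le> 1/4 / ((P / K) * (P / K))"
      proof -
        have le: "(P / K) * (P / K) \<le> norm x ^ 2 * (norm (x - 1/2) * norm (x + 1/2))"
          using PK by (intro mult_mono b1(1) b2) auto
        moreover have pos: "(P / K) * (P / K) > 0" using PK by (rule mult_pos_pos[OF PK])
        ultimately have "norm x ^ 2 * (norm (x - 1/2) * norm (x + 1/2)) > 0" by linarith
        from mult_pos_pos[OF this pos] show ?thesis by (intro divide_left_mono[OF le]) auto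
      qed
      also have "\<dots> = K\<^sup>2 / 4 * P powr (-2)"
        using P K by (simp add: powr_minus_divide power2_eq_square powr_numeral)
      also have "\<dots> \<le> (4 + K\<^sup>2) * P powr (-3/2)"
        using P by (intro mult_mono powr_mono) auto
      also have "P powr (-3/2) = lattice_weight n * lattice_weight j"
        unfolding P_def lattice_weight_def by (subst powr_mult) auto
      finally show ?thesis by (simp add: p)
    qed
  qed
  moreover have "(\<lambda>p. (4 + K\<^sup>2) * (case p of (n, j) \<Rightarrow> lattice_weight n * lattice_weight j)) summable_on UNIV"
    by (intro summable_on_cmult_right summable_lattice_weight_prod)
  ultimately have "(\<lambda>p. norm (R p)) summable_on UNIV"
    by (intro summable_on_comparison_test[where g = "\<lambda>p. norm (R p)"]) auto
  hence "R summable_on UNIV" by (rule abs_summable_summable)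
  thus ?thesis by (simp add: R_def)
qed

lemma has_sum_diff:
  fixes f g :: "'a \<Rightarrow> 'b :: real_normed_vector"
  assumes "(f has_sum a) A" "(g has_sum b) A"
  shows "((\<lambda>x. f x - g x) has_sum (a - b)) A"
proof -
  have "((\<lambda>x. - g x) has_sum - b) A"
    using assms(2) by (simp add: has_sum_uminus)
  from has_sum_add[OF assms(1) this] show ?thesis by simp
qed

lemma has_sum_int_telescope:
  fixes u :: "int \<Rightarrow> complex"
  assumes "((\<lambda>j. u j - u (j + 1)) has_sum S) UNIV"
    and "(\<lambda>N. u (- int N)) \<longlonglongrightarrow> a" "(\<lambda>N. u (int N + 1)) \<longlonglongrightarrow> b"
  shows "S = a - b"
proof -
  have "filterlim (\<lambda>N. {- int N..int N}) (finite_subsets_at_top UNIV) sequentially"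
    unfolding filterlim_finite_subsets_at_top
  proof (intro allI impI)
    fix X :: "int set" assume X: "finite X \<and> X \<subseteq> UNIV"
    then obtain B where B: "\<And>x. x \<in> X \<Longrightarrow> \<bar>x\<bar> \<le> B" 
      by (metis finite_imageI Max_ge imageI)
    show "eventually (\<lambda>N. finite {- int N..int N} \<and> X \<subseteq> {- int N..int N} \<and> {- int N..int N} \<subseteq> UNIV) sequentially"
      using eventually_ge_at_top[of "nat B"]
    proof eventually_elim
      case (elim N)
      thus ?case using B by (fastforce simp: abs_le_iff)
    qed
  qed
  hence "(\<lambda>N. \<Sum>j\<in>{- int N..int N}. u j - u (j + 1)) \<longlonglongrightarrow> S"
    using assms(1) unfolding has_sum_def by (rule filterlim_compose[rotated])
  moreover have "(\<Sum>j\<in>{- int N..int N}. u j - u (j + 1)) = u (- int N) - u (int N + 1)" for N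
  proof (induction N)
    case (Suc N)
    have "{- int (Suc N)..int (Suc N)} = insert (- 1 - int N) (insert (int N + 1) {- int N..int N})" by auto
    thus ?case using Suc by simp
  qed simp
  ultimately have "(\<lambda>N. u (- int N) - u (int N + 1)) \<longlonglongrightarrow> S" by simp
  thus ?thesis using tendsto_diff[OF assms(2,3)] LIMSEQ_unique by blast
qed

lemma Im_minus_inverse_pos:
  assumes "Im \<tau> > 0"
  shows "Im (- 1 / \<tau>) > 0"
proof -
  have "Im (- 1 / \<tau>) = Im \<tau> / ((Re \<tau>)\<^sup>2 + (Im \<tau>)\<^sup>2)" by (simp add: Im_divide)
  thus ?thesis using assms by (simp add: sum_power2_gt_zero_iff)
qed

text \<open>The regularised double series is absolutely convergent and may be summed in both orders.
  The correction vanishes along each row, which gives E2_sum \<tau>. Along the columns it leaves a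
  telescoping series of cotangents, whose boundary values at the two ends are -pi i/\<tau> and pi
  i/\<tau>; their difference is the anomaly.\<close>

lemma E2_sum_inversion:
  assumes "Im \<tau> > 0"
  shows "E2_sum (- 1 / \<tau>) / \<tau> ^ 2 - E2_sum \<tau> = - 2 * of_real pi * \<i> / \<tau>"
proof -
  have t0: "\<tau> \<noteq> 0" using assms by auto
  have imt: "Im (- 1 / \<tau>) > 0" by (rule Im_minus_inverse_pos) fact
  let ?x = "\<lambda>n j. of_int n * \<tau> + of_int j"
  define R where "R = (\<lambda>n j :: int. 1 / ?x n j ^ 2 - (1 / (?x n j - 1/2) - 1 / (?x n j + 1/2)))"
  have R: "(\<lambda>(n, j). R n j) summable_on UNIV \<times> UNIV"
    using eisenstein_remainder_summable[OF assms] by (simp add: R_def)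
  have Im_half: "Im (of_int n * \<tau>) \<noteq> 0 \<or> of_int n * \<tau> = 0" for n
    using assms by (cases "n = 0") auto
  have row: "((\<lambda>j. R n j) has_sum int_square_sum (of_int n * \<tau>)) UNIV" for n
  proof -
    have nI: "of_int n * \<tau> - 1/2 \<notin> \<int>" "of_int n * \<tau> + 1/2 \<notin> \<int>"
    proof -
      have "of_int n * \<tau> + of_int e / 2 \<notin> \<int>" if "odd e" for e :: int
      proof (cases "n = 0")
        case True
        have "of_int e / 2 \<notin> (\<int> :: complex set)"
        proof
          assume "of_int e / 2 \<in> (\<int> :: complex set)"
          then obtain k where "of_int e / 2 = (of_int k :: complex)" by (auto elim: Ints_cases)
          hence "of_int e = (of_int (2 * k) :: complex)" by (simp add: field_simps)
          hence "e = 2 * k" by (simp only: of_int_eq_iff)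
          thus False using that by simp
        qed
        thus ?thesis by (simp add: True)
      next
        case False
        thus ?thesis using assms by (intro not_Ints_upper) simp
      qed
      from this[of "-1"] this[of 1] show "of_int n * \<tau> - 1/2 \<notin> \<int>" "of_int n * \<tau> + 1/2 \<notin> \<int>" by simp_all
    qed
    \<comment> \<open>The two half shifts differ by 1, a period of cot(pi z), so the correction has
      sum zero along the row.\<close>
    have "cot (of_real pi * (of_int n * \<tau> + 1/2)) = cot (of_real pi * (of_int n * \<tau> - 1/2) + of_real pi)"
      by (simp add: algebra_simps)
    also have "\<dots> = cot (of_real pi * (of_int n * \<tau> - 1/2))"
      by (simp add: cot_def sin_add cos_add)
    finally have "((\<lambda>j. 1 / (of_int n * \<tau> - 1/2 + of_int j) - 1 / (of_int n * \<tau> + 1/2 + of_int j)) has_sum 0) UNIV"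
      using has_sum_cot_diff[OF nI] by simp
    hence "((\<lambda>j. 1 / (?x n j - 1/2) - 1 / (?x n j + 1/2)) has_sum 0) UNIV"
      by (simp add: algebra_simps)
    from has_sum_diff[OF has_sum_int_square_sum[OF Im_half] this]
    show ?thesis unfolding R_def by simp
  qed
  \<comment> \<open>Up to divergent parts that cancel in differences, \<open>u j\<close> is the sum
    over n of 1/(n\<tau> + j - 1/2), by the partial fractions of the cotangent.\<close>
  define u where "u = (\<lambda>j :: int. of_real pi * cot (of_real pi * ((of_int j - 1/2) / \<tau>)) / \<tau>)"
  have col: "((\<lambda>n. R n j) has_sum (int_square_sum (of_int j * (- 1 / \<tau>)) / \<tau> ^ 2 - (u j - u (j + 1)))) UNIV" for j
  proof -
    have Imne: "Im (c / \<tau>) \<noteq> 0" if "c \<noteq> 0" "c \<in> \<real>" for c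
    proof -
      from that obtain r where c: "c = of_real r" "r \<noteq> 0" by (auto elim: Reals_cases)
      have "c / \<tau> = - r *\<^sub>R (- 1 / \<tau>)" by (simp add: c scaleR_conv_of_real)
      hence "Im (c / \<tau>) = - r * Im (- 1 / \<tau>)" by (simp only: scaleR_complex.sel)
      thus ?thesis using c imt by simp
    qed
    have "Im (of_int j / \<tau>) \<noteq> 0 \<or> of_int j / \<tau> = 0"
      using Imne[of "of_int j"] by auto
    from has_sum_cmult_right[OF has_sum_int_square_sum[OF this], of "1 / \<tau> ^ 2"]
    have 1: "((\<lambda>n. 1 / ?x n j ^ 2) has_sum (int_square_sum (of_int j * (- 1 / \<tau>)) / \<tau> ^ 2)) UNIV"
    proof -
      have "1 / \<tau> ^ 2 * (1 / (of_int j / \<tau> + of_int n) ^ 2) = 1 / ?x n j ^ 2" for n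
      proof -
        have "\<tau> * (of_int j / \<tau> + of_int n) = ?x n j" using t0 by (simp add: field_simps)
        thus ?thesis by (metis power_mult_distrib times_divide_times_eq mult_1)
      qed
      moreover have "int_square_sum (of_int j * (- 1 / \<tau>)) = int_square_sum (of_int j / \<tau>)"
        using int_square_sum_minus[of "of_int j / \<tau>"] by simp
      ultimately show "((\<lambda>n. 1 / \<tau> ^ 2 * (1 / (of_int j / \<tau> + of_int n) ^ 2)) has_sum 1 / \<tau> ^ 2 * int_square_sum (of_int j / \<tau>)) UNIV \<Longrightarrow> ?thesis"
        by simp
    qed
    have half: "of_int j - 1/2 \<noteq> (0 :: complex)" "of_int j + 1/2 \<noteq> (0 :: complex)"
    proof -
      have "of_int (2 * j) \<noteq> (of_int 1 :: complex)" "of_int (2 * j) \<noteq> (of_int (-1) :: complex)"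
        unfolding of_int_eq_iff by presburger+
      thus "of_int j - 1/2 \<noteq> (0 :: complex)" "of_int j + 1/2 \<noteq> (0 :: complex)"
        by (auto simp: field_simps eq_neg_iff_add_eq_0)
    qed
    have real: "of_int j - 1/2 \<in> (\<real> :: complex set)" "of_int j + 1/2 \<in> (\<real> :: complex set)"
      by (auto intro!: Reals_diff Reals_add Reals_of_int)
    have "((\<lambda>n. 1 / ((of_int j - 1/2) / \<tau> + of_int n) - 1 / ((of_int j + 1/2) / \<tau> + of_int n)) has_sum
       (of_real pi * cot (of_real pi * ((of_int j - 1/2) / \<tau>)) - of_real pi * cot (of_real pi * ((of_int j + 1/2) / \<tau>)))) UNIV"
      by (intro has_sum_cot_diff not_Ints_upper Imne half real)
    from has_sum_cmult_right[OF this, of "1 / \<tau>"]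
    have 2: "((\<lambda>n. 1 / (?x n j - 1/2) - 1 / (?x n j + 1/2)) has_sum (u j - u (j + 1))) UNIV"
    proof -
      have aux: "1 / \<tau> * (1 / (c / \<tau> + of_int n)) = 1 / (c + of_int n * \<tau>)" for c and n :: int
      proof -
        have "\<tau> * (c / \<tau> + of_int n) = c + of_int n * \<tau>" using t0 by (simp add: field_simps)
        thus ?thesis by (metis times_divide_times_eq mult_1)
      qed
      have "1 / \<tau> * (1 / ((of_int j - 1/2) / \<tau> + of_int n) - 1 / ((of_int j + 1/2) / \<tau> + of_int n)) = 1 / (?x n j - 1/2) - 1 / (?x n j + 1/2)" for n
        unfolding right_diff_distrib aux by (simp add: algebra_simps)
      moreover have "1 / \<tau> * (of_real pi * cot (of_real pi * ((of_int j - 1/2) / \<tau>)) - of_real pi * cot (of_real pi * ((of_int j + 1/2) / \<tau>))) = u j - u (j + 1)"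
      proof -
        have "of_int (j + 1) - 1/2 = (of_int j + 1/2 :: complex)" by simp
        thus ?thesis by (simp only: u_def) (simp add: diff_divide_distrib)
      qed
      ultimately show "((\<lambda>n. 1 / \<tau> * (1 / ((of_int j - 1/2) / \<tau> + of_int n) - 1 / ((of_int j + 1/2) / \<tau> + of_int n))) has_sum
        1 / \<tau> * (of_real pi * cot (of_real pi * ((of_int j - 1/2) / \<tau>)) - of_real pi * cot (of_real pi * ((of_int j + 1/2) / \<tau>)))) UNIV \<Longrightarrow> ?thesis"
        by simp
    qed
    from has_sum_diff[OF 1 2] show ?thesis unfolding R_def .
  qed
  obtain S where S: "((\<lambda>(n, j). R n j) has_sum S) (UNIV \<times> UNIV)"
    using R by (auto simp: summable_on_def)
  have "((\<lambda>n. int_square_sum (of_int n * \<tau>)) has_sum S) UNIV"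
    by (rule has_sum_SigmaD[OF S]) (use row in simp)
  hence S1: "S = E2_sum \<tau>" unfolding E2_sum_def by (simp add: infsumI)
  have "((\<lambda>(j, n). R n j) has_sum S) (UNIV \<times> UNIV)"
    using S by (subst has_sum_swap) simp
  hence S2: "((\<lambda>j. int_square_sum (of_int j * (- 1 / \<tau>)) / \<tau> ^ 2 - (u j - u (j + 1))) has_sum S) UNIV"
    by (rule has_sum_SigmaD) (use col in simp)
  have "((\<lambda>j. int_square_sum (of_int j * (- 1 / \<tau>))) has_sum E2_sum (- 1 / \<tau>)) UNIV"
    unfolding E2_sum_def using E2_sum_expansion[OF imt] by (intro has_sum_infsum) (auto simp: summable_on_def)
  from has_sum_cmult_right[OF this, of "1 / \<tau> ^ 2"]
  have "((\<lambda>j. int_square_sum (of_int j * (- 1 / \<tau>)) / \<tau> ^ 2) has_sum E2_sum (- 1 / \<tau>) / \<tau> ^ 2) UNIV"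
    by simp
  from has_sum_diff[OF this S2] have T: "((\<lambda>j. u j - u (j + 1)) has_sum (E2_sum (- 1 / \<tau>) / \<tau> ^ 2 - S)) UNIV"
    by simp
  have u_minus: "u (- int N) = - u (int N + 1)" for N
  proof -
    have "of_real pi * ((of_int (- int N) - 1/2) / \<tau>) = - (of_real pi * ((of_int (int N + 1) - 1/2) / \<tau>))"
    proof -
      have "of_int (- int N) - 1/2 = - (of_int (int N + 1) - 1/2 :: complex)" by simp
      thus ?thesis by (simp only: minus_divide_left [symmetric] mult_minus_right)
    qed
    thus ?thesis unfolding u_def by (simp only: cot_minus) simp
  qed
  have lim: "(\<lambda>N. u (- int N)) \<longlonglongrightarrow> (of_real pi * \<i> - 2 * of_real pi * \<i> / (1 - 0)) / \<tau>"
  proof -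
    \<comment> \<open>These are the arguments of the cotangent in \<open>u (- int N)\<close>. They
      move up the ray through -1/\<tau>, so q tends to 0 and the cotangent to -i; the other end
      follows because \<open>u\<close> is odd about 1/2.\<close>
    define z where "z = (\<lambda>N. (real N + 1/2) *\<^sub>R (- 1 / \<tau>))"
    have Imz: "Im (z N) = (real N + 1/2) * Im (- 1 / \<tau>)" for N unfolding z_def by simp
    have Imz_pos: "Im (z N) > 0" for N unfolding Imz by (rule mult_pos_pos) (use imt in auto)
    have "filterlim (\<lambda>N. (real N + 1/2) * Im (- 1 / \<tau>)) at_top sequentially"
      by (rule filterlim_at_top_mult_tendsto_pos[OF tendsto_const imt]) real_asymp
    hence "filterlim (\<lambda>N. Im (z N)) at_top sequentially" unfolding Imz .
    hence "(\<lambda>N. exp (- 2 * pi * Im (z N))) \<longlonglongrightarrow> 0"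
      by (rule filterlim_compose[rotated]) real_asymp
    hence "(\<lambda>N. nome (z N)) \<longlonglongrightarrow> 0"
      by (subst tendsto_norm_zero_iff [symmetric]) (simp add: nome_norm)
    hence "(\<lambda>N. (of_real pi * \<i> - 2 * of_real pi * \<i> / (1 - nome (z N))) / \<tau>) \<longlonglongrightarrow> (of_real pi * \<i> - 2 * of_real pi * \<i> / (1 - 0)) / \<tau>"
      by (intro tendsto_intros t0) auto
    moreover have "(of_real pi * \<i> - 2 * of_real pi * \<i> / (1 - nome (z N))) / \<tau> = u (- int N)" for N
    proof -
      have "z N = (of_int (- int N) - 1/2) / \<tau>"
      proof -
        have "z N = - ((of_nat N + 1/2) / \<tau>)" by (simp add: z_def scaleR_conv_of_real)
        also have "\<dots> = - (of_nat N + 1/2) / \<tau>" by (rule minus_divide_left)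
        also have "- (of_nat N + 1/2) = (of_int (- int N) - 1/2 :: complex)" by simp
        finally show ?thesis .
      qed
      thus ?thesis using cot_nome[OF Imz_pos[of N]] by (simp add: u_def)
    qed
    ultimately show ?thesis by simp
  qed
  have "(\<lambda>N. u (int N + 1)) \<longlonglongrightarrow> - ((of_real pi * \<i> - 2 * of_real pi * \<i> / (1 - 0)) / \<tau>)"
    using tendsto_minus[OF lim] by (simp add: u_minus)
  from has_sum_int_telescope[OF T lim this]
  show ?thesis by (simp add: S1 field_simps)
qed

text \<open>The quotient F has derivative zero: the anomaly of \<open>E2_sum\<close> exactly
  compensates the derivative of the explicit factor \<tau>. The constant is read off at the fixed
  point \<i> of the inversion, where both \<eta> values coincide.\<close>

lemma dedekind_eta_inversion:
  assumes "Im \<tau> > 0"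
  shows "dedekind_eta (- 1 / \<tau>) ^ 2 = - \<i> * \<tau> * dedekind_eta \<tau> ^ 2"
proof -
  define H where "H = {z :: complex. Im z > 0}"
  define g where "g = (\<lambda>\<tau>. dedekind_eta (- 1 / \<tau>))"
  define F where "F = (\<lambda>\<tau>. g \<tau> ^ 2 / (\<tau> * dedekind_eta \<tau> ^ 2))"
  have "\<exists>c. \<forall>\<tau>\<in>H. F \<tau> = c"
  proof (rule has_field_derivative_zero_constant)
    show "convex H" unfolding H_def by (rule convex_halfspace_Im_gt)
    fix \<tau> assume "\<tau> \<in> H"
    hence t: "Im \<tau> > 0" by (simp add: H_def)
    hence t0: "\<tau> \<noteq> 0" by auto
    have imt: "Im (- 1 / \<tau>) > 0" by (rule Im_minus_inverse_pos) fact
    define a b where "a = g \<tau>" and "b = dedekind_eta \<tau>"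
    define A B where "A = E2_sum (- 1 / \<tau>)" and "B = E2_sum \<tau>"
    define c where "c = \<i> / (4 * of_real pi)"
    have b0: "b \<noteq> 0" unfolding b_def by (rule dedekind_eta_nonzero[OF t])
    have d1: "(g has_field_derivative (c * A * a * (1 / \<tau> ^ 2))) (at \<tau>)"
      unfolding c_def A_def a_def g_def
      by (rule DERIV_chain2[of dedekind_eta _ "\<lambda>\<tau>. - 1 / \<tau>", OF has_field_derivative_dedekind_eta[OF imt]])
         (use t0 in \<open>auto intro!: derivative_eq_intros simp: power2_eq_square\<close>)
    have d2: "(dedekind_eta has_field_derivative (c * B * b)) (at \<tau>)"
      unfolding c_def B_def b_def by (rule has_field_derivative_dedekind_eta[OF t])
    have "A / \<tau> ^ 2 - B = - 2 * of_real pi * \<i> / \<tau>"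
      unfolding A_def B_def by (rule E2_sum_inversion[OF t])
    hence A: "A = \<tau> ^ 2 * (B - 2 * of_real pi * \<i> / \<tau>)"
      using t0 by (simp add: field_simps)
    have cc: "c * (2 * of_real pi * \<i>) = - 1/2" by (simp add: c_def)
    have "2 * c * A = \<tau> ^ 2 * (2 * c * B) - \<tau> * (2 * (c * (2 * of_real pi * \<i>)))"
      unfolding A using t0 by (simp add: field_simps power2_eq_square)
    hence cA: "2 * c * A = \<tau> ^ 2 * (2 * c * B) + \<tau>" unfolding cc by simp
    have "(F has_field_derivative
      ((2 * a * (c * A * a * (1 / \<tau> ^ 2))) * (\<tau> * b ^ 2) - a ^ 2 * (b ^ 2 + \<tau> * (2 * b * (c * B * b)))) / ((\<tau> * b ^ 2) * (\<tau> * b ^ 2))) (at \<tau>)"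
      unfolding F_def using t0 b0
      by (auto intro!: derivative_eq_intros d1 d2 simp: a_def [symmetric] b_def [symmetric] power2_eq_square mult_ac)
    also have "(2 * a * (c * A * a * (1 / \<tau> ^ 2))) * (\<tau> * b ^ 2) - a ^ 2 * (b ^ 2 + \<tau> * (2 * b * (c * B * b)))
       = a ^ 2 * b ^ 2 * ((2 * c * A) / \<tau> - 1 - \<tau> * (2 * c * B))"
      using t0 by (simp add: field_simps power2_eq_square)
    also have "\<dots> = 0"
      unfolding cA using t0 by (simp add: field_simps power2_eq_square)
    finally show "(F has_field_derivative 0) (at \<tau> within H)"
      by (simp add: has_field_derivative_at_within)
  qed
  then obtain c where c: "\<And>\<tau>. \<tau> \<in> H \<Longrightarrow> F \<tau> = c" by blast
  have "c = F \<i>" by (rule c [symmetric]) (simp add: H_def)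
  also have "F \<i> = - \<i>"
    using dedekind_eta_nonzero[of \<i>] by (simp add: F_def g_def divide_simps)
  finally have "F \<tau> = - \<i>" using c[of \<tau>] assms by (simp add: H_def)
  moreover have "\<tau> \<noteq> 0" using assms by auto
  ultimately show ?thesis
    using dedekind_eta_nonzero[OF assms] by (simp add: F_def g_def field_simps)
qed

section \<open>The weight one eta quotient\<close>

text \<open>In theta notation this is \<theta>_2(2\<tau>)^2/4. It starts with q^(1/2), which
  accounts for its sign under \<tau> -> \<tau> + 1.\<close>

definition eta_g :: "complex \<Rightarrow> complex" where
  "eta_g \<tau> = dedekind_eta (4 * \<tau>) ^ 4 / dedekind_eta (2 * \<tau>) ^ 2"

text \<open>The theta square \<theta>_4(2\<tau>)^2, into which \<open>eta_g\<close> passes under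
  \<tau> -> -1/(4\<tau>). It has period 1 and constant term 1, so every cusp value of f_k reduces to
  it.\<close>

definition eta_h :: "complex \<Rightarrow> complex" where
  "eta_h \<tau> = dedekind_eta \<tau> ^ 4 / dedekind_eta (2 * \<tau>) ^ 2"

lemma f_eta_eq_eta_g:
  assumes "Im \<tau> > 0" "k \<ge> 1"
  shows "f_eta k \<tau> = eta_g \<tau> ^ (2 * k) * eta_g (2 * \<tau>)"
proof -
  define x y z where "x = dedekind_eta (4 * \<tau>)" and "y = dedekind_eta (2 * \<tau>)" and "z = dedekind_eta (8 * \<tau>)"
  have nz: "x \<noteq> 0" "y \<noteq> 0" unfolding x_def y_def
    using assms by (auto intro!: dedekind_eta_nonzero)
  have "8 * k = (8 * k - 2) + 2" using assms by simp
  hence x8: "x ^ (8 * k) = x ^ (8 * k - 2) * x ^ 2" by (metis power_add)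
  have "f_eta k \<tau> = x ^ (8 * k - 2) * z ^ 4 / y ^ (4 * k)"
    by (simp only: f_eta_def x_def y_def z_def)
  also have "\<dots> = x ^ (8 * k) / y ^ (4 * k) * (z ^ 4 / x ^ 2)"
    using nz by (simp add: x8)
  also have "x ^ (8 * k) / y ^ (4 * k) = (x ^ 4 / y ^ 2) ^ (2 * k)"
    by (simp add: power_divide flip: power_mult)
  also have "x ^ 4 / y ^ 2 = eta_g \<tau>" by (simp only: eta_g_def x_def y_def)
  also have "z ^ 4 / x ^ 2 = eta_g (2 * \<tau>)" by (simp add: eta_g_def x_def z_def)
  finally show ?thesis .
qed

lemma nome_plus_1: "nome (\<tau> + 1) = nome \<tau>"
  by (simp add: nome_def distrib_left exp_add)

lemma dedekind_eta_plus_1: "dedekind_eta (\<tau> + 1) = exp (2 * of_real pi * \<i> / 24) * dedekind_eta \<tau>"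
  by (simp add: dedekind_eta_euler_prod nome_plus_1 distrib_left add_divide_distrib exp_add)

lemma exp_24th_root_power6: "exp (2 * of_real pi * \<i> / 24) ^ 6 = \<i>"
proof -
  have "exp (2 * of_real pi * \<i> / 24) ^ 6 = exp (of_nat 6 * (2 * of_real pi * \<i> / 24))"
    by (rule exp_of_nat_mult [symmetric])
  also have "of_nat 6 * (2 * of_real pi * \<i> / 24) = \<i> * of_real (pi / 2)" by simp
  also have "exp \<dots> = cis (pi / 2)" by (simp only: cis_conv_exp)
  finally show ?thesis by simp
qed

lemma eta_g_plus_half: "eta_g (\<tau> + 1/2) = \<i> * eta_g \<tau>"
proof -
  define e where "e = exp (2 * of_real pi * \<i> / 24 :: complex)"
  have e0: "e \<noteq> 0" by (simp add: e_def)
  have "4 * (\<tau> + 1/2) = 4 * \<tau> + 1 + 1" "2 * (\<tau> + 1/2) = 2 * \<tau> + 1" by simp_all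
  hence "eta_g (\<tau> + 1/2) = (e * (e * dedekind_eta (4 * \<tau>))) ^ 4 / (e * dedekind_eta (2 * \<tau>)) ^ 2"
    by (simp only: eta_g_def dedekind_eta_plus_1 e_def)
  also have "\<dots> = (e ^ 4 * e ^ 4 / e ^ 2) * eta_g \<tau>" by (simp add: eta_g_def power_mult_distrib)
  also have "e ^ 4 * e ^ 4 / e ^ 2 = e ^ 6" using e0 by (simp add: field_simps flip: power_add)
  finally show ?thesis by (simp only: e_def exp_24th_root_power6)
qed

lemma eta_g_plus_1: "eta_g (\<tau> + 1) = - eta_g \<tau>"
  using eta_g_plus_half[of "\<tau> + 1/2"] eta_g_plus_half[of \<tau>] by (simp add: add.assoc)

definition parity_sign :: "int \<Rightarrow> complex" where
  "parity_sign n = (if even n then 1 else -1)"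

lemma eta_g_plus_int: "eta_g (\<tau> + of_int n) = parity_sign n * eta_g \<tau>"
proof (induction n rule: int_induct[where k = 0])
  case (step1 n)
  have "eta_g (\<tau> + of_int (n + 1)) = - eta_g (\<tau> + of_int n)"
    using eta_g_plus_1[of "\<tau> + of_int n"] by (simp add: add_ac)
  thus ?case using step1 by (simp add: parity_sign_def)
next
  case (step2 n)
  have "eta_g (\<tau> + of_int n) = - eta_g (\<tau> + of_int (n - 1))"
    using eta_g_plus_1[of "\<tau> + of_int (n - 1)"] by (simp add: add_ac)
  thus ?case using step2 by (simp add: parity_sign_def split: if_splits)
qed (simp add: parity_sign_def)

lemma eta_h_plus_1: "eta_h (\<tau> + 1) = eta_h \<tau>"
proof -
  define e where "e = exp (2 * of_real pi * \<i> / 24 :: complex)"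
  have e0: "e \<noteq> 0" by (simp add: e_def)
  have "2 * (\<tau> + 1) = 2 * \<tau> + 1 + 1" by simp
  hence "eta_h (\<tau> + 1) = (e * dedekind_eta \<tau>) ^ 4 / (e * (e * dedekind_eta (2 * \<tau>))) ^ 2"
    by (simp only: eta_h_def dedekind_eta_plus_1 e_def)
  also have "\<dots> = (e ^ 4 / (e ^ 2 * e ^ 2)) * eta_h \<tau>" by (simp add: eta_h_def power_mult_distrib)
  also have "e ^ 4 / (e ^ 2 * e ^ 2) = 1" using e0 by (simp flip: power_add)
  finally show ?thesis by simp
qed

lemma eta_h_plus_int: "eta_h (\<tau> + of_int n) = eta_h \<tau>"
proof (induction n rule: int_induct[where k = 0])
  case (step1 n)
  thus ?case using eta_h_plus_1[of "\<tau> + of_int n"] by (simp add: add_ac)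
next
  case (step2 n)
  thus ?case using eta_h_plus_1[of "\<tau> + of_int (n - 1)"] by (simp add: add_ac)
qed simp

lemma eta_g_inversion:
  assumes "Im \<tau> > 0"
  shows "eta_g (- 1 / (4 * \<tau>)) = - \<i> * \<tau> / 2 * eta_h \<tau>"
proof -
  have t0: "\<tau> \<noteq> 0" using assms by auto
  have args: "4 * (- 1 / (4 * \<tau>)) = - 1 / \<tau>" "2 * (- 1 / (4 * \<tau>)) = - 1 / (2 * \<tau>)"
    using t0 by (simp_all add: field_simps)
  have 1: "dedekind_eta (- 1 / \<tau>) ^ 4 = (- \<i> * \<tau> * dedekind_eta \<tau> ^ 2) ^ 2"
    using dedekind_eta_inversion[OF assms] by (metis power_mult numeral_times_numeral semiring_norm(13) mult_2 numeral_Bit0)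
  have 2: "dedekind_eta (- 1 / (2 * \<tau>)) ^ 2 = - \<i> * (2 * \<tau>) * dedekind_eta (2 * \<tau>) ^ 2"
    using assms by (intro dedekind_eta_inversion) simp
  have "dedekind_eta (2 * \<tau>) \<noteq> 0" using assms by (intro dedekind_eta_nonzero) simp
  moreover have "(dedekind_eta \<tau> ^ 2) ^ 2 = dedekind_eta \<tau> ^ 4" by (simp flip: power_mult)
  ultimately show ?thesis using t0
    unfolding eta_g_def eta_h_def args 1 2 by (simp add: power_mult_distrib field_simps power2_eq_square)
qed

text \<open>The map \<tau> -> \<tau>/(4n\<tau> + 1) is the translation by -n conjugated by \<tau> ->
  -1/(4\<tau>). Conjugation turns \<open>eta_g\<close> into \<open>eta_h\<close>, which is invariant
  under translations; the automorphy factor is the quotient of the two linear factors.\<close>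

lemma eta_g_unipotent:
  assumes "Im \<tau> > 0"
  shows "eta_g (\<tau> / (4 * of_int n * \<tau> + 1)) = (4 * of_int n * \<tau> + 1) * eta_g \<tau>"
proof -
  have t0: "\<tau> \<noteq> 0" using assms by auto
  define u where "u = - 1 / (4 * \<tau>)"
  define w where "w = u + of_int (- n)"
  have u: "Im u > 0" unfolding u_def by (rule Im_minus_inverse_pos) (use assms in simp)
  hence w: "Im w > 0" by (simp add: w_def)
  have u0: "u \<noteq> 0" "w \<noteq> 0" using u w by auto
  have 4: "- 4 * w * \<tau> = 4 * of_int n * \<tau> + 1" using t0 by (simp add: w_def u_def field_simps)
  have "- 1 / (4 * w) = \<tau> / (4 * of_int n * \<tau> + 1)"
    unfolding 4 [symmetric] using u0 t0 by (simp add: field_simps)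
  hence "eta_g (\<tau> / (4 * of_int n * \<tau> + 1)) = - \<i> * w / 2 * eta_h w"
    using eta_g_inversion[OF w] by simp
  also have "eta_h w = eta_h u" unfolding w_def by (rule eta_h_plus_int)
  also have "- \<i> * w / 2 * eta_h u = (w / u) * (- \<i> * u / 2 * eta_h u)" using u0 by simp
  also have "- \<i> * u / 2 * eta_h u = eta_g (- 1 / (4 * u))" by (rule eta_g_inversion [OF u, symmetric])
  also have "- 1 / (4 * u) = \<tau>" using t0 by (simp add: u_def)
  also have "w / u = - 4 * w * \<tau>" using t0 by (simp add: u_def)
  finally show ?thesis unfolding 4 .
qed

lemma odd_of_det:
  fixes a b c d :: int
  assumes "a * d - b * c = 1" "even c"
  shows "odd a" "odd d"
proof -
  have "even d \<or> even a \<Longrightarrow> even (a * d - b * c)" using assms(2) by auto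
  thus "odd a" "odd d" using assms(1) by auto
qed

lemma int_nearest_multiple:
  fixes c d :: int
  assumes "c \<noteq> 0"
  shows "\<exists>j. 2 * \<bar>d + j * c\<bar> \<le> \<bar>c\<bar>"
proof -
  define r where "r = d mod \<bar>c\<bar>"
  have r: "0 \<le> r" "r < \<bar>c\<bar>" using assms by (auto simp: r_def)
  have d: "d = (d div \<bar>c\<bar>) * \<bar>c\<bar> + r" by (simp add: r_def)
  have "\<exists>j. 2 * \<bar>d + j * \<bar>c\<bar>\<bar> \<le> \<bar>c\<bar>"
  proof (cases "2 * r \<le> \<bar>c\<bar>")
    case True
    have "d + (- (d div \<bar>c\<bar>)) * \<bar>c\<bar> = r" using d by (simp add: algebra_simps)
    thus ?thesis using True r by (intro exI[of _ "- (d div \<bar>c\<bar>)"]) simp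
  next
    case False
    have "d + (- (d div \<bar>c\<bar>) - 1) * \<bar>c\<bar> = r - \<bar>c\<bar>" using d by (simp add: algebra_simps)
    thus ?thesis using False r by (intro exI[of _ "- (d div \<bar>c\<bar>) - 1"]) simp
  qed
  then obtain j where j: "2 * \<bar>d + j * \<bar>c\<bar>\<bar> \<le> \<bar>c\<bar>" by blast
  show ?thesis
  proof (cases "c \<ge> 0")
    case True thus ?thesis using j by auto
  next
    case False
    thus ?thesis using j by (intro exI[of _ "- j"]) simp
  qed
qed

lemma Im_moebius_pos:
  fixes a b c d :: int
  assumes "Im \<tau> > 0" "a * d - b * c = 1"
  shows "Im ((of_int a * \<tau> + of_int b) / (of_int c * \<tau> + of_int d)) > 0"
proof -
  define j where "j = of_int c * \<tau> + of_int d"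
  have j: "j \<noteq> 0" unfolding j_def by (rule moebius_denom_nonzero[OF assms])
  have det: "of_int a * of_int d - of_int b * of_int c = (1 :: real)"
    using assms(2) by (simp flip: of_int_mult of_int_diff)
  have "Im ((of_int a * \<tau> + of_int b) / j) = Im ((of_int a * \<tau> + of_int b) * cnj j) / (norm j)\<^sup>2"
    by (subst complex_div_cnj) (simp flip: of_real_power)
  also have "Im ((of_int a * \<tau> + of_int b) * cnj j) = (of_int a * of_int d - of_int b * of_int c) * Im \<tau>"
    by (simp add: j_def algebra_simps)
  finally show ?thesis unfolding j_def [symmetric] using assms(1) j det by simp
qed

text \<open>Euclid's algorithm on the lower row: right multiplication by powers of
  \<open>(1, 1; 0, 1)\<close> and \<open>(1, 0; 4, 1)\<close> makes \<open>\<bar>c\<bar>\<close> strictly smaller.\<close>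

lemma eta_g_modular:
  assumes "a * d - b * c = 1" "4 dvd c" "Im \<tau> > 0"
  shows "eta_g ((of_int a * \<tau> + of_int b) / (of_int c * \<tau> + of_int d)) =
     chi_m4 d * parity_sign b * (of_int c * \<tau> + of_int d) * eta_g \<tau>"
  using assms
proof (induction "nat \<bar>c\<bar>" arbitrary: a b c d \<tau> rule: less_induct)
  case less
  note det = less.prems(1) and c4 = less.prems(2) and t = less.prems(3)
  show ?case
  proof (cases "c = 0")
    case True
    hence "a * d = 1" using det by simp
    hence "a = 1 \<and> d = 1 \<or> a = -1 \<and> d = -1" by (auto simp: zmult_eq_1_iff)
    thus ?thesis
    proof
      assume "a = 1 \<and> d = 1"
      thus ?thesis using True by (simp add: eta_g_plus_int chi_m4_def)
    next
      assume ad: "a = -1 \<and> d = -1"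
      have "(- \<tau> + of_int b) / (- 1) = \<tau> + of_int (- b)" by simp
      thus ?thesis using True ad eta_g_plus_int[of \<tau> "- b"] by (simp add: chi_m4_def parity_sign_def)
    qed
  next
    case False
    have "even c" using c4 by presburger
    note odd = odd_of_det[OF det this]
    obtain j where j: "2 * \<bar>d + j * c\<bar> \<le> \<bar>c\<bar>" using int_nearest_multiple[OF False] by blast
    define d' where "d' = d + j * c"
    have d'_odd: "odd d'" using odd c4 by (auto simp: d'_def)
    \<comment> \<open>Parity makes the inequality strict: c is divisible by 4 and d' is odd. Without
      strictness the descent could stall.\<close>
    have "2 * \<bar>d'\<bar> \<noteq> \<bar>c\<bar>"
    proof
      assume "2 * \<bar>d'\<bar> = \<bar>c\<bar>"
      hence "4 dvd 2 * \<bar>d'\<bar>" using c4 by simp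
      hence "2 dvd \<bar>d'\<bar>" by presburger
      thus False using d'_odd by simp
    qed
    hence dc: "2 * \<bar>d'\<bar> < \<bar>c\<bar>" using j by (simp add: d'_def)
    have "4 * d' \<noteq> 0" using d'_odd by auto
    \<comment> \<open>The lower unipotent generator changes c by multiples of 4d', so the new entry
      satisfies |c''| \<le> 2|d'| < |c|.\<close>
    then obtain i where i: "2 * \<bar>c + i * (4 * d')\<bar> \<le> \<bar>4 * d'\<bar>" using int_nearest_multiple by blast
    define c'' where "c'' = c + 4 * i * d'"
    define b' where "b' = b + j * a"
    define a'' where "a'' = a + 4 * i * b'"
    have "c'' = c + i * (4 * d')" by (simp add: c''_def)
    hence "\<bar>c''\<bar> < \<bar>c\<bar>" using i dc abs_mult[of 4 d'] by simp
    hence small: "nat \<bar>c''\<bar> < nat \<bar>c\<bar>" by simp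
    have det': "a * d' - b' * c = 1" using det by (simp add: d'_def b'_def algebra_simps)
    hence det'': "a'' * d' - b' * c'' = 1" by (simp add: a''_def c''_def algebra_simps)
    have c4'': "4 dvd c''" using c4 by (simp add: c''_def)
    define \<tau>1 where "\<tau>1 = \<tau> + of_int (- j)"
    define n where "n = 4 * of_int (- i) * \<tau>1 + 1"
    define \<sigma> where "\<sigma> = \<tau>1 / n"
    have t1: "Im \<tau>1 > 0" using t by (simp add: \<tau>1_def)
    have n0: "n \<noteq> 0" using moebius_denom_nonzero[OF t1, of 1 1 0 "- 4 * i"] by (simp add: n_def)
    have s: "Im \<sigma> > 0"
      using Im_moebius_pos[OF t1, of 1 1 0 "- 4 * i"] by (simp add: \<sigma>_def n_def)
    have den: "(of_int c'' * \<sigma> + of_int d') * n = of_int c * \<tau> + of_int d"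
    proof -
      have "(of_int c'' * \<sigma> + of_int d') * n = of_int c'' * \<tau>1 + of_int d' * n"
        using n0 by (simp add: \<sigma>_def distrib_right)
      also have "\<dots> = of_int c * \<tau> + of_int d"
        by (simp add: n_def c''_def d'_def \<tau>1_def algebra_simps)
      finally show ?thesis .
    qed
    have num: "(of_int a'' * \<sigma> + of_int b') * n = of_int a * \<tau> + of_int b"
    proof -
      have "(of_int a'' * \<sigma> + of_int b') * n = of_int a'' * \<tau>1 + of_int b' * n"
        using n0 by (simp add: \<sigma>_def distrib_right)
      also have "\<dots> = of_int a * \<tau> + of_int b"
        by (simp add: n_def a''_def b'_def \<tau>1_def algebra_simps)
      finally show ?thesis .
    qed
    have "(of_int a * \<tau> + of_int b) / (of_int c * \<tau> + of_int d) = (of_int a'' * \<sigma> + of_int b') / (of_int c'' * \<sigma> + of_int d')"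
      unfolding den [symmetric] num [symmetric] using n0 by simp
    also have "eta_g \<dots> = chi_m4 d' * parity_sign b' * (of_int c'' * \<sigma> + of_int d') * eta_g \<sigma>"
      by (rule less.hyps[OF small det'' c4'' s])
    also have "eta_g \<sigma> = n * eta_g \<tau>1"
      unfolding \<sigma>_def n_def by (rule eta_g_unipotent[OF t1])
    also have "eta_g \<tau>1 = parity_sign (- j) * eta_g \<tau>"
      unfolding \<tau>1_def by (rule eta_g_plus_int)
    also have "chi_m4 d' * parity_sign b' * (of_int c'' * \<sigma> + of_int d') * (n * (parity_sign (- j) * eta_g \<tau>))
      = chi_m4 d' * (parity_sign b' * parity_sign (- j)) * ((of_int c'' * \<sigma> + of_int d') * n) * eta_g \<tau>"
      by (simp add: mult_ac)
    \<comment> \<open>Here b' = b + ja with a odd, so the translation by -j changes the parity of b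
      exactly when j is odd.\<close>
    also have "parity_sign b' * parity_sign (- j) = parity_sign b"
      using odd by (simp add: parity_sign_def b'_def)
    also have "chi_m4 d' = chi_m4 d"
    proof -
      obtain q where "c = 4 * q" using c4 by (rule dvdE)
      hence "d' = d + (j * q) * 4" by (simp add: d'_def)
      hence "d' mod 4 = d mod 4" by simp
      thus ?thesis by (simp add: chi_m4_def)
    qed
    finally show ?thesis unfolding den .
  qed
qed

lemma chi_m4_odd_square: "odd d \<Longrightarrow> chi_m4 d * chi_m4 d = 1"
  unfolding chi_m4_def by (auto, presburger)

text \<open>The even power 2k removes both character and sign from the first factor. Doubling \<tau>
  replaces the entries b and c by 2b and c/2: the new matrix lies in \<Gamma>_0(4) because 8 divides
  c, and its sign is trivial because 2b is even. The second factor thus supplies the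
  character.\<close>

lemma f_eta_modular:
  assumes "a * d - b * c = 1" "8 dvd c" "Im \<tau> > 0" "k \<ge> 1"
  shows "weight_slash (2 * k + 1) a b c d (f_eta k) \<tau> = chi_m4 d * f_eta k \<tau>"
proof -
  define j where "j = of_int c * \<tau> + of_int d"
  have j0: "j \<noteq> 0" unfolding j_def by (rule moebius_denom_nonzero[OF assms(3,1)])
  define \<sigma> where "\<sigma> = (of_int a * \<tau> + of_int b) / j"
  have s: "Im \<sigma> > 0" unfolding \<sigma>_def j_def by (rule Im_moebius_pos[OF assms(3,1)])
  obtain c' where c: "c = 8 * c'" using assms(2) by (auto elim: dvdE)
  have odd: "odd d" using odd_of_det[OF assms(1)] c by simp
  have g1: "eta_g \<sigma> = chi_m4 d * parity_sign b * j * eta_g \<tau>"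
    unfolding \<sigma>_def j_def using assms c by (intro eta_g_modular) auto
  have g1': "eta_g \<sigma> ^ (2 * k) = j ^ (2 * k) * eta_g \<tau> ^ (2 * k)"
  proof -
    have "(chi_m4 d * parity_sign b) ^ 2 = 1"
      using chi_m4_odd_square[OF odd] by (simp add: power2_eq_square parity_sign_def)
    hence "(chi_m4 d * parity_sign b) ^ (2 * k) = 1" by (simp add: power_mult)
    thus ?thesis unfolding g1 by (simp only: power_mult_distrib mult_1_left)
  qed
  have "2 * \<sigma> = (of_int a * (2 * \<tau>) + of_int (2 * b)) / (of_int (4 * c') * (2 * \<tau>) + of_int d)"
    by (simp add: \<sigma>_def j_def c algebra_simps)
  also have "eta_g \<dots> = chi_m4 d * parity_sign (2 * b) * (of_int (4 * c') * (2 * \<tau>) + of_int d) * eta_g (2 * \<tau>)"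
    using assms c by (intro eta_g_modular) (auto simp: algebra_simps)
  also have "\<dots> = chi_m4 d * j * eta_g (2 * \<tau>)"
    by (simp add: j_def c parity_sign_def algebra_simps)
  finally have g2: "eta_g (2 * \<sigma>) = chi_m4 d * j * eta_g (2 * \<tau>)" .
  have "f_eta k \<sigma> = j ^ (2 * k + 1) * (chi_m4 d * f_eta k \<tau>)"
    using s assms by (simp add: f_eta_eq_eta_g g1' g2)
  thus ?thesis using j0 by (simp add: weight_slash_def \<sigma>_def j_def)
qed

section \<open>Behaviour of f_k at the four cusps\<close>

abbreviation at_i_inf :: "complex filter" where
  "at_i_inf \<equiv> filtercomap Im at_top"

lemma tendsto_nome: "(nome \<longlongrightarrow> 0) at_i_inf"
proof -
  have "((\<lambda>y. exp (- 2 * pi * y)) \<longlongrightarrow> 0) at_top" by real_asymp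
  hence "((\<lambda>\<tau>. exp (- 2 * pi * Im \<tau>)) \<longlongrightarrow> 0) at_i_inf"
    by (rule filterlim_compose) (rule filterlim_filtercomap)
  thus ?thesis by (subst tendsto_norm_zero_iff [symmetric]) (simp add: nome_norm)
qed

lemma filterlim_affine_at_i_infinity:
  assumes "r > 0"
  shows "filterlim (\<lambda>\<tau>. of_real r * \<tau> + z) at_i_inf at_i_inf"
  unfolding filterlim_filtercomap_iff o_def
proof -
  have "filterlim (\<lambda>y. r * y + Im z) at_top at_top" using assms by real_asymp
  hence "filterlim (\<lambda>\<tau>. r * Im \<tau> + Im z) at_top at_i_inf"
    by (rule filterlim_compose) (rule filterlim_filtercomap)
  thus "filterlim (\<lambda>\<tau>. Im (of_real r * \<tau> + z)) at_top at_i_inf" by simp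
qed

lemma eventually_Im_pos: "eventually (\<lambda>\<tau>. Im \<tau> > 0) at_i_inf"
  using eventually_gt_at_top[of 0] by (rule eventually_filtercomapI)

lemma euler_prod_cusp: "((\<lambda>\<tau>. euler_prod (nome \<tau>)) \<longlongrightarrow> 1) at_i_inf"
proof -
  have "isCont euler_prod 0"
    by (rule field_differentiable_imp_continuous_at, rule euler_prod_log_deriv) simp
  from isCont_tendsto_compose[OF this tendsto_nome] show ?thesis by (simp add: euler_prod_at_0)
qed

lemma euler_prod_cusp_mult:
  assumes "r > 0"
  shows "((\<lambda>\<tau>. euler_prod (nome (of_real r * \<tau>))) \<longlongrightarrow> 1) at_i_inf"
  using filterlim_compose[OF euler_prod_cusp filterlim_affine_at_i_infinity[OF assms, of 0]] by simp

lemma eta_h_cusp: "(eta_h \<longlongrightarrow> 1) at_i_inf"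
proof -
  have "eta_h = (\<lambda>\<tau>. euler_prod (nome \<tau>) ^ 4 / euler_prod (nome (of_real 2 * \<tau>)) ^ 2)"
  proof
    fix \<tau>
    have "exp (2 * of_real pi * \<i> * \<tau> / 24) ^ 4 = exp (2 * of_real pi * \<i> * (2 * \<tau>) / 24) ^ 2"
      by (simp only: exp_of_nat_mult [symmetric]) simp
    thus "eta_h \<tau> = euler_prod (nome \<tau>) ^ 4 / euler_prod (nome (of_real 2 * \<tau>)) ^ 2"
      by (simp add: eta_h_def dedekind_eta_euler_prod power_mult_distrib)
  qed
  moreover have "((\<lambda>\<tau>. euler_prod (nome \<tau>) ^ 4 / euler_prod (nome (of_real 2 * \<tau>)) ^ 2) \<longlongrightarrow> 1 ^ 4 / 1 ^ 2) at_i_inf"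
    by (intro tendsto_intros euler_prod_cusp euler_prod_cusp_mult) auto
  ultimately show ?thesis by simp
qed

lemma eta_h_cusp_affine:
  assumes "r > 0"
  shows "((\<lambda>\<tau>. eta_h (of_real r * \<tau> + z)) \<longlongrightarrow> 1) at_i_inf"
  by (rule filterlim_compose[OF eta_h_cusp filterlim_affine_at_i_infinity[OF assms]])

text \<open>The q-exponents of the eta factors add up to 16/24 - 4/24 = 1/2, leaving the decaying
  factor exp(pi i \<tau>) in front of a quotient that tends to 1.\<close>

lemma eta_g_cusp: "(eta_g \<longlongrightarrow> 0) at_i_inf"
proof -
  have "eta_g = (\<lambda>\<tau>. exp (of_real pi * \<i> * \<tau>) * (euler_prod (nome (of_real 4 * \<tau>)) ^ 4 / euler_prod (nome (of_real 2 * \<tau>)) ^ 2))"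
  proof
    fix \<tau>
    have "exp (2 * of_real pi * \<i> * (4 * \<tau>) / 24) ^ 4 = exp (of_real pi * \<i> * \<tau>) * exp (2 * of_real pi * \<i> * (2 * \<tau>) / 24) ^ 2"
      by (simp only: exp_of_nat_mult [symmetric] exp_add [symmetric]) (simp add: field_simps)
    thus "eta_g \<tau> = exp (of_real pi * \<i> * \<tau>) * (euler_prod (nome (of_real 4 * \<tau>)) ^ 4 / euler_prod (nome (of_real 2 * \<tau>)) ^ 2)"
      by (simp add: eta_g_def dedekind_eta_euler_prod power_mult_distrib)
  qed
  moreover have "((\<lambda>\<tau>. exp (of_real pi * \<i> * \<tau>)) \<longlongrightarrow> 0) at_i_inf"
  proof -
    have "((\<lambda>y. exp (- pi * y)) \<longlongrightarrow> 0) at_top" by real_asymp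
    hence "((\<lambda>\<tau>. exp (- pi * Im \<tau>)) \<longlongrightarrow> 0) at_i_inf"
      by (rule filterlim_compose) (rule filterlim_filtercomap)
    thus ?thesis by (subst tendsto_norm_zero_iff [symmetric]) (simp add: norm_exp_eq_Re)
  qed
  hence "((\<lambda>\<tau>. exp (of_real pi * \<i> * \<tau>) * (euler_prod (nome (of_real 4 * \<tau>)) ^ 4 / euler_prod (nome (of_real 2 * \<tau>)) ^ 2)) \<longlongrightarrow> 0 * (1 ^ 4 / 1 ^ 2)) at_i_inf"
    by (intro tendsto_intros euler_prod_cusp_mult) auto
  ultimately show ?thesis by simp
qed

text \<open>With w = \<tau> + 1/2 the argument is -1/(4w) + 1/2. The half translation contributes i
  and the inversion -i, so the two cancel.\<close>

lemma eta_g_cusp_half: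
  assumes "Im \<tau> > 0"
  shows "eta_g (\<tau> / (2 * \<tau> + 1)) = (2 * \<tau> + 1) / 4 * eta_h (\<tau> + 1/2)"
proof -
  define w where "w = \<tau> + 1/2"
  have w: "Im w > 0" using assms by (simp add: w_def)
  hence w0: "w \<noteq> 0" by auto
  have e: "2 * \<tau> + 1 = 2 * w" by (simp add: w_def)
  have "- 1 / (4 * w) + 1/2 = (2 * w - 1) / (4 * w)" using w0 by (simp add: field_simps)
  also have "2 * w - 1 = 2 * \<tau>" by (simp add: w_def)
  finally have "\<tau> / (2 * w) = - 1 / (4 * w) + 1/2" by simp
  hence "eta_g (\<tau> / (2 * w)) = \<i> * (- \<i> * w / 2 * eta_h w)"
    using eta_g_plus_half[of "- 1 / (4 * w)"] eta_g_inversion[OF w] by simp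
  also have "\<dots> = - (\<i> * \<i>) * (w / 2 * eta_h w)" by (simp only: mult_ac mult_minus_left mult_minus_right times_divide_eq_left times_divide_eq_right minus_divide_left)
  finally show ?thesis unfolding e w_def [symmetric] by simp
qed

lemma f_eta_cusp_infinity:
  assumes "k \<ge> 1"
  shows "(f_eta k \<longlongrightarrow> 0) at_i_inf"
proof -
  have "((\<lambda>\<tau>. eta_g \<tau> ^ (2 * k) * eta_g (of_real 2 * \<tau> + 0)) \<longlongrightarrow> 0 ^ (2 * k) * 0) at_i_inf"
    by (intro tendsto_intros eta_g_cusp filterlim_compose[OF eta_g_cusp] filterlim_affine_at_i_infinity) simp
  moreover have "eventually (\<lambda>\<tau>. f_eta k \<tau> = eta_g \<tau> ^ (2 * k) * eta_g (of_real 2 * \<tau> + 0)) at_i_inf"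
    using eventually_Im_pos by eventually_elim (use assms in \<open>simp add: f_eta_eq_eta_g\<close>)
  ultimately show ?thesis by (simp add: tendsto_cong)
qed

text \<open>Write -1/\<tau> as -1/(4(\<tau>/4)) and -2/\<tau> as -1/(4(\<tau>/8)). Inversion then
  produces the constants -i/8 and -i/16, and \<open>eta_h\<close> tends to 1.\<close>

lemma f_eta_cusp_0:
  assumes "k \<ge> 1"
  shows "(weight_slash (2 * k + 1) 0 (-1) 1 0 (f_eta k) \<longlongrightarrow> (- \<i> / 8) ^ (2 * k) * (- \<i> / 16)) at_i_inf"
proof -
  have "((\<lambda>\<tau>. ((- \<i> / 8) * eta_h (of_real (1/4) * \<tau> + 0)) ^ (2 * k) * ((- \<i> / 16) * eta_h (of_real (1/8) * \<tau> + 0))) \<longlongrightarrow>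
     ((- \<i> / 8) * 1) ^ (2 * k) * ((- \<i> / 16) * 1)) at_i_inf"
    by (intro tendsto_intros eta_h_cusp_affine) auto
  moreover have "eventually (\<lambda>\<tau>. weight_slash (2 * k + 1) 0 (-1) 1 0 (f_eta k) \<tau> =
     ((- \<i> / 8) * eta_h (of_real (1/4) * \<tau> + 0)) ^ (2 * k) * ((- \<i> / 16) * eta_h (of_real (1/8) * \<tau> + 0))) at_i_inf"
    using eventually_Im_pos
  proof eventually_elim
    case (elim \<tau>)
    hence t0: "\<tau> \<noteq> 0" by auto
    have "eta_g (- 1 / (4 * (\<tau> / 4))) = - \<i> * (\<tau> / 4) / 2 * eta_h (\<tau> / 4)"
      by (rule eta_g_inversion) (use elim in simp)
    hence 1: "eta_g (- 1 / \<tau>) = \<tau> * ((- \<i> / 8) * eta_h (\<tau> / 4))" by simp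
    have "eta_g (- 1 / (4 * (\<tau> / 8))) = - \<i> * (\<tau> / 8) / 2 * eta_h (\<tau> / 8)"
      by (rule eta_g_inversion) (use elim in simp)
    hence 2: "eta_g (2 * (- 1 / \<tau>)) = \<tau> * ((- \<i> / 16) * eta_h (\<tau> / 8))" by simp
    have "f_eta k (- 1 / \<tau>) = \<tau> ^ (2 * k + 1) * (((- \<i> / 8) * eta_h (\<tau> / 4)) ^ (2 * k) * ((- \<i> / 16) * eta_h (\<tau> / 8)))"
      unfolding f_eta_eq_eta_g[OF Im_minus_inverse_pos[OF elim] assms] 1 2
      by (simp only: power_mult_distrib power_add power_one_right mult_ac)
    thus ?case using t0 by (simp add: weight_slash_def)
  qed
  ultimately show ?thesis by (simp add: tendsto_cong)
qed

text \<open>With j = 2\<tau> + 1, the doubled argument is -1/(4(j/4)) + 1. The translation by 1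
  changes the sign of the inversion constant -i/8; the first factor is covered by
  \<open>eta_g_cusp_half\<close>.\<close>

lemma f_eta_cusp_half:
  assumes "k \<ge> 1"
  shows "(weight_slash (2 * k + 1) 1 0 2 1 (f_eta k) \<longlongrightarrow> (1 / 4) ^ (2 * k) * (\<i> / 8)) at_i_inf"
proof -
  have "((\<lambda>\<tau>. ((1 / 4) * eta_h (of_real 1 * \<tau> + 1/2)) ^ (2 * k) * ((\<i> / 8) * eta_h (of_real (1/2) * \<tau> + 1/4))) \<longlongrightarrow>
     ((1 / 4) * 1) ^ (2 * k) * ((\<i> / 8) * 1)) at_i_inf"
    by (intro tendsto_intros eta_h_cusp_affine) auto
  moreover have "eventually (\<lambda>\<tau>. weight_slash (2 * k + 1) 1 0 2 1 (f_eta k) \<tau> =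
     ((1 / 4) * eta_h (of_real 1 * \<tau> + 1/2)) ^ (2 * k) * ((\<i> / 8) * eta_h (of_real (1/2) * \<tau> + 1/4))) at_i_inf"
    using eventually_Im_pos
  proof eventually_elim
    case (elim \<tau>)
    define j where "j = 2 * \<tau> + 1"
    have j: "Im j > 0" using elim by (simp add: j_def)
    hence j0: "j \<noteq> 0" by auto
    have 1: "eta_g (\<tau> / j) = j * ((1 / 4) * eta_h (\<tau> + 1/2))"
      using eta_g_cusp_half[OF elim] by (simp add: j_def)
    have "2 * (\<tau> / j) = (j - 1) / j" by (simp add: j_def)
    also have "\<dots> = - 1 / (4 * (j / 4)) + 1" using j0 by (simp add: diff_divide_distrib)
    finally have "2 * (\<tau> / j) = - 1 / (4 * (j / 4)) + 1" .
    hence "eta_g (2 * (\<tau> / j)) = - eta_g (- 1 / (4 * (j / 4)))" by (simp only: eta_g_plus_1)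
    also have "\<dots> = - (- \<i> * (j / 4) / 2 * eta_h (j / 4))"
      by (subst eta_g_inversion) (use j in simp_all)
    also have "\<dots> = j * ((\<i> / 8) * eta_h (j / 4))" by simp
    also have "j / 4 = \<tau> / 2 + 1/4" by (simp add: j_def add_divide_distrib)
    finally have 2: "eta_g (2 * (\<tau> / j)) = j * ((\<i> / 8) * eta_h (\<tau> / 2 + 1/4))" .
    have s: "Im (\<tau> / j) > 0" using Im_moebius_pos[OF elim, of 1 1 0 2] by (simp add: j_def)
    have "f_eta k (\<tau> / j) = j ^ (2 * k + 1) * (((1 / 4) * eta_h (\<tau> + 1/2)) ^ (2 * k) * ((\<i> / 8) * eta_h (\<tau> / 2 + 1/4)))"
      unfolding f_eta_eq_eta_g[OF s assms] 1 2
      by (simp only: power_mult_distrib power_add power_one_right mult_ac)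
    thus ?case using j0 by (simp add: weight_slash_def j_def)
  qed
  ultimately have "(weight_slash (2 * k + 1) 1 0 2 1 (f_eta k) \<longlongrightarrow> ((1 / 4) * 1) ^ (2 * k) * ((\<i> / 8) * 1)) at_i_inf"
    by (simp only: tendsto_cong)
  thus ?thesis by simp
qed

text \<open>The matrix fixes \<open>eta_g\<close> up to the automorphy factor, so the first factor
  still decays. The doubled argument is that of the cusp 1/2 in the variable 2\<tau>, where the
  second factor only tends to 1/4.\<close>

lemma f_eta_cusp_quarter:
  assumes "k \<ge> 1"
  shows "(weight_slash (2 * k + 1) 1 0 4 1 (f_eta k) \<longlongrightarrow> 0) at_i_inf"
proof -
  have "((\<lambda>\<tau>. eta_g \<tau> ^ (2 * k) * ((1 / 4) * eta_h (of_real 2 * \<tau> + 1/2))) \<longlongrightarrow> 0 ^ (2 * k) * ((1 / 4) * 1)) at_i_inf"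
    by (intro tendsto_intros eta_h_cusp_affine eta_g_cusp) auto
  moreover have "eventually (\<lambda>\<tau>. weight_slash (2 * k + 1) 1 0 4 1 (f_eta k) \<tau> =
     eta_g \<tau> ^ (2 * k) * ((1 / 4) * eta_h (of_real 2 * \<tau> + 1/2))) at_i_inf"
    using eventually_Im_pos
  proof eventually_elim
    case (elim \<tau>)
    define j where "j = 4 * \<tau> + 1"
    have j: "Im j > 0" using elim by (simp add: j_def)
    hence j0: "j \<noteq> 0" by auto
    have 1: "eta_g (\<tau> / j) = j * eta_g \<tau>"
      using eta_g_unipotent[OF elim, of 1] by (simp add: j_def)
    have "eta_g (2 * (\<tau> / j)) = j * ((1 / 4) * eta_h (2 * \<tau> + 1/2))"
      using eta_g_cusp_half[of "2 * \<tau>"] elim by (simp add: j_def)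
    note 2 = this
    have s: "Im (\<tau> / j) > 0" using Im_moebius_pos[OF elim, of 1 1 0 4] by (simp add: j_def)
    have "f_eta k (\<tau> / j) = j ^ (2 * k + 1) * (eta_g \<tau> ^ (2 * k) * ((1 / 4) * eta_h (2 * \<tau> + 1/2)))"
      unfolding f_eta_eq_eta_g[OF s assms] 1 2
      by (simp only: power_mult_distrib power_add power_one_right mult_ac)
    thus ?case using j0 by (simp add: weight_slash_def j_def)
  qed
  ultimately have "(weight_slash (2 * k + 1) 1 0 4 1 (f_eta k) \<longlongrightarrow> 0 ^ (2 * k) * ((1 / 4) * 1)) at_i_inf"
    by (simp only: tendsto_cong)
  thus ?thesis using assms by (simp add: power_0_left)
qed

section \<open>The Eisenstein part\<close>

lemma chi_m4_mod: "m mod 4 = n mod 4 \<Longrightarrow> chi_m4 m = chi_m4 n"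
  by (simp add: chi_m4_def)

lemma chi_m4_mult: "chi_m4 (m * n) = chi_m4 m * chi_m4 n"
proof -
  define r s where "r = m mod 4" and "s = n mod 4"
  have "r = 0 \<or> r = 1 \<or> r = 2 \<or> r = 3" "s = 0 \<or> s = 1 \<or> s = 2 \<or> s = 3"
    unfolding r_def s_def by presburger+
  hence "chi_m4 (r * s) = chi_m4 r * chi_m4 s"
    by (elim disjE) (simp_all add: chi_m4_def)
  moreover have "chi_m4 (m * n) = chi_m4 (r * s)" "chi_m4 m = chi_m4 r" "chi_m4 n = chi_m4 s"
    by (rule chi_m4_mod, simp add: r_def s_def mod_mult_eq)+
  ultimately show ?thesis by simp
qed

definition chi_sum :: "nat \<Rightarrow> complex \<Rightarrow> complex" where
  "chi_sum k = lattice_sum (\<lambda>(m, n). chi_m4 m) (2 * k + 1)"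

definition lipschitz_const :: "nat \<Rightarrow> complex" where
  "lipschitz_const k = fact (2 * k) / (- 2 * of_real pi * \<i>) ^ (2 * k + 1)"

definition eulerian_frac :: "nat \<Rightarrow> complex \<Rightarrow> complex" where
  "eulerian_frac k t = t * poly (eulerian_poly (2 * k)) t / (1 - t) ^ (2 * k + 1)"

lemma has_sum_eulerian_frac:
  assumes "Im z > 0" "k \<ge> 1"
  shows "((\<lambda>n. 1 / (z + of_int n) ^ (2 * k + 1)) has_sum (eulerian_frac k (nome z) / lipschitz_const k)) UNIV"
proof -
  have "(\<lambda>j. of_nat (Suc j) ^ (2 * k) * nome z ^ Suc j) sums eulerian_frac k (nome z)"
    using eulerian_poly_sums[OF nome_norm_less_1[OF assms(1)], of "2 * k"] by (simp add: eulerian_frac_def)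
  hence "(\<lambda>j. of_nat j ^ (2 * k) * nome z ^ j) sums (eulerian_frac k (nome z) + of_nat 0 ^ (2 * k) * nome z ^ 0)"
    using sums_Suc_iff[of "\<lambda>j. of_nat j ^ (2 * k) * nome z ^ j"] by blast
  hence "(\<Sum>j. of_nat j ^ (2 * k) * nome z ^ j) = eulerian_frac k (nome z)"
    using assms by (simp add: sums_iff power_0_left)
  moreover have "(- 2 * of_real pi * \<i>) ^ Suc (2 * k) / fact (2 * k) = 1 / lipschitz_const k"
    by (simp add: lipschitz_const_def)
  ultimately show ?thesis
    using lipschitz_formula[OF assms(1), of "2 * k"] assms(2) by simp
qed

lemma lipschitz_const_nonzero: "lipschitz_const k \<noteq> 0"
  by (simp add: lipschitz_const_def)

text \<open>Summing over n first, the Lipschitz formula turns each row m > 0 into a term of the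
  Lambert series. The rows m and -m agree, as the character and the odd power both change sign,
  which explains the factor 1/2; the row 0 is killed by \<chi>(0) = 0.\<close>

lemma has_sum_chi_eulerian_frac:
  assumes "Im \<tau> > 0" "k \<ge> 1"
  shows "((\<lambda>n. chi_m4 (int (Suc n)) * eulerian_frac k (nome \<tau> ^ Suc n)) has_sum
     (lipschitz_const k / 2 * chi_sum k \<tau>)) UNIV"
proof -
  define f where "f = (\<lambda>m n. chi_m4 m / (of_int m * \<tau> + of_int n) ^ (2 * k + 1))"
  define g where "g = (\<lambda>m. \<Sum>\<^sub>\<infinity>n. f m n)"
  have "(\<lambda>(m, n). (case (m, n) of (m, n) \<Rightarrow> chi_m4 m) / (of_int m * \<tau> + of_int n) ^ (2 * k + 1)) summable_on UNIV"
    by (rule lattice_sum_summable[where M = 1]) (use assms norm_chi_m4_le in auto)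
  hence sum: "(\<lambda>(m, n). f m n) summable_on UNIV \<times> UNIV"
    by (simp add: f_def)
  have tot: "((\<lambda>(m, n). f m n) has_sum chi_sum k \<tau>) (UNIV \<times> UNIV)"
    using has_sum_infsum[OF sum] by (simp add: chi_sum_def lattice_sum_def f_def)
  have row: "(f m has_sum g m) UNIV" for m
    unfolding g_def using summable_on_SigmaD1[OF sum, of m] by (intro has_sum_infsum) simp
  have g: "(g has_sum chi_sum k \<tau>) UNIV"
    by (rule has_sum_SigmaD[OF tot]) (use row in simp)
  have g_minus: "g (- m) = g m" for m
    unfolding g_def
  proof (rule infsum_reindex_bij_witness[of _ uminus uminus])
    fix n :: int
    have "of_int (- m) * \<tau> + of_int n = - (of_int m * \<tau> + of_int (- n))" by simp
    moreover have "(- (of_int m * \<tau> + of_int (- n))) ^ (2 * k + 1) = - ((of_int m * \<tau> + of_int (- n)) ^ (2 * k + 1))"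
      by (rule power_minus_odd) simp
    ultimately have "(of_int (- m) * \<tau> + of_int n) ^ (2 * k + 1) = - ((of_int m * \<tau> + of_int (- n)) ^ (2 * k + 1))"
      by (simp only:)
    thus "f m (- n) = f (- m) n" unfolding f_def chi_m4_minus by (simp only: minus_divide_divide)
  qed auto
  have g0: "g 0 = 0" by (simp add: g_def f_def chi_m4_def)
  have "g summable_on UNIV" using g by (rule has_sum_imp_summable)
  hence "(\<lambda>n. g (int (Suc n))) summable_on UNIV" by (rule summable_on_int_Suc)
  then obtain b where b: "((\<lambda>n. g (int (Suc n))) has_sum b) UNIV" by (auto simp: summable_on_def)
  moreover have "((\<lambda>n. g (- int (Suc n))) has_sum b) UNIV" using b unfolding g_minus .
  ultimately have "(g has_sum (g 0 + b + b)) UNIV" by (rule has_sum_int_nat0)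
  hence "chi_sum k \<tau> = g 0 + b + b" using g has_sum_unique by blast
  hence b_eq: "b = chi_sum k \<tau> / 2" by (simp add: g0)
  have "g (int (Suc n)) = chi_m4 (int (Suc n)) * (eulerian_frac k (nome \<tau> ^ Suc n) / lipschitz_const k)" for n
  proof -
    have z: "Im (of_nat (Suc n) * \<tau>) > 0" using assms by simp
    from has_sum_cmult_right[OF has_sum_eulerian_frac[OF z assms(2)], of "chi_m4 (int (Suc n))"]
    have "(f (int (Suc n)) has_sum (chi_m4 (int (Suc n)) * (eulerian_frac k (nome \<tau> ^ Suc n) / lipschitz_const k))) UNIV"
      unfolding nome_of_nat_mult f_def by simp
    thus ?thesis using row has_sum_unique by blast
  qed
  hence "lipschitz_const k * g (int (Suc n)) = chi_m4 (int (Suc n)) * eulerian_frac k (nome \<tau> ^ Suc n)" for n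
    using lipschitz_const_nonzero[of k] by simp
  thus ?thesis using has_sum_cmult_right[OF b, of "lipschitz_const k"] by (simp add: b_eq)
qed

definition eisenstein_part :: "nat \<Rightarrow> complex \<Rightarrow> complex" where
  "eisenstein_part k \<tau> = lambert_coeff k * (lipschitz_const k / 2) *
     (if even k then chi_sum k \<tau> - 2 ^ (2 * k) * chi_sum k (2 * \<tau>) else chi_sum k (2 * \<tau>))"

text \<open>This is the origin of P_k: it is the numerator of the difference of the two fractions
  over the common denominator (1 - t^2)^(2k+1), where 1 - t^2 = (1 + t)(1 - t).\<close>

lemma P_poly_eulerian_frac:
  assumes "norm t < 1"
  shows "t * poly (P_poly k) t / (1 - t ^ 2) ^ (2 * k + 1) = eulerian_frac k t - 2 ^ (2 * k) * eulerian_frac k (t ^ 2)"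
proof -
  have nz: "1 + t \<noteq> 0" "1 - t \<noteq> 0"
  proof -
    have "norm (- t) \<noteq> norm (1 :: complex)" "norm t \<noteq> norm (1 :: complex)" using assms by auto
    hence "- t \<noteq> 1" "t \<noteq> 1" by metis+
    thus "1 + t \<noteq> 0" "1 - t \<noteq> 0" by (auto simp: add_eq_0_iff)
  qed
  have sq: "1 - t ^ 2 = (1 + t) * (1 - t)" by (simp add: power2_eq_square algebra_simps)
  have "poly (P_poly k) t = (1 + t) ^ (2 * k + 1) * poly (eulerian_poly (2 * k)) t - 2 ^ (2 * k) * (t * poly (eulerian_poly (2 * k)) (t ^ 2))"
    by (simp add: P_poly_def poly_pcompose poly_monom del: power_Suc)
  moreover have "t * ((1 + t) ^ (2 * k + 1) * x) / ((1 + t) * (1 - t)) ^ (2 * k + 1) = t * x / (1 - t) ^ (2 * k + 1)" for x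
    unfolding power_mult_distrib using nz by simp
  ultimately show ?thesis
    by (simp only: eulerian_frac_def right_diff_distrib diff_divide_distrib sq) (simp add: power2_eq_square mult_ac)
qed

lemma has_sum_lambert:
  assumes "Im \<tau> > 0" "k \<ge> 1"
  shows "((\<lambda>n. lambert_coeff k * lambert_term k \<tau> (Suc n)) has_sum eisenstein_part k \<tau>) UNIV"
proof -
  define q where "q = nome \<tau>"
  have q: "norm q < 1" unfolding q_def by (rule nome_norm_less_1) fact
  have q2: "nome (2 * \<tau>) = q ^ 2" using nome_of_nat_mult[of 2 \<tau>] by (simp add: q_def)
  have t2: "Im (2 * \<tau>) > 0" using assms by simp
  have h2: "((\<lambda>n. chi_m4 (int (Suc n)) * eulerian_frac k (q ^ (2 * Suc n))) has_sum
     (lipschitz_const k / 2 * chi_sum k (2 * \<tau>))) UNIV"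
    using has_sum_chi_eulerian_frac[OF t2 assms(2)] unfolding q2 by (simp only: power_mult)
  have h1: "((\<lambda>n. chi_m4 (int (Suc n)) * eulerian_frac k (q ^ Suc n)) has_sum
     (lipschitz_const k / 2 * chi_sum k \<tau>)) UNIV"
    using has_sum_chi_eulerian_frac[OF assms] unfolding q_def .
  show ?thesis
  proof (cases "even k")
    case False
    have "lambert_term k \<tau> (Suc n) = chi_m4 (int (Suc n)) * eulerian_frac k (q ^ (2 * Suc n))" for n
      using False unfolding lambert_term_def Let_def q_def [symmetric] eulerian_frac_def by simp
    thus ?thesis using has_sum_cmult_right[OF h2, of "lambert_coeff k"] False
      by (simp add: eisenstein_part_def mult.assoc)
  next
    case True
    have "lambert_term k \<tau> (Suc n) = chi_m4 (int (Suc n)) * eulerian_frac k (q ^ Suc n) -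
       2 ^ (2 * k) * (chi_m4 (int (Suc n)) * eulerian_frac k (q ^ (2 * Suc n)))" for n
    proof -
      have t: "norm (q ^ Suc n) < 1" using power_Suc_less_1[of "norm q" n] q by (simp only: norm_power) simp
      have "(q ^ Suc n) ^ 2 = q ^ (2 * Suc n)" by (simp only: power_mult [symmetric] mult.commute)
      hence "q ^ Suc n * poly (P_poly k) (q ^ Suc n) / (1 - q ^ (2 * Suc n)) ^ (2 * k + 1) =
         eulerian_frac k (q ^ Suc n) - 2 ^ (2 * k) * eulerian_frac k (q ^ (2 * Suc n))"
        using P_poly_eulerian_frac[OF t, of k] by (simp only:)
      thus ?thesis using True unfolding lambert_term_def Let_def q_def [symmetric]
        by (simp only: if_True right_diff_distrib) (simp only: mult_ac)
    qed
    moreover have "((\<lambda>n. chi_m4 (int (Suc n)) * eulerian_frac k (q ^ Suc n) -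
       2 ^ (2 * k) * (chi_m4 (int (Suc n)) * eulerian_frac k (q ^ (2 * Suc n)))) has_sum
      (lipschitz_const k / 2 * chi_sum k \<tau> - 2 ^ (2 * k) * (lipschitz_const k / 2 * chi_sum k (2 * \<tau>)))) UNIV"
      by (intro has_sum_diff h1 has_sum_cmult_right h2)
    ultimately have "((\<lambda>n. lambert_coeff k * lambert_term k \<tau> (Suc n)) has_sum
       lambert_coeff k * (lipschitz_const k / 2 * chi_sum k \<tau> - 2 ^ (2 * k) * (lipschitz_const k / 2 * chi_sum k (2 * \<tau>)))) UNIV"
      by (intro has_sum_cmult_right) (simp only:)
    thus ?thesis using True by (simp add: eisenstein_part_def algebra_simps)
  qed
qed

lemma lambert_coeff_nonzero: "k \<ge> 1 \<Longrightarrow> lambert_coeff k \<noteq> 0"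
  using euler_number_even_nonzero[of k] by (simp add: lambert_coeff_def)

section \<open>Transformation and constant terms of the Eisenstein part\<close>

lemma chi_sum_slash:
  assumes "Im \<tau> > 0" "a * d - b * c = 1"
  shows "weight_slash (2 * k + 1) a b c d (chi_sum k) \<tau> = lattice_sum (\<lambda>(m, n). chi_m4 (m * d - n * c)) (2 * k + 1) \<tau>"
  unfolding chi_sum_def lattice_sum_slash[OF assms] by (simp add: case_prod_unfold)

text \<open>Modulo 4 the weight \<chi>(md - nc) loses its second term and factors. So G(\<tau>) has
  level 4, and only the doubled argument in G(2\<tau>) raises the level to 8.\<close>

lemma chi_sum_modular:
  assumes "Im \<tau> > 0" "a * d - b * c = 1" "4 dvd c"
  shows "weight_slash (2 * k + 1) a b c d (chi_sum k) \<tau> = chi_m4 d * chi_sum k \<tau>"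
proof -
  obtain e where c: "c = 4 * e" using assms(3) by (rule dvdE)
  have "chi_m4 (m * d - n * c) = chi_m4 d * chi_m4 m" for m n
  proof -
    have "(m * d - n * c) = m * d + (- n * e) * 4" by (simp add: c)
    hence "(m * d - n * c) mod 4 = (m * d) mod 4" by (simp only: mod_mult_self1)
    hence "chi_m4 (m * d - n * c) = chi_m4 (m * d)" by (rule chi_m4_mod)
    thus ?thesis by (simp add: chi_m4_mult mult.commute)
  qed
  hence "weight_slash (2 * k + 1) a b c d (chi_sum k) \<tau> = lattice_sum (\<lambda>(m, n). chi_m4 d * chi_m4 m) (2 * k + 1) \<tau>"
    unfolding chi_sum_slash[OF assms(1,2)] by simp
  also have "\<dots> = chi_m4 d * chi_sum k \<tau>"
    unfolding chi_sum_def lattice_sum_def by (subst infsum_cmult_right' [symmetric]) (simp add: case_prod_unfold)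
  finally show ?thesis .
qed

lemma weight_slash_double:
  "weight_slash s a b (2 * c) d (\<lambda>\<tau>. F (2 * \<tau>)) \<tau> = weight_slash s a (2 * b) c d F (2 * \<tau>)"
  by (simp add: weight_slash_def distrib_left mult_ac)

lemma weight_slash_eisenstein:
  "weight_slash s a b c d (eisenstein_part k) \<tau> = lambert_coeff k * (lipschitz_const k / 2) *
     (if even k then weight_slash s a b c d (chi_sum k) \<tau> - 2 ^ (2 * k) * weight_slash s a b c d (\<lambda>\<tau>. chi_sum k (2 * \<tau>)) \<tau>
      else weight_slash s a b c d (\<lambda>\<tau>. chi_sum k (2 * \<tau>)) \<tau>)"
  by (cases "even k") (simp_all add: weight_slash_def eisenstein_part_def right_diff_distrib diff_divide_distrib)

lemma eisenstein_part_modular: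
  assumes "Im \<tau> > 0" "a * d - b * c = 1" "8 dvd c"
  shows "weight_slash (2 * k + 1) a b c d (eisenstein_part k) \<tau> = chi_m4 d * eisenstein_part k \<tau>"
proof -
  obtain e where c: "c = 8 * e" using assms(3) by (rule dvdE)
  have 1: "weight_slash (2 * k + 1) a b c d (chi_sum k) \<tau> = chi_m4 d * chi_sum k \<tau>"
    by (rule chi_sum_modular) (use assms c in auto)
  have "weight_slash (2 * k + 1) a b c d (\<lambda>\<tau>. chi_sum k (2 * \<tau>)) \<tau> = weight_slash (2 * k + 1) a (2 * b) (4 * e) d (chi_sum k) (2 * \<tau>)"
    using weight_slash_double[of "2 * k + 1" a b "4 * e" d "chi_sum k" \<tau>] by (simp add: c)
  also have "\<dots> = chi_m4 d * chi_sum k (2 * \<tau>)"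
    by (rule chi_sum_modular) (use assms c in auto)
  finally show ?thesis unfolding weight_slash_eisenstein 1
    by (simp add: eisenstein_part_def algebra_simps)
qed

text \<open>Only the row m = 0 survives, with weight \<chi>(-nc) = -\<chi>(c) \<chi>(n), and its sum
  over all nonzero n is twice the beta value. In particular the constant term vanishes at every cusp
  with even c.\<close>

lemma chi_sum_cusp:
  assumes "k \<ge> 1" "a * d - b * c = 1"
  shows "(weight_slash (2 * k + 1) a b c d (chi_sum k) \<longlongrightarrow> - 2 * chi_m4 c * dirichlet_beta (of_nat (2 * k + 1))) at_i_inf"
proof -
  have "(lattice_sum (\<lambda>(m, n). chi_m4 (m * d - n * c)) (2 * k + 1) \<longlongrightarrow>
      (\<Sum>\<^sub>\<infinity>n. (case (0, n) of (m, n) \<Rightarrow> chi_m4 (m * d - n * c)) / of_int n ^ (2 * k + 1))) at_i_inf"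
    by (rule lattice_sum_cusp_limit[where M = 1]) (use assms norm_chi_m4_le in auto)
  also have "(\<Sum>\<^sub>\<infinity>n. (case (0, n) of (m, n) \<Rightarrow> chi_m4 (m * d - n * c)) / of_int n ^ (2 * k + 1))
     = (\<Sum>\<^sub>\<infinity>n. (- chi_m4 c) * (chi_m4 n / of_int n ^ (2 * k + 1)))"
    by (simp add: chi_m4_minus chi_m4_mult mult.commute)
  also have "\<dots> = - 2 * chi_m4 c * dirichlet_beta (of_nat (2 * k + 1))"
    using infsumI[OF has_sum_cmult_right[OF has_sum_chi_m4_beta[of k], of "- chi_m4 c"]] assms by simp
  finally show ?thesis
  proof (rule Lim_transform_eventually)
    show "eventually (\<lambda>\<tau>. lattice_sum (\<lambda>(m, n). chi_m4 (m * d - n * c)) (2 * k + 1) \<tau> =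
      weight_slash (2 * k + 1) a b c d (chi_sum k) \<tau>) at_i_inf"
      using eventually_Im_pos by eventually_elim (rule chi_sum_slash[OF _ assms(2), symmetric])
  qed
qed

lemma chi_sum_double_cusp:
  assumes "k \<ge> 1" "a * d - 2 * b * c = 1"
  shows "(weight_slash (2 * k + 1) a b (2 * c) d (\<lambda>\<tau>. chi_sum k (2 * \<tau>)) \<longlongrightarrow> - 2 * chi_m4 c * dirichlet_beta (of_nat (2 * k + 1))) at_i_inf"
proof -
  have "((\<lambda>\<tau>. weight_slash (2 * k + 1) a (2 * b) c d (chi_sum k) (of_real 2 * \<tau> + 0)) \<longlongrightarrow> - 2 * chi_m4 c * dirichlet_beta (of_nat (2 * k + 1))) at_i_inf"
    by (rule filterlim_compose[OF chi_sum_cusp filterlim_affine_at_i_infinity]) (use assms in auto)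
  moreover have "weight_slash (2 * k + 1) a b (2 * c) d (\<lambda>\<tau>. chi_sum k (2 * \<tau>)) =
     (\<lambda>\<tau>. weight_slash (2 * k + 1) a (2 * b) c d (chi_sum k) (of_real 2 * \<tau> + 0))"
  proof
    fix \<tau>
    show "weight_slash (2 * k + 1) a b (2 * c) d (\<lambda>\<tau>. chi_sum k (2 * \<tau>)) \<tau> =
       weight_slash (2 * k + 1) a (2 * b) c d (chi_sum k) (of_real 2 * \<tau> + 0)"
      using weight_slash_double[of "2 * k + 1" a b c d "chi_sum k" \<tau>] by simp
  qed
  ultimately show ?thesis by (simp only:)
qed

text \<open>The lower left entry is odd here and cannot be halved. Instead, -2/\<tau> =
  -1/(\<tau>/2) reduces the claim to \<open>chi_sum\<close> at \<tau>/2, and the automorphy factors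
  differ by 2^(2k+1).\<close>

lemma chi_sum_double_cusp_0:
  assumes "k \<ge> 1"
  shows "(weight_slash (2 * k + 1) 0 (-1) 1 0 (\<lambda>\<tau>. chi_sum k (2 * \<tau>)) \<longlongrightarrow> - 2 * dirichlet_beta (of_nat (2 * k + 1)) / 2 ^ (2 * k + 1)) at_i_inf"
proof -
  have "((\<lambda>\<tau>. weight_slash (2 * k + 1) 0 (-1) 1 0 (chi_sum k) (of_real (1/2) * \<tau> + 0) / 2 ^ (2 * k + 1)) \<longlongrightarrow> (- 2 * chi_m4 1 * dirichlet_beta (of_nat (2 * k + 1))) / 2 ^ (2 * k + 1)) at_i_inf"
    by (intro tendsto_divide tendsto_const filterlim_compose[OF chi_sum_cusp filterlim_affine_at_i_infinity]) (use assms in auto)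
  moreover have "weight_slash (2 * k + 1) 0 (-1) 1 0 (chi_sum k) (of_real (1/2) * \<tau> + 0) / 2 ^ (2 * k + 1)
     = weight_slash (2 * k + 1) 0 (-1) 1 0 (\<lambda>\<tau>. chi_sum k (2 * \<tau>)) \<tau>" for \<tau>
    by (simp add: weight_slash_def power_divide)
  ultimately show ?thesis by (simp add: chi_m4_def)
qed

text \<open>The factorials and all powers of pi cancel, leaving a constant that can be compared with
  the purely algebraic cusp values of f_k.\<close>

lemma lipschitz_const_beta:
  assumes "k \<ge> 1"
  shows "lipschitz_const k * dirichlet_beta (of_nat (2 * k + 1)) = \<i> * of_real (euler_number (2 * k)) / (8 * 16 ^ k)"
proof -
  have "(- 2 * of_real pi * \<i>) ^ (2 * k + 1) = ((- 2 * of_real pi * \<i>) ^ 2) ^ k * (- 2 * of_real pi * \<i>)"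
    by (simp only: power_add power_mult power_one_right)
  also have "(- 2 * of_real pi * \<i>) ^ 2 = (-1) * 4 * of_real pi ^ 2" by (simp add: power_mult_distrib)
  also have "((-1) * 4 * of_real pi ^ 2 :: complex) ^ k = (-1) ^ k * 4 ^ k * of_real pi ^ (2 * k)"
    by (simp only: power_mult_distrib power_mult)
  finally have p: "(- 2 * of_real pi * \<i>) ^ (2 * k + 1) = (-1) ^ k * 4 ^ k * of_real pi ^ (2 * k) * (- 2 * of_real pi * \<i>)" .
  have s: "(16 :: complex) ^ k = 4 ^ k * 4 ^ k" by (simp flip: power_mult_distrib)
  \<comment> \<open>The letters stand for F = (2k)!, N = (-1)^k, x = 4^k, p = pi^(2k), P = pi and e
    the Euler number.\<close>
  have gen: "F / (N * x * p * (- 2 * P * \<i>)) * (N * e / (x * 4 * F) * (p * P)) = \<i> * e / (8 * (x * x))"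
    if nz: "F \<noteq> 0" "N \<noteq> 0" "x \<noteq> 0" "p \<noteq> 0" "P \<noteq> 0" for F N x p P e :: complex
  proof -
    have "F / (N * x * p * (- 2 * P * \<i>)) = \<i> * F / (\<i> * (N * x * p * (- 2 * P * \<i>)))" by simp
    also have "\<i> * (N * x * p * (- 2 * P * \<i>)) = (- (\<i> * \<i>)) * (N * x * p * (2 * P))"
      by (simp only: mult_ac mult_minus_left mult_minus_right)
    finally show ?thesis using nz by simp
  qed
  have "dirichlet_beta (of_nat (2 * k + 1)) =
      (-1) ^ k * of_real (euler_number (2 * k)) / (4 ^ (k + 1) * fact (2 * k)) * of_real pi ^ (2 * k + 1)"
    using assms by (intro dirichlet_beta_odd) simp
  hence B: "dirichlet_beta (of_nat (2 * k + 1)) =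
      (-1) ^ k * of_real (euler_number (2 * k)) / (4 ^ k * 4 * fact (2 * k)) * (of_real pi ^ (2 * k) * of_real pi)"
    by (simp only: power_add power_one_right)
  show ?thesis
    unfolding lipschitz_const_def p s B by (rule gen) auto
qed

section \<open>The cusp form\<close>

definition cusp_part :: "nat \<Rightarrow> complex \<Rightarrow> complex" where
  "cusp_part k \<tau> = f_eta k \<tau> - eisenstein_part k \<tau>"

lemma weight_slash_cusp_part:
  "weight_slash s a b c d (cusp_part k) \<tau> = weight_slash s a b c d (f_eta k) \<tau> - weight_slash s a b c d (eisenstein_part k) \<tau>"
  by (simp add: weight_slash_def cusp_part_def diff_divide_distrib)

lemma cusp_part_modular:
  assumes "Im \<tau> > 0" "a * d - b * c = 1" "8 dvd c" "k \<ge> 1"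
  shows "weight_slash (2 * k + 1) a b c d (cusp_part k) \<tau> = chi_m4 d * cusp_part k \<tau>"
  unfolding weight_slash_cusp_part f_eta_modular[OF assms(2,3,1,4)] eisenstein_part_modular[OF assms(1,2,3)]
  by (simp add: cusp_part_def right_diff_distrib)

lemma eisenstein_cusp:
  assumes "(weight_slash s a b c d (chi_sum k) \<longlongrightarrow> x) F"
    "(weight_slash s a b c d (\<lambda>\<tau>. chi_sum k (2 * \<tau>)) \<longlongrightarrow> y) F"
  shows "(weight_slash s a b c d (eisenstein_part k) \<longlongrightarrow>
     lambert_coeff k * (lipschitz_const k / 2) * (if even k then x - 2 ^ (2 * k) * y else y)) F"
  unfolding weight_slash_eisenstein [abs_def] using assms
  by (cases "even k") (auto intro!: tendsto_intros)

lemma cusp_part_cusp_infinity: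
  assumes "k \<ge> 1"
  shows "(weight_slash (2 * k + 1) 1 0 0 1 (cusp_part k) \<longlongrightarrow> 0) at_i_inf"
proof -
  have 1: "(weight_slash (2 * k + 1) 1 0 0 1 (chi_sum k) \<longlongrightarrow> 0) at_i_inf"
    using chi_sum_cusp[OF assms, of 1 1 0 0] by (simp add: chi_m4_def)
  have 2: "(weight_slash (2 * k + 1) 1 0 0 1 (\<lambda>\<tau>. chi_sum k (2 * \<tau>)) \<longlongrightarrow> 0) at_i_inf"
    using chi_sum_double_cusp[OF assms, of 1 1 0 0] by (simp add: chi_m4_def)
  have 3: "(weight_slash (2 * k + 1) 1 0 0 1 (eisenstein_part k) \<longlongrightarrow> 0) at_i_inf"
    using eisenstein_cusp[OF 1 2] by (simp split: if_splits)
  have "(weight_slash (2 * k + 1) 1 0 0 1 (f_eta k) \<longlongrightarrow> 0) at_i_inf"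
    using f_eta_cusp_infinity[OF assms] by (simp add: weight_slash_def [abs_def])
  from tendsto_diff[OF this 3] show ?thesis
    unfolding weight_slash_cusp_part [abs_def] by simp
qed

lemma cusp_part_cusp_quarter:
  assumes "k \<ge> 1"
  shows "(weight_slash (2 * k + 1) 1 0 4 1 (cusp_part k) \<longlongrightarrow> 0) at_i_inf"
proof -
  have 1: "(weight_slash (2 * k + 1) 1 0 4 1 (chi_sum k) \<longlongrightarrow> 0) at_i_inf"
    using chi_sum_cusp[OF assms, of 1 1 0 4] by (simp add: chi_m4_def)
  have 2: "(weight_slash (2 * k + 1) 1 0 4 1 (\<lambda>\<tau>. chi_sum k (2 * \<tau>)) \<longlongrightarrow> 0) at_i_inf"
    using chi_sum_double_cusp[OF assms, of 1 1 0 2] by (simp add: chi_m4_def)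
  have "(weight_slash (2 * k + 1) 1 0 4 1 (eisenstein_part k) \<longlongrightarrow> 0) at_i_inf"
    using eisenstein_cusp[OF 1 2] by (simp split: if_splits)
  from tendsto_diff[OF f_eta_cusp_quarter[OF assms] this] show ?thesis
    unfolding weight_slash_cusp_part [abs_def] by simp
qed

text \<open>Only G(2\<tau>) contributes. Its coefficient in the Eisenstein part is the same for both
  parities: the factor 2^(2k) in the even case cancels the one in
  \<open>lambert_coeff\<close>.\<close>

lemma cusp_part_cusp_half:
  assumes "k \<ge> 1"
  shows "(weight_slash (2 * k + 1) 1 0 2 1 (cusp_part k) \<longlongrightarrow> 0) at_i_inf"
proof -
  define B where "B = dirichlet_beta (of_nat (2 * k + 1))"
  define E where "E = complex_of_real (euler_number (2 * k))"
  have E: "E \<noteq> 0" using euler_number_even_nonzero[of k] assms by (simp add: E_def)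
  have CB: "lipschitz_const k * B = \<i> * E / (8 * 16 ^ k)"
    unfolding B_def E_def by (rule lipschitz_const_beta[OF assms])
  have 1: "(weight_slash (2 * k + 1) 1 0 2 1 (chi_sum k) \<longlongrightarrow> 0) at_i_inf"
    using chi_sum_cusp[OF assms, of 1 1 0 2] by (simp add: chi_m4_def)
  have 2: "(weight_slash (2 * k + 1) 1 0 2 1 (\<lambda>\<tau>. chi_sum k (2 * \<tau>)) \<longlongrightarrow> - 2 * B) at_i_inf"
    using chi_sum_double_cusp[OF assms, of 1 1 0 1] by (simp add: chi_m4_def B_def)
  have "lambert_coeff k * (lipschitz_const k / 2) * (if even k then 0 - 2 ^ (2 * k) * (- 2 * B) else - 2 * B)
     = (lipschitz_const k * B) / E"
    by (simp add: lambert_coeff_def E_def)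
  also have "\<dots> = (1 / 4) ^ (2 * k) * (\<i> / 8)"
    unfolding CB using E by (simp add: power_mult power_divide)
  finally have K: "lambert_coeff k * (lipschitz_const k / 2) * (if even k then 0 - 2 ^ (2 * k) * (- 2 * B) else - 2 * B)
     = (1 / 4) ^ (2 * k) * (\<i> / 8)" .
  have "(weight_slash (2 * k + 1) 1 0 2 1 (eisenstein_part k) \<longlongrightarrow> (1 / 4) ^ (2 * k) * (\<i> / 8)) at_i_inf"
    using eisenstein_cusp[OF 1 2] by (simp only: K)
  from tendsto_diff[OF f_eta_cusp_half[OF assms] this] show ?thesis
    unfolding weight_slash_cusp_part [abs_def] by simp
qed

text \<open>G(2\<tau>) contributes 2^(-2k-1) times the constant term of G(\<tau>). In the even case
  the difference 1 - 1/2 = 1/2, against the bare G(2\<tau>) with coefficient of opposite sign in the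
  odd case, yields exactly the factor (-1)^k present in f_k.\<close>

lemma cusp_part_cusp_0:
  assumes "k \<ge> 1"
  shows "(weight_slash (2 * k + 1) 0 (-1) 1 0 (cusp_part k) \<longlongrightarrow> 0) at_i_inf"
proof -
  define B where "B = dirichlet_beta (of_nat (2 * k + 1))"
  define E where "E = complex_of_real (euler_number (2 * k))"
  have E: "E \<noteq> 0" using euler_number_even_nonzero[of k] assms by (simp add: E_def)
  have CB: "lipschitz_const k * B = \<i> * E / (8 * 16 ^ k)"
    unfolding B_def E_def by (rule lipschitz_const_beta[OF assms])
  have 1: "(weight_slash (2 * k + 1) 0 (-1) 1 0 (chi_sum k) \<longlongrightarrow> - 2 * B) at_i_inf"
    using chi_sum_cusp[OF assms, of 0 0 "-1" 1] by (simp add: chi_m4_def B_def)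
  have 2: "(weight_slash (2 * k + 1) 0 (-1) 1 0 (\<lambda>\<tau>. chi_sum k (2 * \<tau>)) \<longlongrightarrow> - 2 * B / 2 ^ (2 * k + 1)) at_i_inf"
    using chi_sum_double_cusp_0[OF assms] by (simp add: B_def)
  have p: "(2 :: complex) ^ (2 * k) = 4 ^ k" by (simp add: power_mult)
  have "lambert_coeff k * (lipschitz_const k / 2) * (if even k then - 2 * B - 2 ^ (2 * k) * (- 2 * B / 2 ^ (2 * k + 1)) else - 2 * B / 2 ^ (2 * k + 1))
     = - ((-1) ^ k) * ((lipschitz_const k * B) / E) / (2 * 4 ^ k)"
    by (simp add: lambert_coeff_def E_def p)
  also have "\<dots> = - ((-1) ^ k) * \<i> / (16 * (4 ^ k * 16 ^ k))"
    unfolding CB using E by simp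
  also have "(4 :: complex) ^ k * 16 ^ k = 64 ^ k" by (simp flip: power_mult_distrib)
  also have "- ((-1) ^ k) * \<i> / (16 * 64 ^ k) = (- \<i> / 8) ^ (2 * k) * (- \<i> / 16)"
    by (simp add: power_mult power_divide) (simp add: power_minus' field_simps)
  finally have K: "lambert_coeff k * (lipschitz_const k / 2) * (if even k then - 2 * B - 2 ^ (2 * k) * (- 2 * B / 2 ^ (2 * k + 1)) else - 2 * B / 2 ^ (2 * k + 1))
     = (- \<i> / 8) ^ (2 * k) * (- \<i> / 16)" .
  have "(weight_slash (2 * k + 1) 0 (-1) 1 0 (eisenstein_part k) \<longlongrightarrow> (- \<i> / 8) ^ (2 * k) * (- \<i> / 16)) at_i_inf"
    using eisenstein_cusp[OF 1 2] by (simp only: K)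
  from tendsto_diff[OF f_eta_cusp_0[OF assms] this] show ?thesis
    unfolding weight_slash_cusp_part [abs_def] by simp
qed

text \<open>The entries in \<open>M\<close> say that the matrix is a product of an element of
  \<Gamma>_0(8), a cusp representative (p, q; r, s) and the translation by j. The first factor costs
  only a character value and the last preserves the filter, so the limit at the representative
  decides.\<close>

lemma cusp_part_cusp_transfer:
  fixes a0 b0 c0 d0 p q r s j :: int
  assumes "k \<ge> 1" "a0 * d0 - b0 * c0 = 1" "8 dvd c0" "p * s - q * r = 1"
    and M: "a = a0 * p + b0 * r" "b = a0 * (p * j + q) + b0 * (r * j + s)"
      "c = c0 * p + d0 * r" "d = c0 * (p * j + q) + d0 * (r * j + s)"
    and lim: "(weight_slash (2 * k + 1) p q r s (cusp_part k) \<longlongrightarrow> 0) at_i_inf"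
  shows "(weight_slash (2 * k + 1) a b c d (cusp_part k) \<longlongrightarrow> 0) at_i_inf"
proof -
  have "((\<lambda>\<tau>. chi_m4 d0 * weight_slash (2 * k + 1) p q r s (cusp_part k) (of_real 1 * \<tau> + of_int j)) \<longlongrightarrow> chi_m4 d0 * 0) at_i_inf"
    by (intro tendsto_mult tendsto_const filterlim_compose[OF lim filterlim_affine_at_i_infinity]) simp
  moreover have "eventually (\<lambda>\<tau>. chi_m4 d0 * weight_slash (2 * k + 1) p q r s (cusp_part k) (of_real 1 * \<tau> + of_int j) =
     weight_slash (2 * k + 1) a b c d (cusp_part k) \<tau>) at_i_inf"
    using eventually_Im_pos
  proof eventually_elim
    case (elim \<tau>)
    define \<sigma> where "\<sigma> = \<tau> + of_int j"
    have s: "Im \<sigma> > 0" using elim by (simp add: \<sigma>_def)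
    define A J where "A = of_int p * \<sigma> + of_int q" and "J = of_int r * \<sigma> + of_int s"
    have J: "J \<noteq> 0" unfolding J_def by (rule moebius_denom_nonzero[OF s assms(4)])
    have z: "Im (A / J) > 0" unfolding A_def J_def by (rule Im_moebius_pos[OF s assms(4)])
    have n: "(of_int a0 * (A / J) + of_int b0) * J = of_int a * \<tau> + of_int b"
    proof -
      have "(of_int a0 * (A / J) + of_int b0) * J = of_int a0 * A + of_int b0 * J"
        using J by (simp add: distrib_right)
      thus ?thesis by (simp add: A_def J_def M \<sigma>_def algebra_simps)
    qed
    have m: "(of_int c0 * (A / J) + of_int d0) * J = of_int c * \<tau> + of_int d"
    proof -
      have "(of_int c0 * (A / J) + of_int d0) * J = of_int c0 * A + of_int d0 * J"
        using J by (simp add: distrib_right)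
      thus ?thesis by (simp add: A_def J_def M \<sigma>_def algebra_simps)
    qed
    have "weight_slash (2 * k + 1) a b c d (cusp_part k) \<tau> =
       weight_slash (2 * k + 1) a0 b0 c0 d0 (cusp_part k) (A / J) / J ^ (2 * k + 1)"
      unfolding weight_slash_def n [symmetric] m [symmetric] using J
      by (simp only: power_mult_distrib mult_divide_mult_cancel_right divide_divide_eq_left) simp
    also have "\<dots> = chi_m4 d0 * (cusp_part k (A / J) / J ^ (2 * k + 1))"
      by (subst cusp_part_modular[OF z assms(2,3,1)]) simp
    finally show ?case by (simp add: weight_slash_def \<sigma>_def A_def J_def)
  qed
  ultimately show ?thesis by (simp add: tendsto_cong)
qed

text \<open>The classes of c distinguished here belong to the cusps 0, 1/2, 1/4 and infinity.
  Multiplying on the right by a translation and by the inverse representative, it remains to make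
  the lower left entry divisible by 8.\<close>

lemma cusp_part_cusp:
  assumes "k \<ge> 1" "a * d - b * c = 1"
  shows "(weight_slash (2 * k + 1) a b c d (cusp_part k) \<longlongrightarrow> 0) at_i_inf"
proof -
  have "odd c \<or> c mod 4 = 2 \<or> c mod 8 = 4 \<or> c mod 8 = 0" by presburger
  then consider "odd c" | "c mod 4 = 2" | "c mod 8 = 4" | "c mod 8 = 0" by blast
  thus ?thesis
  proof cases
    case 1
    \<comment> \<open>For odd c the square c^2 is 1 mod 8, hence d - jc = d(1 - c^2) is divisible by
      8.\<close>
    define j where "j = c * d"
    have "8 dvd c * c - 1"
    proof -
      from 1 obtain e where e: "c = 2 * e + 1" by (auto elim: oddE)
      have "even (e * (e + 1))" by simp
      then obtain h where h: "e * (e + 1) = 2 * h" by (rule evenE)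
      have "c * c - 1 = 4 * (e * (e + 1))" by (simp add: e algebra_simps)
      thus ?thesis by (simp add: h)
    qed
    hence "8 dvd d * (c * c - 1)" by simp
    hence c0: "8 dvd - (d - j * c)" by (simp add: j_def algebra_simps)
    show ?thesis
    proof -
      have det: "- (b - j * a) * c - a * - (d - j * c) = 1" using assms(2) by (simp add: algebra_simps)
      have S: "(0 :: int) * 0 - (-1) * 1 = 1" by simp
      have "a = - (b - j * a) * 0 + a * 1" "b = - (b - j * a) * (0 * j + -1) + a * (1 * j + 0)"
        "c = - (d - j * c) * 0 + c * 1" "d = - (d - j * c) * (0 * j + -1) + c * (1 * j + 0)"
        by simp_all
      from cusp_part_cusp_transfer[OF assms(1) det c0 S this cusp_part_cusp_0[OF assms(1)]]
      show ?thesis .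
    qed
  next
    case 2
    have "even c" using 2 by presburger
    note odd = odd_of_det(2)[OF assms(2) this]
    \<comment> \<open>The requirement is that c/2 and d - jc agree mod 4. Both c/2 and d are odd, so
      they differ by 0 or 2 mod 4, and since c is 2 mod 4 the choice j = 0 or j = 1 corrects
      this.\<close>
    obtain j where c0: "8 dvd c - 2 * (d - j * c)"
    proof (cases "(c div 2) mod 4 = d mod 4")
      case True
      have "8 dvd c - 2 * (d - 0 * c)" using True 2 by presburger
      thus ?thesis using that by blast
    next
      case False
      have "8 dvd c - 2 * (d - 1 * c)" using False 2 odd by presburger
      thus ?thesis using that by blast
    qed
    have det: "(a - 2 * (b - j * a)) * (d - j * c) - (b - j * a) * (c - 2 * (d - j * c)) = 1"
      using assms(2) by (simp add: algebra_simps)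
    have U: "(1 :: int) * 1 - 0 * 2 = 1" by simp
    have "a = (a - 2 * (b - j * a)) * 1 + (b - j * a) * 2"
      "b = (a - 2 * (b - j * a)) * (1 * j + 0) + (b - j * a) * (2 * j + 1)"
      "c = (c - 2 * (d - j * c)) * 1 + (d - j * c) * 2"
      "d = (c - 2 * (d - j * c)) * (1 * j + 0) + (d - j * c) * (2 * j + 1)"
      by (simp_all add: algebra_simps)
    from cusp_part_cusp_transfer[OF assms(1) det c0 U this cusp_part_cusp_half[OF assms(1)]]
    show ?thesis .
  next
    case 3
    have "even c" using 3 by presburger
    note odd = odd_of_det(2)[OF assms(2) this]
    have c0: "8 dvd c - 4 * d" using 3 odd by presburger
    have det: "(a - 4 * b) * d - b * (c - 4 * d) = 1"
      using assms(2) by (simp add: algebra_simps)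
    have V: "(1 :: int) * 1 - 0 * 4 = 1" by simp
    have "a = (a - 4 * b) * 1 + b * 4" "b = (a - 4 * b) * (1 * 0 + 0) + b * (4 * 0 + 1)"
      "c = (c - 4 * d) * 1 + d * 4" "d = (c - 4 * d) * (1 * 0 + 0) + d * (4 * 0 + 1)"
      by simp_all
    from cusp_part_cusp_transfer[OF assms(1) det c0 V this cusp_part_cusp_quarter[OF assms(1)]]
    show ?thesis .
  next
    case 4
    hence c0: "8 dvd c" by presburger
    have I: "(1 :: int) * 1 - 0 * 0 = 1" by simp
    have "a = a * 1 + b * 0" "b = a * (1 * 0 + 0) + b * (0 * 0 + 1)"
      "c = c * 1 + d * 0" "d = c * (1 * 0 + 0) + d * (0 * 0 + 1)"
      by simp_all
    from cusp_part_cusp_transfer[OF assms c0 I this cusp_part_cusp_infinity[OF assms(1)]]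
    show ?thesis .
  qed
qed

section \<open>Holomorphy and membership in the space of cusp forms\<close>

lemma open_upper_half_plane: "open upper_half_plane"
  unfolding upper_half_plane_def by (rule open_halfspace_Im_gt)

lemma dedekind_eta_scaled_holomorphic:
  "r > 0 \<Longrightarrow> (\<lambda>\<tau>. dedekind_eta (of_nat r * \<tau>)) holomorphic_on upper_half_plane"
  unfolding holomorphic_on_open[OF open_upper_half_plane]
proof
  fix \<tau> assume "r > 0" "\<tau> \<in> upper_half_plane"
  hence "Im (of_nat r * \<tau>) > 0" by (simp add: upper_half_plane_def)
  from DERIV_chain2[of dedekind_eta _ "\<lambda>\<tau>. of_nat r * \<tau>", OF has_field_derivative_dedekind_eta[OF this]]
  show "\<exists>f'. ((\<lambda>\<tau>. dedekind_eta (of_nat r * \<tau>)) has_field_derivative f') (at \<tau>)"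
    using DERIV_cmult_Id by blast
qed

lemma cusp_part_holomorphic:
  assumes "k \<ge> 1"
  shows "cusp_part k holomorphic_on upper_half_plane"
proof -
  have eta: "(\<lambda>\<tau>. dedekind_eta (numeral r * \<tau>)) holomorphic_on upper_half_plane" for r
    using dedekind_eta_scaled_holomorphic[of "numeral r"] by simp
  have "dedekind_eta (2 * \<tau>) \<noteq> 0" if "\<tau> \<in> upper_half_plane" for \<tau>
    using that by (intro dedekind_eta_nonzero) (simp add: upper_half_plane_def)
  hence f: "f_eta k holomorphic_on upper_half_plane"
    unfolding f_eta_def [abs_def] by (intro holomorphic_intros eta) auto
  have c: "chi_sum k holomorphic_on upper_half_plane"
    unfolding chi_sum_def by (rule lattice_sum_holomorphic[where M = 1]) (use assms norm_chi_m4_le in auto)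
  have "(chi_sum k \<circ> (\<lambda>\<tau>. 2 * \<tau>)) holomorphic_on upper_half_plane"
    by (rule holomorphic_on_compose_gen[OF _ c]) (auto intro!: holomorphic_intros simp: upper_half_plane_def)
  hence c2: "(\<lambda>\<tau>. chi_sum k (2 * \<tau>)) holomorphic_on upper_half_plane" by (simp add: o_def)
  have "eisenstein_part k holomorphic_on upper_half_plane"
    unfolding eisenstein_part_def [abs_def] using c c2 by (cases "even k") (auto intro!: holomorphic_intros)
  with f show ?thesis unfolding cusp_part_def [abs_def] by (intro holomorphic_intros)
qed

lemma cusp_part_in_cusp_forms:
  assumes "k \<ge> 1"
  shows "cusp_part k \<in> cusp_forms (2 * k + 1) 8 chi_m4"
  unfolding cusp_forms_def
  using cusp_part_holomorphic[OF assms] cusp_part_modular[OF _ _ _ assms] cusp_part_cusp[OF assms]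
  by (auto simp: upper_half_plane_def)

text \<open>The limit q -> 1 is the behaviour at the cusp 0. For t = i/y one has iy = -1/t, so
  f_k(iy) equals t^(2k+1) times the slashed function at t; moreover (1 - q) t tends to 2 pi i. The
  result is (2 pi i)^(2k+1) times the constant term found in \<open>f_eta_cusp_0\<close>.\<close>

lemma f_eta_limit:
  assumes "k \<ge> 1"
  shows "((\<lambda>y::real. (1 - nome (\<i> * of_real y)) ^ (2 * k + 1) * f_eta k (\<i> * of_real y))
          \<longlongrightarrow> of_real pi ^ (2 * k + 1) / 2 ^ (4 * k + 3)) (at_right 0)"
proof -
  define W where "W = weight_slash (2 * k + 1) 0 (-1) 1 0 (f_eta k)"
  have "filterlim (\<lambda>y. Im (\<i> * of_real (1 / y))) at_top (at_right 0)"
    by simp real_asymp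
  hence "filterlim (\<lambda>y. \<i> * of_real (1 / y)) at_i_inf (at_right 0)"
    by (simp add: filterlim_filtercomap_iff o_def)
  hence l1: "((\<lambda>y. W (\<i> * of_real (1 / y))) \<longlongrightarrow> (- \<i> / 8) ^ (2 * k) * (- \<i> / 16)) (at_right 0)"
    unfolding W_def by (rule filterlim_compose[OF f_eta_cusp_0[OF assms]])
  have "((\<lambda>y. (1 - exp (- 2 * pi * y)) / y) \<longlongrightarrow> 2 * pi) (at_right 0)" by real_asymp
  hence "((\<lambda>y. of_real ((1 - exp (- 2 * pi * y)) / y)) \<longlongrightarrow> (of_real (2 * pi) :: complex)) (at_right 0)"
    by (rule tendsto_of_real)
  hence "((\<lambda>y. (of_real ((1 - exp (- 2 * pi * y)) / y) * \<i>) ^ (2 * k + 1) * W (\<i> * of_real (1 / y))) \<longlongrightarrow>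
     (of_real (2 * pi) * \<i>) ^ (2 * k + 1) * ((- \<i> / 8) ^ (2 * k) * (- \<i> / 16))) (at_right 0)"
    by (intro tendsto_mult tendsto_power l1 tendsto_const)
  also have "(of_real (2 * pi) * \<i>) ^ (2 * k + 1) * ((- \<i> / 8) ^ (2 * k) * (- \<i> / 16)) = (of_real pi ^ (2 * k + 1) / 2 ^ (4 * k + 3) :: complex)"
  proof -
    have "(of_real (2 * pi) * \<i>) ^ (2 * k + 1) * ((- \<i> / 8) ^ (2 * k) * (- \<i> / 16)) =
       ((of_real (2 * pi) * \<i>) * (- \<i> / 8)) ^ (2 * k) * ((of_real (2 * pi) * \<i>) * (- \<i> / 16))"
      by (simp only: power_add power_one_right power_mult_distrib mult_ac)
    also have "(of_real (2 * pi) * \<i>) * (- \<i> / 8) = of_real pi / (4 :: complex)" by simp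
    also have "(of_real (2 * pi) * \<i>) * (- \<i> / 16) = of_real pi / (8 :: complex)" by simp
    also have "(of_real pi / 4 :: complex) ^ (2 * k) * (of_real pi / 8) = of_real pi ^ (2 * k + 1) / 2 ^ (4 * k + 3)"
    proof -
      have "(4 :: complex) ^ (2 * k) * 8 = 2 ^ (4 * k + 3)"
        by (simp add: power_add power_mult)
      thus ?thesis by (simp add: power_divide mult_ac)
    qed
    finally show ?thesis .
  qed
  finally show ?thesis
  proof (rule Lim_transform_eventually)
    have "eventually (\<lambda>y::real. y > 0) (at_right 0)" by (rule eventually_at_right_less)
    thus "eventually (\<lambda>y. (of_real ((1 - exp (- 2 * pi * y)) / y) * \<i>) ^ (2 * k + 1) * W (\<i> * of_real (1 / y)) =
       (1 - nome (\<i> * of_real y)) ^ (2 * k + 1) * f_eta k (\<i> * of_real y)) (at_right 0)"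
    proof eventually_elim
      case (elim y)
      define t where "t = \<i> * of_real (1 / y)"
      have t0: "t \<noteq> 0" using elim by (simp add: t_def)
      have m: "- 1 / t = \<i> * of_real y" using elim by (simp add: t_def field_simps)
      have n: "nome (\<i> * of_real y) = of_real (exp (- 2 * pi * y))"
        by (simp add: nome_def exp_of_real [symmetric] mult_ac)
      have W: "W t = f_eta k (\<i> * of_real y) / t ^ (2 * k + 1)"
        unfolding m [symmetric] by (simp add: W_def weight_slash_def)
      have "of_real ((1 - exp (- 2 * pi * y)) / y) * \<i> = (1 - nome (\<i> * of_real y)) * t"
        unfolding n t_def by simp
      hence "(of_real ((1 - exp (- 2 * pi * y)) / y) * \<i>) ^ (2 * k + 1) * W t =
         ((1 - nome (\<i> * of_real y)) ^ (2 * k + 1) * t ^ (2 * k + 1)) * W t"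
        by (simp only: power_mult_distrib)
      also have "\<dots> = (1 - nome (\<i> * of_real y)) ^ (2 * k + 1) * f_eta k (\<i> * of_real y)"
        unfolding W using t0 by simp
      finally show ?case by (simp only: t_def)
    qed
  qed
qed

theorem theorem1p2:
  fixes k :: nat
  assumes "k \<ge> 1"
  shows "(\<forall>i. coeff (P_poly k) i \<in> \<int>) \<and> degree (P_poly k) = 4 * k \<and>
    (\<exists>T \<in> cusp_forms (2 * k + 1) 8 chi_m4.
       (\<forall>\<tau>\<in>upper_half_plane.
          summable (\<lambda>n. lambert_term k \<tau> (Suc n)) \<and> f_eta k \<tau> = rhs_side k T \<tau>) \<and>
       ((\<lambda>y::real. (1 - nome (\<i> * of_real y)) ^ (2 * k + 1) * f_eta k (\<i> * of_real y))
          \<longlongrightarrow> of_real pi ^ (2 * k + 1) / 2 ^ (4 * k + 3)) (at_right 0) \<and>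
       ((\<lambda>y::real. (1 - nome (\<i> * of_real y)) ^ (2 * k + 1) * rhs_side k T (\<i> * of_real y))
          \<longlongrightarrow> (-1) ^ k * fact (2 * k) / (2 ^ (2 * k + 1) * of_real (euler_number (2 * k)))
               * dirichlet_beta (of_nat (2 * k + 1))) (at_right 0)) \<and>
    dirichlet_beta (of_nat (2 * k + 1)) =
      (-1) ^ k * of_real (euler_number (2 * k)) / (4 ^ (k + 1) * fact (2 * k))
        * of_real pi ^ (2 * k + 1)"
proof -
  have beta: "dirichlet_beta (of_nat (2 * k + 1)) =
      (-1) ^ k * of_real (euler_number (2 * k)) / (4 ^ (k + 1) * fact (2 * k))
        * of_real pi ^ (2 * k + 1)"
    using assms by (intro dirichlet_beta_odd) simp
  have main: "summable (\<lambda>n. lambert_term k \<tau> (Suc n)) \<and> f_eta k \<tau> = rhs_side k (cusp_part k) \<tau>"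
    if "\<tau> \<in> upper_half_plane" for \<tau>
  proof -
    have t: "Im \<tau> > 0" using that by (simp add: upper_half_plane_def)
    have S: "(\<lambda>n. lambert_coeff k * lambert_term k \<tau> (Suc n)) sums eisenstein_part k \<tau>"
      by (rule has_sum_imp_sums[OF has_sum_lambert[OF t assms]])
    \<comment> \<open>The scalar in front is nonzero and can be divided out.\<close>
    have sm: "summable (\<lambda>n. lambert_term k \<tau> (Suc n))"
      using sums_summable[OF S] lambert_coeff_nonzero[OF assms] by (simp add: summable_cmult_iff)
    have "lambert_coeff k * (\<Sum>n. lambert_term k \<tau> (Suc n)) = eisenstein_part k \<tau>"
      using S sums_unique2 sums_mult[OF summable_sums[OF sm]] by blast
    thus ?thesis using sm by (simp add: rhs_side_def cusp_part_def)
  qed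
  have lim: "((\<lambda>y::real. (1 - nome (\<i> * of_real y)) ^ (2 * k + 1) * rhs_side k (cusp_part k) (\<i> * of_real y))
          \<longlongrightarrow> of_real pi ^ (2 * k + 1) / 2 ^ (4 * k + 3)) (at_right 0)"
  proof (rule Lim_transform_eventually[OF f_eta_limit[OF assms]])
    have "eventually (\<lambda>y::real. y > 0) (at_right 0)" by (rule eventually_at_right_less)
    thus "eventually (\<lambda>y::real. (1 - nome (\<i> * of_real y)) ^ (2 * k + 1) * f_eta k (\<i> * of_real y) =
       (1 - nome (\<i> * of_real y)) ^ (2 * k + 1) * rhs_side k (cusp_part k) (\<i> * of_real y)) (at_right 0)"
      by eventually_elim (simp add: main upper_half_plane_def)
  qed
  \<comment> \<open>The limit inherited from f_k is rewritten through the known beta value. The two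
    signs (-1)^k and the Euler numbers cancel, and 2^(4k+3) splits as 2^(2k+1) 4^(k+1).\<close>
  have "of_real pi ^ (2 * k + 1) / 2 ^ (4 * k + 3) =
     (-1) ^ k * fact (2 * k) / (2 ^ (2 * k + 1) * of_real (euler_number (2 * k))) * dirichlet_beta (of_nat (2 * k + 1))"
  proof -
    define E where "E = complex_of_real (euler_number (2 * k))"
    have E: "E \<noteq> 0" using euler_number_even_nonzero[of k] assms by (simp add: E_def)
    have "(2 :: complex) ^ (4 * k + 3) = 2 ^ (2 * k + 1) * 4 ^ (k + 1)"
    proof -
      have "4 * k + 3 = (2 * k + 1) + 2 * (k + 1)" by simp
      thus ?thesis by (simp only: power_add power_mult) simp
    qed
    moreover have "(-1) ^ k * (-1) ^ k = (1 :: complex)" by (simp flip: power_mult_distrib)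
    ultimately show ?thesis unfolding beta E_def [symmetric] using E by (simp add: field_simps)
  qed
  with lim have lim': "((\<lambda>y::real. (1 - nome (\<i> * of_real y)) ^ (2 * k + 1) * rhs_side k (cusp_part k) (\<i> * of_real y))
          \<longlongrightarrow> (-1) ^ k * fact (2 * k) / (2 ^ (2 * k + 1) * of_real (euler_number (2 * k)))
               * dirichlet_beta (of_nat (2 * k + 1))) (at_right 0)"
    by (simp only:)
  show ?thesis
    by (intro conjI allI bexI[of _ "cusp_part k"] ballI P_poly_coeff_Ints degree_P_poly[OF assms]
        f_eta_limit[OF assms] lim' cusp_part_in_cusp_forms[OF assms] beta) (use main in blast)+
qed

end
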